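(* Let $\mathcal{A}=\mathbb{Z}/2\mathbb{Z}$ and $\frac{1}{\sqrt2}<\alpha<1$, and let $\mu$ be the probability measure on $\mathcal{A}^{\mathbb{Z}}$ constructed from $\alpha$ as described in the context. Then $h(\mu,\sigma)=0$, $\mu$ is Lucas mixing, and $\Phi=1+\sigma$ asymptotically randomizes $\mu$.
   Context: Construction of $\mu$. For $n\in\mathbb{N}=\{0,1,2,\dots\}$ let $\rho_n$ be the probability distribution on $\mathcal{A}$ with $\rho_n\{1\}=\alpha^n$, $\rho_n\{0\}=1-\alpha^n$. Let $r^n_0,\dots,r^n_{2^n-1}$ ($n\in\mathbb{N}$) be $\mathcal{A}$-valued random variables, all jointly independent (over all $n$ and all indices), with $r^n_i$ having distribution $\rho_n$. Let $\mathbf{r}^n\in\mathcal{A}^{\mathbb{Z}}$ be the random $2^{n+1}$-periodic sequence whose coordinates $0,\dots,2^n-1$ are $0$ and whose coordinates $2^n,\dots,2^{n+1}-1$ are $r^n_0,\dots,r^n_{2^n-1}$. Put $\mathbf{a}^0=[\dots000\dots]$ and $\mathbf{a}^{n+1}=\mathbf{a}^n+\mathbf{r}^n$. Let $\mu_n$ be the distribution of $\mathbf{a}^n$, let $\widetilde\mu_n=\frac1{2^n}\sum_{i=1}^{2^n}\sigma^i(\mu_n)$, and let $\mu$ be the weak* limit of $\widetilde\mu_n$ as $n\to\infty$. $\sigma$ is the shift on $\mathcal{A}^{\mathbb{Z}}$; $(1+\sigma)(\mathbf{a})=\mathbf{a}+\sigma(\mathbf{a})$, i.e. $\Phi(\mathbf{a})_m=a_m+a_{m+1}$;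 $h(\mu,\sigma)$ is the Kolmogorov–Sinai entropy. A set $\mathbb{J}\subset\mathbb{N}$ has Cesàro density one if $\lim_{N\to\infty}\frac1N\#(\mathbb{J}\cap[0,N))=1$. $\Phi$ asymptotically randomizes $\mu$ if there is $\mathbb{J}\subset\mathbb{N}$ of Cesàro density one such that $\Phi^j\mu$ converges weak* to the uniform Bernoulli (Haar) measure as $j\to\infty$ in $\mathbb{J}$. A character of $\mathcal{A}^{\mathbb{Z}}$ is a continuous homomorphism into the circle group; each has the form $\boldsymbol\chi(\mathbf{a})=\prod_{k\in\mathbb{K}}\chi_k(a_k)$ with $\mathbb{K}\subset\mathbb{Z}$ finite and each $\chi_k$ nontrivial. For nontrivial $\boldsymbol\chi$ put $|[\boldsymbol\chi]|=\max(\mathbb{K})-\min(\mathbb{K})$ and $\langle\langle\boldsymbol\chi\rangle\rangle=2^r$ with $r=\lceil\log_2|[\boldsymbol\chi]|\rceil$ (and $\langle\langle\boldsymbol\chi\rangle\rangle=1$ if $|[\boldsymbol\chi]|=0$). $\mu$ is Lucas mixing if for every nontrivial character $\boldsymbol\chi$ there is $\mathbb{H}\subset\mathbb{N}$ of Cesàro density one with $\lim_{\mathbb{H}\ni h\to\infty}\int\boldsymbol\chi\circ\Phi^{h\cdot\langle\langle\boldsymbol\chi\rangle\rangle}\,d\mu=0$. *)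

theory Defs
  imports "HOL-Probability.Probability" "HOL-Library.Z2" "HOL-Library.Function_Algebras"
begin

text \<open>
  The alphabet \<open>\<int>/2\<int>\<close> is \<^typ>\<open>bit\<close> with the discrete topology. The configuration space is
  \<^typ>\<open>int \<Rightarrow> bit\<close>, with pointwise addition (\<^theory>\<open>HOL-Library.Function_Algebras\<close>), the product
  topology (\<^theory>\<open>HOL-Analysis.Function_Topology\<close>) and its Borel sigma-algebra.
\<close>

instantiation bit :: discrete_topology
begin

definition open_bit :: "bit set \<Rightarrow> bool"
  where "open_bit = (\<lambda>_. True)"

instance
  by standard (simp_all add: open_bit_def)

end

lemma UNIV_bit: "(UNIV :: bit set) = {0, 1}"
  by (auto intro: bit.exhaust)

instance bit :: finite
  by standard (simp add: UNIV_bit)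

instance bit :: second_countable_topology
proof
  show "\<exists>B::bit set set. countable B \<and> open = generate_topology B"
  proof (intro exI conjI)
    show "countable (UNIV :: bit set set)"
      by (rule countable_finite) simp
    show "open = generate_topology (UNIV :: bit set set)"
      by (auto simp: fun_eq_iff open_bit_def intro: generate_topology.Basis)
  qed
qed

type_synonym config = "int \<Rightarrow> bit"

lemma sets_PiM_eq_borel_config:
  "sets (PiM UNIV (\<lambda>_::int. measure_pmf p)) = sets (borel :: config measure)"
proof -
  have "sets (PiM UNIV (\<lambda>_::int. measure_pmf p)) = sets (PiM UNIV (\<lambda>_::int. borel :: bit measure))"
    by (rule sets_PiM_cong) (simp_all add: sets_borel_eq_count_space)
  then show ?thesis
    by (simp add: sets_PiM_equal_borel)
qed

definition finite_measurable_partition :: "'a measure \<Rightarrow> 'a set set \<Rightarrow> bool" where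
  "finite_measurable_partition M P \<longleftrightarrow> finite P \<and> P \<subseteq> sets M \<and> partition_on (space M) P"

text \<open>The convention \<open>0 log 0 = 0\<close> is built in, because of the factor \<open>measure M A\<close>.\<close>

definition partition_entropy :: "'a measure \<Rightarrow> 'a set set \<Rightarrow> real" where
  "partition_entropy M P = - (\<Sum>A\<in>P. measure M A * ln (measure M A))"

definition partition_join :: "'a set set \<Rightarrow> 'a set set \<Rightarrow> 'a set set" where
  "partition_join P Q = {A \<inter> B | A B. A \<in> P \<and> B \<in> Q} - {{}}"

definition pullback_partition :: "'a measure \<Rightarrow> ('a \<Rightarrow> 'a) \<Rightarrow> 'a set set \<Rightarrow> 'a set set" where
  "pullback_partition M T P = (\<lambda>A. T -` A \<inter> space M) ` P - {{}}"

text \<open>\<open>iterated_join M T P n\<close> is the join of \<open>T\<^sup>-\<^sup>k P\<close> over \<open>k < n\<close>.\<close>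

primrec iterated_join :: "'a measure \<Rightarrow> ('a \<Rightarrow> 'a) \<Rightarrow> 'a set set \<Rightarrow> nat \<Rightarrow> 'a set set" where
  "iterated_join M T P 0 = {space M}"
| "iterated_join M T P (Suc n) = partition_join (iterated_join M T P n) (pullback_partition M (T ^^ n) P)"

definition ks_entropy_wrt :: "'a measure \<Rightarrow> ('a \<Rightarrow> 'a) \<Rightarrow> 'a set set \<Rightarrow> real" where
  "ks_entropy_wrt M T P = lim (\<lambda>n. partition_entropy M (iterated_join M T P n) / real n)"

definition ks_entropy :: "'a measure \<Rightarrow> ('a \<Rightarrow> 'a) \<Rightarrow> ereal" where
  "ks_entropy M T = (SUP P \<in> {P. finite_measurable_partition M P}. ereal (ks_entropy_wrt M T P))"

definition config_shift :: "config \<Rightarrow> config" where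
  "config_shift a = (\<lambda>m. a (m + 1))"

definition Phi :: "config \<Rightarrow> config" where
  "Phi a = a + config_shift a"

lemma continuous_config_shift: "continuous_on UNIV config_shift"
  unfolding config_shift_def
  by (intro continuous_on_coordinatewise_then_product continuous_on_product_coordinates)

lemma borel_measurable_config_shift_power [measurable]: "config_shift ^^ i \<in> borel \<rightarrow>\<^sub>M borel"
proof (induction i)
  case (Suc i)
  have "config_shift \<in> borel \<rightarrow>\<^sub>M borel"
    by (rule borel_measurable_continuous_onI[OF continuous_config_shift])
  with Suc show ?case
    by simp
qed (simp add: id_def)

definition weak_star_converges ::
    "('i \<Rightarrow> 'a::topological_space measure) \<Rightarrow> 'a measure \<Rightarrow> 'i filter \<Rightarrow> bool" where
  "weak_star_converges \<nu>s \<nu> F \<longleftrightarrow>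
     (\<forall>f :: 'a \<Rightarrow> real. continuous_on UNIV f \<longrightarrow> ((\<lambda>i. \<integral>x. f x \<partial>\<nu>s i) \<longlongrightarrow> (\<integral>x. f x \<partial>\<nu>)) F)"

definition rho :: "real \<Rightarrow> nat \<Rightarrow> bit pmf" where
  "rho \<alpha> n = map_pmf of_bool (bernoulli_pmf (\<alpha> ^ n))"

text \<open>
  The independent variables \<open>r\<^sup>n\<^sub>i\<close> (\<open>i < 2^n\<close>) are realised as the coordinate functions
  \<open>\<omega> \<mapsto> \<omega> (n, i)\<close> on a product space.
\<close>

definition noise_index :: "(nat \<times> nat) set" where
  "noise_index = {(n, i). i < 2 ^ n}"

definition noise_space :: "real \<Rightarrow> (nat \<times> nat \<Rightarrow> bit) measure" where
  "noise_space \<alpha> = PiM noise_index (\<lambda>(n, i). measure_pmf (rho \<alpha> n))"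

definition r_seq :: "(nat \<times> nat \<Rightarrow> bit) \<Rightarrow> nat \<Rightarrow> config" where
  "r_seq \<omega> n = (\<lambda>m. let j = nat (m mod 2 ^ (n + 1)) in
                     if j < 2 ^ n then 0 else \<omega> (n, j - 2 ^ n))"

primrec a_seq :: "(nat \<times> nat \<Rightarrow> bit) \<Rightarrow> nat \<Rightarrow> config" where
  "a_seq \<omega> 0 = 0"
| "a_seq \<omega> (Suc n) = a_seq \<omega> n + r_seq \<omega> n"

definition mu_n :: "real \<Rightarrow> nat \<Rightarrow> config measure" where
  "mu_n \<alpha> n = distr (noise_space \<alpha>) borel (\<lambda>\<omega>. a_seq \<omega> n)"

definition mu_tilde :: "real \<Rightarrow> nat \<Rightarrow> config measure" where
  "mu_tilde \<alpha> n = measure_of UNIV (sets borel)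
     (\<lambda>A. (\<Sum>i = 1..2 ^ n. emeasure (distr (mu_n \<alpha> n) borel (config_shift ^^ i)) A) / 2 ^ n)"

text \<open>
  A weak* limit is unique, because a Borel probability measure on this compact metrizable space is
  determined by its integrals of continuous functions. \<open>THE\<close> selects it, so statements about
  \<open>mu \<alpha>\<close> also rely on its existence.
\<close>

definition mu :: "real \<Rightarrow> config measure" where
  "mu \<alpha> = (THE \<nu>. prob_space \<nu> \<and> sets \<nu> = sets borel \<and>
                  weak_star_converges (mu_tilde \<alpha>) \<nu> sequentially)"

text \<open>
  The next lemmas show that the totalised operations above (\<^const>\<open>distr\<close>, \<^const>\<open>measure_of\<close>,
  \<^const>\<open>bernoulli_pmf\<close>) are applied inside their domain, so that they carry their intended meaning.
\<close>

lemma pmf_rho: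
  assumes "0 \<le> \<alpha>" "\<alpha> \<le> 1"
  shows "pmf (rho \<alpha> n) 1 = \<alpha> ^ n" "pmf (rho \<alpha> n) 0 = 1 - \<alpha> ^ n"
proof -
  have inj: "inj (of_bool :: bool \<Rightarrow> bit)"
    by (auto simp: inj_def)
  have p: "0 \<le> \<alpha> ^ n" "\<alpha> ^ n \<le> 1"
    using assms by (auto simp: power_le_one)
  show "pmf (rho \<alpha> n) 1 = \<alpha> ^ n"
    using pmf_map_inj'[OF inj, of "bernoulli_pmf (\<alpha> ^ n)" True] p by (simp add: rho_def)
  show "pmf (rho \<alpha> n) 0 = 1 - \<alpha> ^ n"
    using pmf_map_inj'[OF inj, of "bernoulli_pmf (\<alpha> ^ n)" False] p by (simp add: rho_def)
qed

lemma prob_space_noise: "prob_space (noise_space \<alpha>)"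
  unfolding noise_space_def by (intro prob_space_PiM) (auto simp: prob_space_measure_pmf)

lemma distr_noise:
  assumes "i < 2 ^ n"
  shows "distr (noise_space \<alpha>) (measure_pmf (rho \<alpha> n)) (\<lambda>\<omega>. \<omega> (n, i)) = measure_pmf (rho \<alpha> n)"
  using distr_PiM_component[of noise_index "\<lambda>(n, i). measure_pmf (rho \<alpha> n)" "(n, i)"] assms
  by (auto simp: noise_space_def noise_index_def prob_space_measure_pmf)

lemma indep_noise:
  "prob_space.indep_vars (noise_space \<alpha>) (\<lambda>(n, i). measure_pmf (rho \<alpha> n))
     (\<lambda>x \<omega>. \<omega> x) noise_index"
proof -
  interpret prob_space "noise_space \<alpha>"
    by (rule prob_space_noise)
  let ?M = "\<lambda>(n, i). measure_pmf (rho \<alpha> n)"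
  have comp: "(\<lambda>\<omega>. \<omega> x) \<in> noise_space \<alpha> \<rightarrow>\<^sub>M ?M x" if "x \<in> noise_index" for x
    using that unfolding noise_space_def by (rule measurable_component_singleton)
  have "distr (noise_space \<alpha>) (PiM noise_index ?M) (\<lambda>\<omega>. \<lambda>x\<in>noise_index. \<omega> x)
      = distr (noise_space \<alpha>) (noise_space \<alpha>) (\<lambda>\<omega>. \<omega>)"
    by (rule distr_cong) (auto simp: noise_space_def space_PiM PiE_restrict)
  also have "\<dots> = PiM noise_index (\<lambda>x. distr (noise_space \<alpha>) (?M x) (\<lambda>\<omega>. \<omega> x))"
    unfolding distr_id
    by (subst (1) noise_space_def, rule PiM_cong) (auto simp: noise_index_def distr_noise)
  finally have eq: "distr (noise_space \<alpha>) (PiM noise_index ?M) (\<lambda>\<omega>. \<lambda>x\<in>noise_index. \<omega> x)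
      = PiM noise_index (\<lambda>x. distr (noise_space \<alpha>) (?M x) (\<lambda>\<omega>. \<omega> x))" .
  have "(0, 0) \<in> noise_index"
    by (simp add: noise_index_def)
  then have "noise_index \<noteq> {}"
    by blast
  with comp eq show ?thesis
    by (subst indep_vars_iff_distr_eq_PiM')
qed

lemma measurable_a_seq [measurable]: "(\<lambda>\<omega>. a_seq \<omega> n) \<in> noise_space \<alpha> \<rightarrow>\<^sub>M borel"
proof -
  have r: "(\<lambda>\<omega>. r_seq \<omega> n m) \<in> noise_space \<alpha> \<rightarrow>\<^sub>M count_space UNIV" for n m
  proof (cases "nat (m mod 2 ^ (n + 1)) < 2 ^ n")
    case True
    then show ?thesis
      by (simp add: r_seq_def)
  next
    case False
    have "nat (m mod 2 ^ (n + 1)) < 2 ^ (n + 1)"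
      by (simp add: nat_less_iff)
    then have "(n, nat (m mod 2 ^ (n + 1)) - 2 ^ n) \<in> noise_index"
      using False by (simp add: noise_index_def)
    then have "(\<lambda>\<omega>. \<omega> (n, nat (m mod 2 ^ (n + 1)) - 2 ^ n))
        \<in> noise_space \<alpha> \<rightarrow>\<^sub>M measure_pmf (rho \<alpha> n)"
      unfolding noise_space_def
      using measurable_component_singleton[of "(n, nat (m mod 2 ^ (n + 1)) - 2 ^ n)" noise_index
          "\<lambda>(n, i). measure_pmf (rho \<alpha> n)"] by simp
    moreover have "measurable (noise_space \<alpha>) (measure_pmf (rho \<alpha> n))
        = measurable (noise_space \<alpha>) (count_space UNIV)"
      by (rule measurable_cong_sets) simp_all
    ultimately show ?thesis
      using False by (simp add: r_seq_def Let_def)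
  qed
  have a: "(\<lambda>\<omega>. a_seq \<omega> n m) \<in> noise_space \<alpha> \<rightarrow>\<^sub>M count_space UNIV" for m
  proof (induction n)
    case (Suc n)
    note [measurable] = Suc r
    have "(\<lambda>\<omega>. (\<lambda>(x, y). x + y) (a_seq \<omega> n m, r_seq \<omega> n m)) \<in> noise_space \<alpha> \<rightarrow>\<^sub>M count_space UNIV"
    proof (rule measurable_compose[where N = "count_space UNIV \<Otimes>\<^sub>M count_space UNIV"])
      show "(\<lambda>(x, y). x + y) \<in> (count_space UNIV :: bit measure) \<Otimes>\<^sub>M count_space UNIV
          \<rightarrow>\<^sub>M count_space UNIV"
        by (simp add: pair_measure_countable)
    qed measurable
    then show ?case
      by simp
  qed simp
  have "(\<lambda>\<omega>. a_seq \<omega> n) \<in> noise_space \<alpha> \<rightarrow>\<^sub>M PiM UNIV (\<lambda>_. borel)"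
    using a by (intro measurable_PiM_single')
      (auto simp: measurable_cong_sets[OF refl sets_borel_eq_count_space])
  then show ?thesis
    by (simp add: measurable_cong_sets[OF refl sets_PiM_equal_borel])
qed

lemma prob_space_mu_n: "prob_space (mu_n \<alpha> n)"
  unfolding mu_n_def by (rule prob_space.prob_space_distr[OF prob_space_noise measurable_a_seq])

lemma sets_mu_tilde: "sets (mu_tilde \<alpha> n) = sets borel"
  unfolding mu_tilde_def by (metis sets.sets_measure_of_eq space_borel)

lemma emeasure_mu_tilde:
  assumes "A \<in> sets borel"
  shows "emeasure (mu_tilde \<alpha> n) A =
    (\<Sum>i = 1..2 ^ n. emeasure (distr (mu_n \<alpha> n) borel (config_shift ^^ i)) A) / 2 ^ n"
proof (rule emeasure_measure_of[OF mu_tilde_def])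
  show "sets borel \<subseteq> Pow (UNIV :: config set)" "A \<in> sets (mu_tilde \<alpha> n)"
    using assms by (simp_all add: sets_mu_tilde)
  show "positive (sets (mu_tilde \<alpha> n))
     (\<lambda>A. (\<Sum>i = 1..2 ^ n. emeasure (distr (mu_n \<alpha> n) borel (config_shift ^^ i)) A) / 2 ^ n)"
    by (simp add: positive_def)
  show "countably_additive (sets (mu_tilde \<alpha> n))
     (\<lambda>A. (\<Sum>i = 1..2 ^ n. emeasure (distr (mu_n \<alpha> n) borel (config_shift ^^ i)) A) / 2 ^ n)"
  proof (rule countably_additiveI)
    fix B :: "nat \<Rightarrow> config set"
    assume B: "range B \<subseteq> sets (mu_tilde \<alpha> n)" "disjoint_family B"
    have "(\<Sum>k. (\<Sum>i = 1..2 ^ n. emeasure (distr (mu_n \<alpha> n) borel (config_shift ^^ i)) (B k)) / 2 ^ n)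
        = (\<Sum>i = 1..2 ^ n. \<Sum>k. emeasure (distr (mu_n \<alpha> n) borel (config_shift ^^ i)) (B k)) / 2 ^ n"
      by (simp add: divide_ennreal_def ennreal_suminf_multc suminf_sum)
    also have "\<dots> = (\<Sum>i = 1..2 ^ n. emeasure (distr (mu_n \<alpha> n) borel (config_shift ^^ i)) (\<Union>k. B k)) / 2 ^ n"
      using B by (intro arg_cong[where f = "\<lambda>x. x / 2 ^ n"] sum.cong refl suminf_emeasure)
        (auto simp: sets_mu_tilde)
    finally show "(\<Sum>k. (\<Sum>i = 1..2 ^ n. emeasure (distr (mu_n \<alpha> n) borel (config_shift ^^ i)) (B k)) / 2 ^ n)
        = (\<Sum>i = 1..2 ^ n. emeasure (distr (mu_n \<alpha> n) borel (config_shift ^^ i)) (\<Union>k. B k)) / 2 ^ n" .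
  qed
qed

definition cesaro_density_one :: "nat set \<Rightarrow> bool" where
  "cesaro_density_one J \<longleftrightarrow> (\<lambda>N. real (card (J \<inter> {0..<N})) / real N) \<longlonglongrightarrow> 1"

text \<open>
  The uniform Bernoulli measure; by \<open>sets_PiM_eq_borel_config\<close>, transporting along the identity
  only renames the sigma-algebra.
\<close>

definition haar :: "config measure" where
  "haar = distr (PiM UNIV (\<lambda>_::int. measure_pmf (pmf_of_set (UNIV :: bit set)))) borel (\<lambda>a. a)"

text \<open>Limits as \<open>j \<rightarrow> \<infinity>\<close> in \<open>J\<close> are limits along the filter \<open>sequentially \<sqinter> principal J\<close>.\<close>

definition asymptotically_randomizes :: "(config \<Rightarrow> config) \<Rightarrow> config measure \<Rightarrow> bool" where
  "asymptotically_randomizes F \<nu> \<longleftrightarrow>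
     (\<exists>J. cesaro_density_one J \<and>
          weak_star_converges (\<lambda>j. distr \<nu> borel (F ^^ j)) haar (inf sequentially (principal J)))"

definition is_character :: "('a::{topological_space, plus} \<Rightarrow> complex) \<Rightarrow> bool" where
  "is_character \<xi> \<longleftrightarrow>
     continuous_on UNIV \<xi> \<and> (\<forall>a. norm (\<xi> a) = 1) \<and> (\<forall>a b. \<xi> (a + b) = \<xi> a * \<xi> b)"

definition nontrivial_character :: "('a::{topological_space, plus} \<Rightarrow> complex) \<Rightarrow> bool" where
  "nontrivial_character \<xi> \<longleftrightarrow> is_character \<xi> \<and> \<xi> \<noteq> (\<lambda>_. 1)"

text \<open>
  \<open>THE\<close> is legitimate for characters: \<open>K\<close> is determined by \<open>\<xi>\<close>, as the set of coordinates on
  which \<open>\<xi>\<close> depends, and continuity makes it finite.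
\<close>

definition character_support :: "(config \<Rightarrow> complex) \<Rightarrow> int set" where
  "character_support \<xi> = (THE K. finite K \<and>
     (\<exists>c :: int \<Rightarrow> bit \<Rightarrow> complex. (\<forall>k\<in>K. nontrivial_character (c k)) \<and>
        (\<forall>a. \<xi> a = (\<Prod>k\<in>K. c k (a k)))))"

definition character_width :: "(config \<Rightarrow> complex) \<Rightarrow> nat" where
  "character_width \<xi> = nat (Max (character_support \<xi>) - Min (character_support \<xi>))"

definition character_scale :: "(config \<Rightarrow> complex) \<Rightarrow> nat" where
  "character_scale \<xi> =
     (if character_width \<xi> = 0 then 1 else 2 ^ nat \<lceil>log 2 (real (character_width \<xi>))\<rceil>)"

definition Lucas_mixing :: "config measure \<Rightarrow> bool" where
  "Lucas_mixing \<nu> \<longleftrightarrow>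
     (\<forall>\<xi>. nontrivial_character \<xi> \<longrightarrow>
        (\<exists>H. cesaro_density_one H \<and>
             ((\<lambda>h. \<integral>a. \<xi> ((Phi ^^ (h * character_scale \<xi>)) a) \<partial>\<nu>) \<longlongrightarrow> 0)
               (inf sequentially (principal H))))"

end

theory Submission
  imports Defs "HOL-Computational_Algebra.Polynomial"
begin

text \<open>
  Sign-valued characters of the configuration space are the Walsh functions \<open>walsh K\<close> for finite
  \<open>K\<close>, and they control everything about mixing. The linear map \<open>Phi\<close> turns \<open>walsh K\<close> into
  another Walsh function: reading \<open>K\<close> as a polynomial \<open>p\<close> over the two-element field,
  \<open>Phi ^^ h\<close> multiplies \<open>p\<close> by \<open>(1 + x) ^ h\<close>. By Lucas' theorem the number of terms of that
  product is about \<open>2\<close> to the number of ones in the binary expansion of \<open>h\<close>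
  (\<open>weight_mult_power_ge\<close>), hence at least \<open>h\<close> to a power arbitrarily close to \<open>1 / 2\<close> for almost
  all \<open>h\<close> (\<open>density_one_many_ones\<close>, by Chebyshev's inequality).

  On the other side, the integral of \<open>walsh K\<close> against \<open>mu \<alpha>\<close> is small as soon as \<open>K\<close> is large
  compared with its diameter. Seen from a uniformly random phase, a set \<open>K\<close> of diameter less than
  \<open>2 ^ J\<close> is, with probability close to \<open>1\<close>, contained in the upper half of a period of some
  \<open>r\<^sup>j\<close> with \<open>j\<close> between \<open>J\<close> and \<open>J + 2 * M\<close>. It then meets \<open>card K\<close> independent variables
  of level \<open>j\<close>, each contributing a factor \<open>1 - 2 * \<alpha> ^ j\<close>, so that the integral is at most about
  \<open>(1 - 2 * \<alpha> ^ (J + 2 * M)) ^ card K\<close> (\<open>walsh_integral_le\<close>). For \<open>K\<close> coming from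
  \<open>(1 + x) ^ h\<close> one has \<open>2 ^ J \<approx> h\<close> and \<open>card K \<approx> sqrt h\<close>; the bound tends to \<open>0\<close> when
  \<open>\<alpha> ^ J * card K\<close> tends to infinity, and this is where \<open>\<alpha> > 1 / sqrt 2\<close> enters. Convergence of
  the Walsh integrals gives Lucas mixing directly, and asymptotic randomization because the Walsh
  functions span the continuous functions densely.

  The entropy vanishes because the summability of \<open>\<alpha> ^ n\<close> makes \<open>mu \<alpha>\<close> a limit, in the metric of
  expected proportion of differing coordinates, of periodic processes. This uses a coupling in which a single
  probability space carries the noise and a 2-adic random phase: there the approximants \<open>approx n\<close>
  have law \<open>mu_tilde \<alpha> n\<close>, are \<open>2 ^ n\<close>-periodic, and differ from the limit at a given coordinate
  with probability at most \<open>\<alpha> ^ n / (1 - \<alpha>)\<close> (\<open>prob_limit_neq_approx\<close>). The itinerary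
  of a point is then on average close in Hamming distance to one of boundedly many names, whatever its length, and
  \<open>partition_entropy_le_hamming\<close> turns this into a bound on the entropy.
\<close>

section \<open>Sets of density one and binary digits\<close>

text \<open>
  These rules rewrite the field operations of \<^typ>\<open>bit\<close> to bit operations, which breaks
  algebraic normalisation.
\<close>

declare add_bit_eq_xor [simp del] mult_bit_eq_and [simp del]

definition density_zero :: "nat set \<Rightarrow> bool" where
  "density_zero B \<longleftrightarrow> (\<lambda>N. real (card (B \<inter> {0..<N})) / real N) \<longlonglongrightarrow> 0"

lemma cesaro_density_one_iff: "cesaro_density_one A \<longleftrightarrow> density_zero (- A)"
proof -
  have eq: "1 - real (card (A \<inter> {0..<N})) / real N = real (card (- A \<inter> {0..<N})) / real N"
    if "N > 0" for N
  proof -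
    have "card (A \<inter> {0..<N}) + card (- A \<inter> {0..<N}) = card ((A \<inter> {0..<N}) \<union> (- A \<inter> {0..<N}))"
      by (subst card_Un_disjoint) auto
    also have "(A \<inter> {0..<N}) \<union> (- A \<inter> {0..<N}) = {0..<N}"
      by auto
    finally have "real (card (A \<inter> {0..<N})) + real (card (- A \<inter> {0..<N})) = real N"
      by (simp flip: of_nat_add)
    with that show ?thesis
      by (simp add: field_simps)
  qed
  have "density_zero (- A) \<longleftrightarrow> (\<lambda>N. 1 - real (card (A \<inter> {0..<N})) / real N) \<longlonglongrightarrow> 0"
    unfolding density_zero_def
    by (rule tendsto_cong) (auto simp: eq intro!: eventually_mono[OF eventually_gt_at_top[of 0]])
  also have "\<dots> \<longleftrightarrow> cesaro_density_one A"
  proof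
    assume "(\<lambda>N. 1 - real (card (A \<inter> {0..<N})) / real N) \<longlonglongrightarrow> 0"
    from tendsto_diff[OF tendsto_const[of 1] this] show "cesaro_density_one A"
      by (simp add: cesaro_density_one_def)
  next
    assume "cesaro_density_one A"
    from tendsto_diff[OF tendsto_const[of 1] this[unfolded cesaro_density_one_def]]
    show "(\<lambda>N. 1 - real (card (A \<inter> {0..<N})) / real N) \<longlonglongrightarrow> 0"
      by simp
  qed
  finally show ?thesis ..
qed

lemma density_zero_bound:
  assumes "density_zero B" "\<And>N. card (A \<inter> {0..<N}) \<le> c * card (B \<inter> {0..<N}) + d"
  shows "density_zero A"
  unfolding density_zero_def
proof (rule tendsto_sandwich)
  show "\<forall>\<^sub>F N in sequentially. 0 \<le> real (card (A \<inter> {0..<N})) / real N"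
    by simp
  have "real (card (A \<inter> {0..<N})) \<le> real c * real (card (B \<inter> {0..<N})) + real d" for N
    using assms(2)[of N] by (metis of_nat_add of_nat_le_iff of_nat_mult)
  then show "\<forall>\<^sub>F N in sequentially. real (card (A \<inter> {0..<N})) / real N
      \<le> real c * (real (card (B \<inter> {0..<N})) / real N) + real d / real N"
    by (intro always_eventually) (auto simp flip: add_divide_distrib intro!: divide_right_mono)
  have "(\<lambda>N. real d / real N) \<longlonglongrightarrow> 0"
    by (rule lim_const_over_n)
  from tendsto_add[OF tendsto_mult[OF tendsto_const assms(1)[unfolded density_zero_def]] this]
  show "(\<lambda>N. real c * (real (card (B \<inter> {0..<N})) / real N) + real d / real N) \<longlonglongrightarrow> 0"
    by simp
qed simp

lemma density_zero_Un:
  assumes "density_zero A" "density_zero B"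
  shows "density_zero (A \<union> B)"
  unfolding density_zero_def
proof (rule tendsto_sandwich)
  show "\<forall>\<^sub>F N in sequentially. 0 \<le> real (card ((A \<union> B) \<inter> {0..<N})) / real N"
    by simp
  have "real (card ((A \<union> B) \<inter> {0..<N})) \<le> real (card (A \<inter> {0..<N})) + real (card (B \<inter> {0..<N}))" for N
    using card_Un_le[of "A \<inter> {0..<N}" "B \<inter> {0..<N}"]
    by (simp add: Int_Un_distrib2 flip: of_nat_add)
  then show "\<forall>\<^sub>F N in sequentially. real (card ((A \<union> B) \<inter> {0..<N})) / real N
      \<le> real (card (A \<inter> {0..<N})) / real N + real (card (B \<inter> {0..<N})) / real N"
    by (intro always_eventually) (auto simp flip: add_divide_distrib intro!: divide_right_mono)
  show "(\<lambda>N. real (card (A \<inter> {0..<N})) / real N + real (card (B \<inter> {0..<N})) / real N) \<longlonglongrightarrow> 0"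
    using tendsto_add[OF assms[unfolded density_zero_def]] by simp
qed simp

lemma density_zero_UN_atMost:
  assumes "\<And>i. density_zero (A i)"
  shows "density_zero (\<Union>i\<le>k::nat. A i)"
proof (induction k)
  case (Suc k)
  then show ?case
    unfolding atMost_Suc UN_insert by (intro density_zero_Un assms)
qed (use assms in simp)

lemma density_zero_vimage_Suc:
  assumes "density_zero B"
  shows "density_zero {h. Suc h \<in> B}"
proof (rule density_zero_bound[OF assms, where c = 1 and d = 1])
  fix N
  have "card ({h. Suc h \<in> B} \<inter> {0..<N}) = card (Suc ` ({h. Suc h \<in> B} \<inter> {0..<N}))"
    by (simp add: card_image)
  also have "\<dots> \<le> card ((B \<inter> {0..<N}) \<union> {N})"
    by (rule card_mono) auto
  also have "\<dots> \<le> card (B \<inter> {0..<N}) + 1"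
    by (rule order_trans[OF card_Un_le]) simp
  finally show "card ({h. Suc h \<in> B} \<inter> {0..<N}) \<le> 1 * card (B \<inter> {0..<N}) + 1"
    by simp
qed

text \<open>
  Each \<open>q\<close> has only \<open>R\<close> preimages under \<open>\<lambda>h. h div R\<close>, all of them at least \<open>q\<close>.
\<close>

lemma density_zero_vimage_div:
  assumes "density_zero B" "R > 0"
  shows "density_zero {h. h div R \<in> B}"
proof (rule density_zero_bound[OF assms(1), where c = R and d = 0])
  fix N
  have "card ({h. h div R \<in> B} \<inter> {0..<N}) \<le> card ((\<lambda>(q, t). q * R + t) ` ((B \<inter> {0..<N}) \<times> {0..<R}))"
  proof (rule card_mono)
    show "{h. h div R \<in> B} \<inter> {0..<N} \<subseteq> (\<lambda>(q, t). q * R + t) ` ((B \<inter> {0..<N}) \<times> {0..<R})"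
    proof
      fix h assume "h \<in> {h. h div R \<in> B} \<inter> {0..<N}"
      moreover have "h div R \<le> h"
        by simp
      ultimately have "(h div R, h mod R) \<in> (B \<inter> {0..<N}) \<times> {0..<R}"
        using assms(2) le_less_trans[of "h div R" h N] by auto
      moreover have "h = (\<lambda>(q, t). q * R + t) (h div R, h mod R)"
        by simp
      ultimately show "h \<in> (\<lambda>(q, t). q * R + t) ` ((B \<inter> {0..<N}) \<times> {0..<R})"
        by blast
    qed
  qed auto
  also have "\<dots> \<le> card ((B \<inter> {0..<N}) \<times> {0..<R})"
    by (rule card_image_le) auto
  finally show "card ({h. h div R \<in> B} \<inter> {0..<N}) \<le> R * card (B \<inter> {0..<N}) + 0"
    by (simp add: card_cartesian_product mult.commute)
qed

text \<open>
  A single set of density one that is eventually contained in every \<open>A k\<close>: between the thresholds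
  \<open>m k\<close> and \<open>m (Suc k)\<close> it may follow \<open>A k\<close>, whose initial proportion is by then close to one.
  This is what allows one set of times to serve all characters at once.
\<close>

lemma cesaro_density_one_diagonal:
  assumes A: "\<And>k. cesaro_density_one (A k)" and dec: "decseq A"
  obtains J where "cesaro_density_one J" "\<And>k. \<exists>m. \<forall>h\<in>J. m \<le> h \<longrightarrow> h \<in> A k"
proof -
  have "\<exists>m. m \<ge> k \<and> (\<forall>N\<ge>m. 1 - 1 / real (Suc k) < real (card (A k \<inter> {0..<N})) / real N)" for k
  proof -
    have "\<forall>\<^sub>F N in sequentially. 1 - 1 / real (Suc k) < real (card (A k \<inter> {0..<N})) / real N"
      using A[of k] unfolding cesaro_density_one_def by (rule order_tendstoD) simp
    then obtain m where "\<forall>N\<ge>m. 1 - 1 / real (Suc k) < real (card (A k \<inter> {0..<N})) / real N"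
      by (auto simp: eventually_sequentially)
    then show ?thesis
      by (intro exI[of _ "max k m"]) auto
  qed
  then obtain m where m: "\<And>k. m k \<ge> k"
    "\<And>k N. N \<ge> m k \<Longrightarrow> 1 - 1 / real (Suc k) < real (card (A k \<inter> {0..<N})) / real N"
    by metis
  \<comment> \<open>Up to N the set A k is decisive for the largest k with m k \<le> N, since it is contained in all earlier ones.\<close>
  define J where "J = {h. \<forall>k. m k \<le> h \<longrightarrow> h \<in> A k}"
  have lower: "1 - 1 / real (Suc k) < real (card (J \<inter> {0..<N})) / real N" if "N \<ge> m k" for k N
  proof -
    have fin: "finite {j. m j \<le> N}"
      by (rule finite_subset[of _ "{..N}"]) (use m(1) order_trans in auto)
    define k' where "k' = Max {j. m j \<le> N}"
    have k': "m k' \<le> N" "k \<le> k'"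
      using Max_in[OF fin] Max_ge[OF fin, of k] that by (auto simp: k'_def)
    have max: "j \<le> k'" if "m j \<le> N" for j
      using Max_ge[OF fin, of j] that by (simp add: k'_def)
    have "A k' \<inter> {0..<N} \<subseteq> J \<inter> {0..<N}"
    proof
      fix h assume h: "h \<in> A k' \<inter> {0..<N}"
      have "h \<in> A j" if "m j \<le> h" for j
        using decseqD[OF dec max[of j]] that h by auto
      with h show "h \<in> J \<inter> {0..<N}"
        by (auto simp: J_def)
    qed
    then have "card (A k' \<inter> {0..<N}) \<le> card (J \<inter> {0..<N})"
      by (intro card_mono) auto
    then have "real (card (A k' \<inter> {0..<N})) / real N \<le> real (card (J \<inter> {0..<N})) / real N"
      by (intro divide_right_mono) auto
    moreover have "1 - 1 / real (Suc k) \<le> 1 - 1 / real (Suc k')"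
      using k'(2) by (simp add: frac_le)
    ultimately show ?thesis
      using m(2)[OF k'(1)] by linarith
  qed
  have "cesaro_density_one J"
    unfolding cesaro_density_one_def
  proof (rule LIMSEQ_I)
    fix e :: real assume "e > 0"
    then obtain k where k: "1 / real (Suc k) < e"
      using nat_approx_posE by blast
    show "\<exists>no. \<forall>N\<ge>no. norm (real (card (J \<inter> {0..<N})) / real N - 1) < e"
    proof (intro exI allI impI)
      fix N assume N: "m k \<le> N"
      have "card (J \<inter> {0..<N}) \<le> card {0..<N}"
        by (rule card_mono) auto
      then have "real (card (J \<inter> {0..<N})) / real N \<le> 1"
        by (auto simp: divide_le_eq)
      with lower[OF N] k show "norm (real (card (J \<inter> {0..<N})) / real N - 1) < e"
        by (simp add: abs_if)
    qed
  qed
  moreover have "\<exists>m. \<forall>h\<in>J. m \<le> h \<longrightarrow> h \<in> A k" for k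
    by (auto simp: J_def)
  ultimately show ?thesis
    by (rule that)
qed

text \<open>
  By Lucas' theorem \<open>2 ^ ones n\<close> is the number of odd binomial coefficients \<open>n choose k\<close>.
\<close>

fun ones :: "nat \<Rightarrow> nat" where
  "ones n = (if n = 0 then 0 else ones (n div 2) + n mod 2)"

declare ones.simps [simp del]

lemma ones_double: "ones (2 * n) = ones n" "ones (Suc (2 * n)) = Suc (ones n)"
  by (simp_all add: ones.simps[of "2 * n"] ones.simps[of "Suc (2 * n)"] ones.simps[of 0])

lemma sum_lessThan_double:
  fixes f :: "nat \<Rightarrow> 'a::comm_monoid_add"
  shows "(\<Sum>h<2 * n. f h) = (\<Sum>h<n. f (2 * h) + f (Suc (2 * h)))"
  by (induction n) (simp_all add: algebra_simps)

text \<open>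
  The variance of a binomial distribution: the digits of a random number below \<open>2 ^ n\<close> are
  independent fair coins.
\<close>

lemma sum_ones_variance: "(\<Sum>h<2 ^ n. (2 * real (ones h) - real n)\<^sup>2) = real n * 2 ^ n"
proof (induction n)
  case 0
  show ?case
    by (simp add: ones.simps[of 0])
next
  case (Suc n)
  have "(\<Sum>h<2 ^ Suc n. (2 * real (ones h) - real (Suc n))\<^sup>2)
    = (\<Sum>h<2 ^ n. 2 * (2 * real (ones h) - real n)\<^sup>2 + 2)"
    unfolding power_Suc sum_lessThan_double
    by (intro sum.cong refl) (simp only: ones_double of_nat_Suc power2_eq_square, simp add: algebra_simps)
  also have "\<dots> = real (Suc n) * 2 ^ Suc n"
    unfolding sum.distrib sum_distrib_left[symmetric] Suc.IH by (simp add: algebra_simps)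
  finally show ?case .
qed

lemma card_few_ones:
  assumes "\<kappa> > 0" "n > 0"
  shows "real (card {h. h < 2 ^ n \<and> 2 * real (ones h) \<le> real n - \<kappa> * real n}) \<le> 2 ^ n / (\<kappa>\<^sup>2 * real n)"
    (is "real (card ?B) \<le> _")
proof -
  have "(\<kappa> * real n)\<^sup>2 \<le> (2 * real (ones h) - real n)\<^sup>2" if "h \<in> ?B" for h
  proof -
    have "0 < \<kappa> * real n"
      using assms by simp
    with that show ?thesis
      by (subst abs_le_square_iff[symmetric]) (auto simp: abs_if)
  qed
  then have "(\<Sum>h\<in>?B. (\<kappa> * real n)\<^sup>2) \<le> (\<Sum>h\<in>?B. (2 * real (ones h) - real n)\<^sup>2)"
    by (rule sum_mono)
  also have "\<dots> \<le> (\<Sum>h<2 ^ n. (2 * real (ones h) - real n)\<^sup>2)"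
    by (rule sum_mono2) auto
  finally have "real (card ?B) * (\<kappa> * real n)\<^sup>2 \<le> real n * 2 ^ n"
    by (simp add: sum_ones_variance)
  then have "real n * (real (card ?B) * (\<kappa>\<^sup>2 * real n)) \<le> real n * 2 ^ n"
    by (simp add: power2_eq_square mult_ac)
  then have "real (card ?B) * (\<kappa>\<^sup>2 * real n) \<le> 2 ^ n"
    using assms by (simp only: mult_le_cancel_left_pos of_nat_0_less_iff)
  with assms show ?thesis
    by (simp add: pos_le_divide_eq)
qed

definition bit_length :: "nat \<Rightarrow> nat" where
  "bit_length h = (LEAST n. h < 2 ^ n)"

lemma less_power_bit_length: "h < 2 ^ bit_length h"
  unfolding bit_length_def by (rule LeastI[of _ h]) (rule less_exp)

lemma bit_length_le: "h < 2 ^ n \<Longrightarrow> bit_length h \<le> n"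
  unfolding bit_length_def by (rule Least_le)

text \<open>
  For typical \<open>h < 2 ^ n\<close> there are about \<open>n / 2\<close> ones, so the quantity is about
  \<open>(sqrt 2 * \<alpha>) ^ n\<close>, and the base exceeds \<open>1\<close>. The deviations are controlled by Chebyshev's
  inequality.
\<close>

lemma density_one_many_ones:
  assumes "1 / sqrt 2 < \<alpha>" "\<alpha> < 1"
  shows "cesaro_density_one {h. C \<le> 2 ^ ones h * \<alpha> ^ bit_length h}"
proof -
  have a0: "0 < \<alpha>"
    using assms(1) by (rule less_trans[rotated]) simp
  have "1 < (sqrt 2 * \<alpha>)"
    using assms(1) by (simp add: field_simps)
  then have "1 < (sqrt 2 * \<alpha>)\<^sup>2"
    by (simp add: one_less_power)
  then have a2: "1 < 2 * \<alpha>\<^sup>2"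
    by (simp add: power_mult_distrib)
  define \<beta> where "\<beta> = - log 2 \<alpha>"
  have "log 2 1 < log 2 (2 * \<alpha>\<^sup>2)"
    using a2 by (subst log_less_cancel_iff) auto
  also have "log 2 (2 * \<alpha>\<^sup>2) = 1 - 2 * \<beta>"
    using a0 by (simp add: log_mult log_nat_power \<beta>_def)
  finally have b: "2 * \<beta> < 1"
    by simp
  \<comment> \<open>The set can only fail to contain h if the proportion of ones in h is below about \<beta> < 1 / 2;
     half of the gap absorbs the additive constant log C'.\<close>
  define \<kappa> where "\<kappa> = (1 - 2 * \<beta>) / 2"
  have k: "\<kappa> > 0"
    using b by (simp add: \<kappa>_def)
  define C' where "C' = max C 1"
  let ?B = "- {h. C \<le> 2 ^ ones h * \<alpha> ^ bit_length h}"
  obtain n0 where n0: "real n0 \<ge> 2 * log 2 C' / \<kappa>"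
    using real_arch_simple by blast
  have few: "card (?B \<inter> {0..<2 ^ n}) \<le> 2 ^ n / (\<kappa>\<^sup>2 * real n)" if "n \<ge> n0" "n > 0" for n
  proof -
    have "?B \<inter> {0..<2 ^ n} \<subseteq> {h. h < 2 ^ n \<and> 2 * real (ones h) \<le> real n - \<kappa> * real n}"
    proof
      fix h assume h: "h \<in> ?B \<inter> {0..<2 ^ n}"
      then have "\<alpha> ^ n \<le> \<alpha> ^ bit_length h"
        using a0 assms by (intro power_decreasing bit_length_le) auto
      then have "2 ^ ones h * \<alpha> ^ n \<le> 2 ^ ones h * \<alpha> ^ bit_length h"
        by simp
      also have "\<dots> < C'"
        using h by (auto simp: C'_def less_max_iff_disj)
      finally have "log 2 (2 ^ ones h * \<alpha> ^ n) < log 2 C'"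
        using a0 by (subst log_less_cancel_iff) (auto simp: C'_def)
      then have "real (ones h) - real n * \<beta> < log 2 C'"
        using a0 by (simp add: log_mult log_nat_power \<beta>_def)
      moreover have "2 * log 2 C' \<le> \<kappa> * real n"
        using n0 that k by (simp add: field_simps) (smt (verit) mult_left_mono of_nat_le_iff)
      ultimately have "2 * real (ones h) \<le> 2 * real n * \<beta> + \<kappa> * real n"
        by linarith
      also have "\<dots> = real n - \<kappa> * real n"
        by (simp add: \<kappa>_def algebra_simps)
      finally show "h \<in> {h. h < 2 ^ n \<and> 2 * real (ones h) \<le> real n - \<kappa> * real n}"
        using h by auto
    qed
    then have "card (?B \<inter> {0..<2 ^ n}) \<le> card {h. h < 2 ^ n \<and> 2 * real (ones h) \<le> real n - \<kappa> * real n}"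
      by (intro card_mono) auto
    with card_few_ones[OF k that(2)] show ?thesis
      by (meson of_nat_le_iff order_trans)
  qed
  have "density_zero ?B"
    unfolding density_zero_def
  proof (rule LIMSEQ_I)
    fix e :: real assume e: "e > 0"
    obtain n1 where n1: "real n1 > 2 / (\<kappa>\<^sup>2 * e)"
      using reals_Archimedean2 by blast
    define n2 where "n2 = Suc (max n0 n1)"
    show "\<exists>no. \<forall>N\<ge>no. norm (real (card (?B \<inter> {0..<N})) / real N - 0) < e"
    proof (intro exI allI impI)
      fix N :: nat assume N: "2 ^ n2 \<le> N"
      define n where "n = bit_length N"
      have Nn: "N < 2 ^ n"
        unfolding n_def by (rule less_power_bit_length)
      with N have "(2::nat) ^ n2 < 2 ^ n"
        by linarith
      then have nn: "n2 < n"
        by (rule power_less_imp_less_exp[rotated]) simp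
      have nN: "2 ^ n \<le> 2 * N"
      proof (rule ccontr)
        assume "\<not> 2 ^ n \<le> 2 * N"
        then have "N < 2 ^ (n - 1)"
          using nn by (cases n) auto
        from bit_length_le[OF this] nn show False
          by (simp add: n_def)
      qed
      have Npos: "N > 0"
        using N by (metis gr0I le_zero_eq power_not_zero zero_neq_numeral)
      have "card (?B \<inter> {0..<N}) \<le> card (?B \<inter> {0..<2 ^ n})"
        using Nn by (intro card_mono) auto
      then have "real (card (?B \<inter> {0..<N})) \<le> 2 ^ n / (\<kappa>\<^sup>2 * real n)"
        using few[of n] nn n2_def by (auto intro: order_trans[OF of_nat_mono])
      also have "real (2 ^ n) \<le> real (2 * N)"
        using nN by (rule of_nat_mono)
      then have "2 ^ n / (\<kappa>\<^sup>2 * real n) \<le> (2 * real N) / (\<kappa>\<^sup>2 * real n)"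
        by (intro divide_right_mono) auto
      finally have "real (card (?B \<inter> {0..<N})) / real N \<le> 2 / (\<kappa>\<^sup>2 * real n)"
        using Npos by (simp add: pos_divide_le_eq mult.commute)
      also have "\<dots> < e"
      proof -
        have "2 / (\<kappa>\<^sup>2 * e) < real n"
          using n1 nn unfolding n2_def by linarith
        then show ?thesis
          using k e nn by (simp add: divide_simps mult_ac)
      qed
      finally show "norm (real (card (?B \<inter> {0..<N})) / real N - 0) < e"
        by simp
    qed
  qed
  then show ?thesis
    by (simp add: cesaro_density_one_iff)
qed

text \<open>
  A power \<open>(1 + x) ^ h\<close> will be compared with \<open>(1 + x ^ (2 ^ r)) ^ (h div 2 ^ r)\<close>, where \<open>r\<close>
  depends on the character. The successor appears because a factor with both residues present acts as
  one more factor \<open>1 + x ^ (2 ^ r)\<close>.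
\<close>

lemma density_one_all_quotients_many_ones:
  assumes "1 / sqrt 2 < \<alpha>" "\<alpha> < 1"
  obtains J where "cesaro_density_one J"
    "\<And>r C. \<exists>m. \<forall>h\<in>J. m \<le> h \<longrightarrow> C \<le> 2 ^ ones (h div 2 ^ r) * \<alpha> ^ bit_length (h div 2 ^ r)
        \<and> C \<le> 2 ^ ones (Suc (h div 2 ^ r)) * \<alpha> ^ bit_length (Suc (h div 2 ^ r))"
proof -
  define G where "G C = {h. (C::real) \<le> 2 ^ ones h * \<alpha> ^ bit_length h}" for C
  define A where "A k = {h. \<forall>r\<le>k. h div 2 ^ r \<in> G (real k) \<and> Suc (h div 2 ^ r) \<in> G (real k)}" for k
  have G: "density_zero (- G C)" for C
    using density_one_many_ones[OF assms, of C] by (simp add: cesaro_density_one_iff G_def)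
  have "cesaro_density_one (A k)" for k
  proof -
    have "- A k = (\<Union>r\<le>k. {h. h div 2 ^ r \<in> - G (real k)} \<union> {h. h div 2 ^ r \<in> {q. Suc q \<in> - G (real k)}})"
      by (auto simp: A_def)
    also have "density_zero \<dots>"
      by (intro density_zero_UN_atMost density_zero_Un density_zero_vimage_div density_zero_vimage_Suc G) auto
    finally show ?thesis
      by (simp add: cesaro_density_one_iff)
  qed
  moreover have "decseq A"
  proof (rule decseq_SucI)
    fix k
    have "G (real (Suc k)) \<subseteq> G (real k)"
      by (auto simp: G_def)
    then show "A (Suc k) \<subseteq> A k"
      unfolding A_def by (blast intro: le_SucI)
  qed
  ultimately obtain J where J: "cesaro_density_one J" "\<And>k. \<exists>m. \<forall>h\<in>J. m \<le> h \<longrightarrow> h \<in> A k"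
    by (rule cesaro_density_one_diagonal) blast
  show ?thesis
  proof (rule that[OF J(1)])
    fix r :: nat and C :: real
    obtain k0 where k0: "C \<le> real k0"
      using real_arch_simple by blast
    define k where "k = max k0 r"
    obtain m where m: "\<forall>h\<in>J. m \<le> h \<longrightarrow> h \<in> A k"
      using J(2) by blast
    have "C \<le> real k" "r \<le> k"
      using k0 by (auto simp: k_def)
    with m show "\<exists>m. \<forall>h\<in>J. m \<le> h \<longrightarrow> C \<le> 2 ^ ones (h div 2 ^ r) * \<alpha> ^ bit_length (h div 2 ^ r)
        \<and> C \<le> 2 ^ ones (Suc (h div 2 ^ r)) * \<alpha> ^ bit_length (Suc (h div 2 ^ r))"
      by (intro exI[of _ m]) (auto simp: A_def G_def dest!: bspec spec[of _ r] intro: order_trans)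
  qed
qed

section \<open>Powers of $1+x$ over the two-element field\<close>

definition poly_support :: "bit poly \<Rightarrow> nat set" where
  "poly_support p = {i. coeff p i \<noteq> 0}"

abbreviation weight :: "bit poly \<Rightarrow> nat" where
  "weight p \<equiv> card (poly_support p)"

lemma poly_support_subset: "poly_support p \<subseteq> {..degree p}"
  by (auto simp: poly_support_def le_degree)

lemma finite_poly_support [simp]: "finite (poly_support p)"
  by (rule finite_subset[OF poly_support_subset]) simp

text \<open>
  The dual group of the configurations supported on the half-line, written additively: the polynomial
  \<open>p\<close> sends \<open>a\<close> to the sum of its values at the exponents of \<open>p\<close>.
\<close>

definition pairing :: "bit poly \<Rightarrow> config \<Rightarrow> bit" where
  "pairing p a = (\<Sum>i\<in>poly_support p. a (int i))"

lemma pairing_eq_sum: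
  assumes "degree p \<le> n"
  shows "pairing p a = (\<Sum>i\<le>n. coeff p i * a (int i))"
proof -
  have "(\<Sum>i\<le>n. coeff p i * a (int i)) = (\<Sum>i\<in>poly_support p. coeff p i * a (int i))"
    using poly_support_subset[of p] assms
    by (intro sum.mono_neutral_right) (auto simp: poly_support_def)
  also have "\<dots> = pairing p a"
    unfolding pairing_def by (rule sum.cong) (auto simp: poly_support_def)
  finally show ?thesis ..
qed

text \<open>
  The adjoint of \<open>1 + \<sigma>\<close> is multiplication by \<open>1 + x\<close>.
\<close>

lemma pairing_Phi: "pairing p (Phi a) = pairing (p * [:1, 1:]) a"
proof -
  let ?n = "degree p"
  have eq: "p * [:1, 1:] = p + pCons 0 p"
    by (simp add: mult.commute[of p])
  have "degree (p + pCons 0 p) \<le> Suc ?n"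
    by (rule degree_add_le) (auto intro: degree_pCons_le)
  then have "pairing (p * [:1, 1:]) a = (\<Sum>i\<le>Suc ?n. coeff (p + pCons 0 p) i * a (int i))"
    unfolding eq by (rule pairing_eq_sum)
  also have "\<dots> = (\<Sum>i\<le>Suc ?n. coeff p i * a (int i)) + (\<Sum>i\<le>Suc ?n. coeff (pCons 0 p) i * a (int i))"
    unfolding coeff_add distrib_right sum.distrib ..
  also have "(\<Sum>i\<le>Suc ?n. coeff (pCons 0 p) i * a (int i)) = (\<Sum>i\<le>?n. coeff p i * a (int i + 1))"
    by (subst sum.atMost_Suc_shift) (simp add: add.commute)
  also have "(\<Sum>i\<le>Suc ?n. coeff p i * a (int i)) = (\<Sum>i\<le>?n. coeff p i * a (int i))"
    by (simp add: coeff_eq_0)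
  finally show ?thesis
    unfolding pairing_eq_sum[OF order_refl, of p] Phi_def config_shift_def plus_fun_def distrib_left sum.distrib
    by (rule sym)
qed

lemma pairing_Phi_power: "pairing p ((Phi ^^ h) a) = pairing (p * [:1, 1:] ^ h) a"
proof (induction h arbitrary: p)
  case (Suc h)
  have "pairing p ((Phi ^^ Suc h) a) = pairing (p * [:1, 1:]) ((Phi ^^ h) a)"
    by (simp add: pairing_Phi)
  also have "\<dots> = pairing (p * [:1, 1:] ^ Suc h) a"
    by (simp only: Suc mult.assoc power_Suc)
  finally show ?case .
qed simp

definition dilate :: "nat \<Rightarrow> bit poly \<Rightarrow> bit poly" where
  "dilate R p = pcompose p (monom 1 R)"

lemma pcompose_monom_1: "pcompose (monom 1 n) q = (q :: bit poly) ^ n"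
  by (induction n) (simp_all add: monom_Suc pcompose_pCons monom_0 pcompose_1 flip: one_pCons)

lemma dilate_dilate: "dilate S (dilate R p) = dilate (R * S) p"
  by (simp add: dilate_def pcompose_assoc[symmetric] pcompose_monom_1 monom_power mult.commute)

lemma coeff_dilate:
  assumes "R > 0"
  shows "coeff (dilate R p) n = (if R dvd n then coeff p (n div R) else 0)"
proof (induction p arbitrary: n)
  case 0
  show ?case
    by (simp add: dilate_def)
next
  case (pCons a p)
  have *: "dilate R (pCons a p) = [:a:] + monom 1 R * dilate R p"
    by (simp add: dilate_def pcompose_pCons)
  show ?case
  proof (cases "n < R")
    case True
    then show ?thesis
      using assms by (cases "n = 0") (auto simp: * coeff_monom_mult coeff_pCons split: nat.splits dest: dvd_imp_le)
  next
    case False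
    then have "R dvd n \<longleftrightarrow> R dvd (n - R)" "n div R = Suc ((n - R) div R)"
      using assms by (auto simp: dvd_minus_self le_div_geq)
    with False assms show ?thesis
      by (auto simp: * coeff_monom_mult coeff_pCons pCons.IH split: nat.splits)
  qed
qed

lemma bit_poly_add_self: "p + p = (0 :: bit poly)"
proof (rule poly_eqI)
  fix n
  show "coeff (p + p) n = coeff 0 n"
    unfolding coeff_add by (cases "coeff p n") simp_all
qed

lemma bit_poly_square: "p ^ 2 = dilate 2 p" for p :: "bit poly"
proof (induction p)
  case 0
  show ?case
    by (simp add: dilate_def)
next
  case (pCons a p)
  have "(pCons a p) ^ 2 = ([:a:] + monom 1 1 * p) ^ 2"
    by (simp add: monom_altdef)
  also have "\<dots> = [:a:] ^ 2 + monom 1 1 ^ 2 * p ^ 2 + ([:a:] * monom 1 1 * p + [:a:] * monom 1 1 * p)"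
    by (simp add: power2_eq_square algebra_simps)
  also have "\<dots> = [:a:] + monom 1 2 * dilate 2 p"
    unfolding bit_poly_add_self pCons.IH monom_power by (cases a) (simp_all add: power2_eq_square)
  also have "\<dots> = dilate 2 (pCons a p)"
    by (simp add: dilate_def pcompose_pCons)
  finally show ?case .
qed

lemma bit_poly_power_two_power: "p ^ (2 ^ r) = dilate (2 ^ r) p" for p :: "bit poly"
proof (induction r)
  case 0
  show ?case
    by (simp add: dilate_def monom_altdef)
next
  case (Suc r)
  have "p ^ (2 ^ Suc r) = (p ^ (2 ^ r)) ^ 2"
    by (simp add: power_mult mult.commute flip: power_mult)
  also have "\<dots> = dilate (2 ^ Suc r) p"
    by (simp only: Suc bit_poly_square dilate_dilate power_Suc mult.commute)
  finally show ?case .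
qed

text \<open>
  Only the exponents \<open>i\<close> and \<open>i + R\<close> of \<open>Q\<close> are congruent to \<open>i\<close> modulo \<open>R\<close> because of the
  degree bound, so each residue class evolves as a polynomial of degree at most one times \<open>u\<close>.
\<close>

lemma coeff_mult_dilate:
  assumes "R > 0" "degree Q < 2 * R" "i < R"
  shows "coeff (Q * dilate R u) (l * R + i) = coeff ([:coeff Q i, coeff Q (i + R):] * u) l"
proof -
  let ?n = "l * R + i"
  let ?f = "\<lambda>k. coeff Q k * coeff (dilate R u) (?n - k)"
  have zero: "?f k = 0" if k: "k \<le> ?n" "k \<noteq> i" "k \<noteq> i + R" for k
  proof (cases "k < 2 * R")
    case False
    with assms(2) have "coeff Q k = 0"
      by (intro coeff_eq_0) linarith
    then show ?thesis
      by (simp only: mult_zero_left)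
  next
    case True
    have "\<not> R dvd ?n - k"
    proof
      assume "R dvd ?n - k"
      then have "k mod R = ?n mod R"
        using k(1) by (metis mod_eq_dvd_iff_nat)
      also have "\<dots> = i"
        using assms(3) by (simp only: mod_mult_self3 mod_less)
      finally have "k mod R = i" .
      then show False
        using True k(2,3) by (cases "k < R") (simp_all add: le_mod_geq)
    qed
    then show ?thesis
      by (simp only: coeff_dilate[OF assms(1)] if_False mult_zero_right)
  qed
  have "coeff (Q * dilate R u) ?n = (\<Sum>k\<le>?n. ?f k)"
    by (rule coeff_mult)
  also have "\<dots> = (\<Sum>k\<in>{k. k \<le> ?n \<and> (k = i \<or> k = i + R)}. ?f k)"
    by (rule sum.mono_neutral_right) (use zero in auto)
  also have "\<dots> = coeff ([:coeff Q i, coeff Q (i + R):] * u) l"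
  proof (cases l)
    case 0
    then have "{k. k \<le> ?n \<and> (k = i \<or> k = i + R)} = {i}"
      using assms by auto
    with 0 show ?thesis
      by (simp add: coeff_dilate[OF assms(1)])
  next
    case (Suc l')
    then have set: "{k. k \<le> ?n \<and> (k = i \<or> k = i + R)} = {i, i + R}"
      by auto
    have "(\<Sum>k\<in>{i, i + R}. ?f k) = ?f i + ?f (i + R)"
      using assms(1) by simp
    moreover have "?n - i = l * R" "?n - (i + R) = l' * R"
      using Suc by simp_all
    ultimately show ?thesis
      unfolding set using Suc assms(1) by (simp add: coeff_dilate)
  qed
  finally show ?thesis .
qed

lemma weight_mult_dilate:
  assumes "R > 0" "degree Q < 2 * R"
  shows "weight (Q * dilate R u) = (\<Sum>i<R. weight ([:coeff Q i, coeff Q (i + R):] * u))"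
proof -
  let ?S = "SIGMA i:{..<R}. poly_support ([:coeff Q i, coeff Q (i + R):] * u)"
  have "bij_betw (\<lambda>(i, l). l * R + i) ?S (poly_support (Q * dilate R u))"
  proof (rule bij_betw_byWitness[where f' = "\<lambda>n. (n mod R, n div R)"])
    show "(\<lambda>(i, l). l * R + i) ` ?S \<subseteq> poly_support (Q * dilate R u)"
      by (auto simp: poly_support_def coeff_mult_dilate[OF assms])
    show "(\<lambda>n. (n mod R, n div R)) ` poly_support (Q * dilate R u) \<subseteq> ?S"
    proof
      fix x assume "x \<in> (\<lambda>n. (n mod R, n div R)) ` poly_support (Q * dilate R u)"
      then obtain n where n: "n \<in> poly_support (Q * dilate R u)" "x = (n mod R, n div R)"
        by blast
      have "n mod R < R"
        using assms by simp
      from coeff_mult_dilate[OF assms this, of u "n div R"] n this show "x \<in> ?S"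
        by (simp add: poly_support_def)
    qed
  qed auto
  then have "weight (Q * dilate R u) = card ?S"
    by (simp add: bij_betw_same_card)
  then show ?thesis
    by simp
qed

text \<open>
  The counting form of Lucas' theorem, by recursion on the binary digits: squaring is dilation in
  characteristic two, and the factor \<open>1 + x\<close> for an odd exponent doubles the number of terms.
\<close>

lemma weight_binomial: "weight ([:1, 1:] ^ q) = 2 ^ ones q"
proof (induction q rule: nat_bit_induct)
  case zero
  have "poly_support 1 = {0}"
    by (auto simp: poly_support_def coeff_1)
  then show ?case
    by (simp add: ones.simps[of 0])
next
  case (even q)
  have "[:1, 1:] ^ (2 * q) = (1 :: bit poly) * dilate 2 ([:1, 1:] ^ q)"
    by (simp add: mult.commute[of 2] power_mult bit_poly_square)
  also have "weight \<dots> = weight ([:1, 1:] ^ q)"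
    by (subst weight_mult_dilate) (simp_all add: numeral_2_eq_2 poly_support_def)
  finally show ?case
    by (simp add: even ones_double)
next
  case (odd q)
  have "[:1, 1:] ^ Suc (2 * q) = [:1, 1:] * dilate 2 ([:1, 1:] ^ q :: bit poly)"
    by (simp only: power_Suc mult.commute[of 2] power_mult bit_poly_square)
  also have "weight \<dots> = 2 * weight ([:1, 1:] ^ q)"
    by (subst weight_mult_dilate) (simp_all add: numeral_2_eq_2 poly_support_def)
  finally show ?case
    by (simp add: odd ones_double)
qed

lemma weight_pCons_0: "weight (pCons 0 p) = weight p"
proof -
  have "poly_support (pCons 0 p) = Suc ` poly_support p"
  proof (rule set_eqI)
    fix n
    show "n \<in> poly_support (pCons 0 p) \<longleftrightarrow> n \<in> Suc ` poly_support p"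
      by (cases n) (simp_all add: poly_support_def inj_image_mem_iff)
  qed
  then show ?thesis
    by (simp add: card_image)
qed

text \<open>
  The initial polynomial \<open>Q\<close> cannot cancel the growth of \<open>(1 + x) ^ (2 ^ r * q)\<close>: some residue
  class of \<open>Q\<close> modulo \<open>2 ^ r\<close> contributes one of the factors \<open>1\<close>, \<open>x\<close>, \<open>1 + x\<close>, and each of them
  leaves a full power of \<open>1 + x\<close>.
\<close>

lemma weight_mult_power_ge:
  assumes "Q \<noteq> 0" "degree Q < 2 * 2 ^ r"
  shows "weight (Q * [:1, 1:] ^ (2 ^ r * q)) \<ge> min (2 ^ ones q) (2 ^ ones (Suc q))"
proof -
  define R :: nat where "R = 2 ^ r"
  have R: "R > 0"
    by (simp add: R_def)
  let ?u = "[:1, 1:] ^ q :: bit poly"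
  obtain i where i: "i < R" "(coeff Q i, coeff Q (i + R)) \<noteq> (0, 0)"
  proof -
    let ?n = "degree Q"
    have n: "coeff Q ?n \<noteq> 0"
      using assms(1) by simp
    show ?thesis
    proof (cases "?n < R")
      case True
      with n show ?thesis
        by (intro that[of ?n]) auto
    next
      case False
      with n assms(2) show ?thesis
        by (intro that[of "?n - R"]) (auto simp: R_def)
    qed
  qed
  have "[:1, 1:] ^ (2 ^ r * q) = dilate R ?u"
    by (simp add: R_def mult.commute[of _ q] power_mult bit_poly_power_two_power)
  then have "weight (Q * [:1, 1:] ^ (2 ^ r * q)) = (\<Sum>i<R. weight ([:coeff Q i, coeff Q (i + R):] * ?u))"
    using weight_mult_dilate[OF R] assms(2) by (simp add: R_def)
  also have "\<dots> \<ge> weight ([:coeff Q i, coeff Q (i + R):] * ?u)"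
    using i(1) by (intro member_le_sum) auto
  finally have le: "weight ([:coeff Q i, coeff Q (i + R):] * ?u) \<le> weight (Q * [:1, 1:] ^ (2 ^ r * q))" .
  consider "[:coeff Q i, coeff Q (i + R):] = 1" | "[:coeff Q i, coeff Q (i + R):] = [:0, 1:]"
    | "[:coeff Q i, coeff Q (i + R):] = [:1, 1:]"
    using i(2) by (cases "coeff Q i"; cases "coeff Q (i + R)") auto
  then have "weight ([:coeff Q i, coeff Q (i + R):] * ?u) \<in> {2 ^ ones q, 2 ^ ones (Suc q)}"
  proof cases
    case 1
    then show ?thesis
      by (simp add: weight_binomial)
  next
    case 2
    then show ?thesis
      by (simp add: weight_binomial weight_pCons_0)
  next
    case 3
    then have "[:coeff Q i, coeff Q (i + R):] * ?u = [:1, 1:] ^ Suc q"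
      by simp
    then show ?thesis
      by (simp only: weight_binomial) simp
  qed
  with le show ?thesis
    by auto
qed

section \<open>Walsh functions and locally determined functions\<close>

definition bit_sign :: "bit \<Rightarrow> real" where
  "bit_sign b = (if b = 0 then 1 else - 1)"

lemma bit_sign_simps [simp]: "bit_sign 0 = 1" "bit_sign 1 = - 1"
  by (simp_all add: bit_sign_def)

lemma bit_sign_add: "bit_sign (a + b) = bit_sign a * bit_sign b"
  by (cases a; cases b) simp_all

lemma abs_bit_sign [simp]: "\<bar>bit_sign b\<bar> = 1"
  by (cases b) simp_all

lemma bit_sign_sum: "bit_sign (\<Sum>i\<in>A. f i) = (\<Prod>i\<in>A. bit_sign (f i))"
  by (induction A rule: infinite_finite_induct) (simp_all add: bit_sign_add)

definition walsh :: "int set \<Rightarrow> config \<Rightarrow> real" where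
  "walsh K a = (\<Prod>k\<in>K. bit_sign (a k))"

lemma abs_walsh [simp]: "\<bar>walsh K a\<bar> = 1"
  by (simp add: walsh_def abs_prod)

lemma walsh_add: "walsh K (a + b) = walsh K a * walsh K b"
  unfolding walsh_def plus_fun_def bit_sign_add prod.distrib ..

lemma walsh_empty [simp]: "walsh {} a = 1"
  by (simp add: walsh_def)

definition delta :: "int \<Rightarrow> config" where
  "delta k = (\<lambda>m. if m = k then 1 else 0)"

lemma walsh_delta: "finite K \<Longrightarrow> walsh K (delta k) = (if k \<in> K then - 1 else 1)"
proof -
  assume fin: "finite K"
  have "walsh K (delta k) = (\<Prod>j\<in>K. if j = k then - 1 else 1)"
    unfolding walsh_def delta_def by (rule prod.cong) auto
  also have "\<dots> = (if k \<in> K then - 1 else 1)"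
    using fin by simp
  finally show ?thesis .
qed

text \<open>
  Functions that depend only on the coordinates in \<open>F\<close>; for finite \<open>F\<close> these are the cylinder
  functions, which are continuous, take finitely many values and determine measures.
\<close>

definition local_at :: "int set \<Rightarrow> (config \<Rightarrow> 'b) \<Rightarrow> bool" where
  "local_at F f \<longleftrightarrow> (\<forall>x y. (\<forall>k\<in>F. x k = y k) \<longrightarrow> f x = f y)"

lemma local_atD: "local_at F f \<Longrightarrow> (\<And>k. k \<in> F \<Longrightarrow> x k = y k) \<Longrightarrow> f x = f y"
  by (auto simp: local_at_def)

lemma local_at_mono: "local_at F f \<Longrightarrow> F \<subseteq> G \<Longrightarrow> local_at G f"
  unfolding local_at_def by blast

lemma open_coordinate: "open {x :: config. x k = b}"
proof -
  have "open ((\<lambda>x :: config. x k) -` {b})"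
    by (rule open_vimage) (simp_all add: open_bit_def continuous_on_product_coordinates)
  then show ?thesis
    by (simp add: vimage_def)
qed

lemma open_cylinder: "finite F \<Longrightarrow> open {y :: config. \<forall>k\<in>F. y k = x k}"
proof -
  assume "finite F"
  then have "open (\<Inter>k\<in>F. {y :: config. y k = x k})"
    by (intro open_INT) (auto simp: open_coordinate)
  also have "(\<Inter>k\<in>F. {y :: config. y k = x k}) = {y. \<forall>k\<in>F. y k = x k}"
    by auto
  finally show ?thesis .
qed

lemma open_local:
  assumes "finite F" "local_at F P"
  shows "open {x. P x}"
proof (subst open_subopen, rule ballI)
  fix x assume "x \<in> {x. P x}"
  then have "{y. \<forall>k\<in>F. y k = x k} \<subseteq> {x. P x}"
    using local_atD[OF assms(2)] by blast
  then show "\<exists>T. open T \<and> x \<in> T \<and> T \<subseteq> {x. P x}"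
    by (intro exI[of _ "{y. \<forall>k\<in>F. y k = x k}"]) (auto intro: open_cylinder assms(1))
qed

lemma local_at_comp: "local_at F f \<Longrightarrow> local_at F (\<lambda>x. h (f x))"
  unfolding local_at_def by metis

lemma local_at_comp2: "local_at F f \<Longrightarrow> local_at F g \<Longrightarrow> local_at F (\<lambda>x. h (f x) (g x))"
  unfolding local_at_def by metis

lemma continuous_local:
  assumes "finite F" "local_at F f"
  shows "continuous_on UNIV f"
proof -
  have "open (f -` B)" for B
  proof -
    have "open {x. f x \<in> B}"
      by (rule open_local[OF assms(1) local_at_comp[OF assms(2)]])
    then show ?thesis
      by (simp add: vimage_def)
  qed
  then show ?thesis
    by (simp add: continuous_on_open_vimage)
qed

lemma local_at_walsh: "local_at K (walsh K)"
  unfolding local_at_def walsh_def by (auto intro: prod.cong)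

lemma borel_measurable_local:
  "finite F \<Longrightarrow> local_at F f \<Longrightarrow> (f :: config \<Rightarrow> 'b::topological_space) \<in> borel \<rightarrow>\<^sub>M borel"
  by (rule borel_measurable_continuous_onI[OF continuous_local])

lemma finite_range_local:
  assumes "finite F" "local_at F f"
  shows "finite (range f)"
proof -
  have "range f \<subseteq> (\<lambda>w. f w) ` PiE_dflt F 0 (\<lambda>_. UNIV)"
  proof
    fix z assume "z \<in> range f"
    then obtain x where x: "z = f x"
      by blast
    have "f x = f (\<lambda>k. if k \<in> F then x k else 0)"
      by (rule local_atD[OF assms(2)]) simp
    with x show "z \<in> (\<lambda>w. f w) ` PiE_dflt F 0 (\<lambda>_. UNIV)"
      by (auto simp: PiE_dflt_def)
  qed
  moreover have "finite (PiE_dflt F (0::bit) (\<lambda>_. UNIV))"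
    using assms(1) by (intro finite_PiE_dflt) auto
  ultimately show ?thesis
    using finite_subset by blast
qed

lemma compact_config: "compact (UNIV :: config set)"
proof -
  have "compact_space (product_topology (\<lambda>_::int. euclidean :: bit topology) UNIV)"
    unfolding compact_space_product_topology
    by (auto simp: compact_space_def intro!: finite_imp_compact)
  then show ?thesis
    by (simp add: compact_space_def euclidean_product_topology flip: compactin_euclidean_iff)
qed

lemma open_contains_cylinder:
  assumes "open U" "x \<in> (U :: config set)"
  obtains F where "finite F" "\<And>y. (\<And>k. k \<in> F \<Longrightarrow> y k = x k) \<Longrightarrow> y \<in> U"
proof -
  have "openin (product_topology (\<lambda>_::int. euclidean :: bit topology) UNIV) U"
    using assms(1) by (simp add: euclidean_product_topology)
  then obtain V where V: "finite {i. V i \<noteq> (UNIV :: bit set)}" "x \<in> Pi\<^sub>E UNIV V" "Pi\<^sub>E UNIV V \<subseteq> U"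
    using assms(2) unfolding openin_product_topology_alt by auto
  have "y \<in> U" if y: "\<And>k. k \<in> {i. V i \<noteq> UNIV} \<Longrightarrow> y k = x k" for y
  proof -
    have "y i \<in> V i" for i
      using V(2) y[of i] by (cases "V i = UNIV") (auto simp: PiE_iff)
    then show ?thesis
      using V(3) by (auto simp: PiE_iff)
  qed
  with V(1) show ?thesis
    by (rule that)
qed

text \<open>
  Uniform continuity on a compact space, in the form used here: fixing all coordinates outside a
  suitable finite set to \<open>0\<close> changes the values of \<open>f\<close> by less than \<open>e\<close>.
\<close>

lemma local_approximation:
  fixes f :: "config \<Rightarrow> real"
  assumes "continuous_on UNIV f" "e > 0"
  obtains g F where "finite F" "local_at F g" "\<And>x. \<bar>f x - g x\<bar> < e"
proof -
  have "\<exists>F. finite F \<and> (\<forall>y. (\<forall>k\<in>F. y k = x k) \<longrightarrow> \<bar>f y - f x\<bar> < e / 2)" for x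
  proof -
    have "open (f -` ball (f x) (e / 2))"
      using assms(1) by (simp add: open_vimage)
    moreover have "x \<in> f -` ball (f x) (e / 2)"
      using assms(2) by simp
    ultimately obtain F where "finite F"
      "\<And>y. (\<And>k. k \<in> F \<Longrightarrow> y k = x k) \<Longrightarrow> y \<in> f -` ball (f x) (e / 2)"
      by (rule open_contains_cylinder) blast
    then show ?thesis
      by (intro exI[of _ F]) (auto simp: dist_real_def abs_minus_commute)
  qed
  then obtain F where F: "\<And>x. finite (F x)"
    "\<And>x y. (\<And>k. k \<in> F x \<Longrightarrow> y k = x k) \<Longrightarrow> \<bar>f y - f x\<bar> < e / 2"
    by metis
  let ?C = "\<lambda>x. {y :: config. \<forall>k\<in>F x. y k = x k}"
  have op: "\<And>x. open (?C x)"
    using F(1) by (rule open_cylinder)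
  have cov: "UNIV \<subseteq> (\<Union>x\<in>UNIV. ?C x)"
    by auto
  obtain D where D: "finite D" "UNIV \<subseteq> (\<Union>x\<in>D. ?C x)"
  proof (rule compactE_image[of UNIV UNIV ?C])
    show "compact (UNIV :: config set)"
      by (rule compact_config)
    show "open (?C x)" for x
      by (rule op)
    show "UNIV \<subseteq> (\<Union>x\<in>UNIV. ?C x)"
      by (rule cov)
  qed
  define G where "G = (\<Union>x\<in>D. F x)"
  define g where "g y = f (\<lambda>k. if k \<in> G then y k else 0)" for y
  show ?thesis
  proof
    show "finite G"
      using D(1) F(1) by (simp add: G_def)
    have "(\<lambda>k. if k \<in> G then x k else 0) = (\<lambda>k. if k \<in> G then y k else 0)"
      if "\<forall>k\<in>G. x k = y k" for x y :: config
      using that by auto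
    then show "local_at G g"
      unfolding local_at_def g_def by metis
    fix y
    obtain x where x: "x \<in> D" "y \<in> ?C x"
      using D(2) by blast
    have "\<bar>f y - f x\<bar> < e / 2"
      by (rule F(2)) (use x in simp)
    moreover have "\<bar>g y - f x\<bar> < e / 2"
      unfolding g_def by (rule F(2)) (use x in \<open>auto simp: G_def\<close>)
    ultimately
    show "\<bar>f y - g y\<bar> < e"
      by linarith
  qed
qed

text \<open>
  Walsh functions span the cylinder functions. One coordinate \<open>k\<close> is removed at a time by writing
  \<open>f\<close> as the mean of its two restrictions plus \<open>bit_sign (x k)\<close> times half of their difference;
  the induction carries an accumulated Walsh factor with frequencies \<open>L\<close>.
\<close>

lemma local_walsh_induct:
  fixes f :: "config \<Rightarrow> real"
  assumes "finite F" "local_at F f"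
    and walsh: "\<And>K. finite K \<Longrightarrow> P (walsh K)"
    and lincomb: "\<And>c d f g. P f \<Longrightarrow> P g \<Longrightarrow> P (\<lambda>x. c * f x + d * g x)"
  shows "P f"
proof -
  have "P (\<lambda>x. f x * walsh L x)" if "finite L" "F \<inter> L = {}" for L
    using assms(1,2) that
  proof (induction F arbitrary: f L rule: finite_induct)
    case empty
    define c where "c = f 0"
    have f: "f x = c" for x
      unfolding c_def by (rule local_atD[OF empty(1)]) simp
    have "P (\<lambda>x. c * walsh L x + 0 * walsh L x)"
      using empty by (intro lincomb walsh) auto
    then show ?case
      by (simp add: f)
  next
    case (insert k F)
    let ?f0 = "\<lambda>x. f (x(k := 0))" and ?f1 = "\<lambda>x. f (x(k := 1))"
    let ?s = "\<lambda>x. 1 / 2 * ?f0 x + 1 / 2 * ?f1 x" and ?d = "\<lambda>x. 1 / 2 * ?f0 x + - (1 / 2) * ?f1 x"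
    have loc: "local_at F ?f0" "local_at F ?f1"
      unfolding local_at_def by (auto intro!: local_atD[OF insert.prems(1)])
    have "P (\<lambda>x. ?s x * walsh L x)"
      using insert.prems by (intro insert.IH local_at_comp2[OF loc, where h = "\<lambda>a b. 1 / 2 * a + 1 / 2 * b"]) auto
    moreover have "P (\<lambda>x. ?d x * walsh (insert k L) x)"
      using insert.prems insert.hyps by (intro insert.IH local_at_comp2[OF loc, where h = "\<lambda>a b. 1 / 2 * a + - (1 / 2) * b"]) auto
    ultimately have "P (\<lambda>x. 1 * (?s x * walsh L x) + 1 * (?d x * walsh (insert k L) x))"
      by (rule lincomb)
    also have "(\<lambda>x. 1 * (?s x * walsh L x) + 1 * (?d x * walsh (insert k L) x)) = (\<lambda>x. f x * walsh L x)"
    proof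
      fix x
      have w: "walsh (insert k L) x = bit_sign (x k) * walsh L x"
        using insert.prems by (simp add: walsh_def)
      have "?s x + ?d x * bit_sign (x k) = f x"
      proof (cases "x k = 0")
        case x0: True
        then have "x(k := 0) = x"
          by auto
        with x0 show ?thesis
          by (simp add: field_simps)
      next
        case False
        then have x1: "x k = 1"
          by simp
        then have "x(k := 1) = x"
          by auto
        with x1 show ?thesis
          by (simp add: field_simps)
      qed
      then have "(?s x + ?d x * bit_sign (x k)) * walsh L x = f x * walsh L x"
        by simp
      then show "1 * (?s x * walsh L x) + 1 * (?d x * walsh (insert k L) x) = f x * walsh L x"
        unfolding w by (simp add: algebra_simps)
    qed
    finally show ?case .
  qed
  from this[of "{}"] show ?thesis
    by simp
qed

lemma measure_eq_if_local_integrals_eq: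
  assumes M: "prob_space M" "sets M = sets borel" and N: "prob_space N" "sets N = sets borel"
    and eq: "\<And>(f :: config \<Rightarrow> real) F. finite F \<Longrightarrow> local_at F f \<Longrightarrow> (\<integral>x. f x \<partial>M) = (\<integral>x. f x \<partial>N)"
  shows "M = N"
proof -
  interpret M: prob_space M by fact
  interpret N: prob_space N by fact
  have sp: "space M = UNIV" "space N = UNIV"
    using M(2) N(2) by (simp_all add: sets_eq_imp_space_eq)
  show ?thesis
  proof (rule measure_eqI_PiM_infinite[where I = UNIV and M = "\<lambda>_. borel :: bit measure"])
    show "sets M = sets (PiM UNIV (\<lambda>_::int. borel :: bit measure))"
      "sets N = sets (PiM UNIV (\<lambda>_::int. borel :: bit measure))"
      using M N by (simp_all add: sets_PiM_equal_borel)
    fix A :: "int \<Rightarrow> bit set" and J :: "int set"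
    assume J: "finite J" "J \<subseteq> UNIV"
    let ?C = "{x :: config. \<forall>k\<in>J. x k \<in> A k}"
    have "prod_emb UNIV (\<lambda>_. borel :: bit measure) J (Pi\<^sub>E J A) = ?C"
      by (auto simp: prod_emb_def PiE_iff)
    moreover have "emeasure M ?C = emeasure N ?C"
    proof -
      have loc: "local_at J (\<lambda>x. indicator ?C x :: real)"
        by (auto simp: local_at_def indicator_def)
      have "open ?C"
        by (rule open_local[OF J(1)]) (auto simp: local_at_def)
      then have "?C \<in> sets borel"
        by simp
      with M(2) N(2) have "?C \<in> sets M" "?C \<in> sets N"
        by simp_all
      with eq[OF J(1) loc] show ?thesis
        by (simp add: M.emeasure_eq_measure N.emeasure_eq_measure sp)
    qed
    ultimately show "emeasure M (prod_emb UNIV (\<lambda>_. borel :: bit measure) J (Pi\<^sub>E J A))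
        = emeasure N (prod_emb UNIV (\<lambda>_. borel :: bit measure) J (Pi\<^sub>E J A))"
      by simp
  qed (rule M.finite_measure)
qed

lemma weak_star_converges_if_local:
  assumes N: "\<And>i. prob_space (Ns i)" "\<And>i. sets (Ns i) = sets (borel :: config measure)"
    and M: "prob_space M" "sets M = sets borel"
    and lim: "\<And>(f :: config \<Rightarrow> real) F. finite F \<Longrightarrow> local_at F f \<Longrightarrow>
        ((\<lambda>i. \<integral>x. f x \<partial>Ns i) \<longlongrightarrow> (\<integral>x. f x \<partial>M)) \<F>"
  shows "weak_star_converges Ns M \<F>"
  unfolding weak_star_converges_def
proof (intro allI impI)
  fix f :: "config \<Rightarrow> real" assume f: "continuous_on UNIV f"
  have int: "integrable Q h" if h: "continuous_on UNIV h" and Q: "prob_space Q" "sets Q = sets borel"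
    for Q and h :: "config \<Rightarrow> real"
  proof -
    interpret Q: prob_space Q by fact
    have "bounded (range h)"
      using compact_continuous_image[OF h compact_config] by (rule compact_imp_bounded)
    then obtain B where "\<And>x. norm (h x) \<le> B"
      unfolding bounded_iff by auto
    moreover have "h \<in> borel_measurable Q"
      using borel_measurable_continuous_onI[OF h] measurable_cong_sets[OF Q(2) refl] by blast
    ultimately show ?thesis
      by (intro Q.integrable_const_bound[of _ B]) auto
  qed
  show "((\<lambda>i. \<integral>x. f x \<partial>Ns i) \<longlongrightarrow> (\<integral>x. f x \<partial>M)) \<F>"
  proof (rule tendstoI)
    fix e :: real assume e: "e > 0"
    then obtain g F where g: "finite F" "local_at F g" "\<And>x. \<bar>f x - g x\<bar> < e / 3"
      using local_approximation[OF f, of "e / 3"] zero_less_divide_iff[of e 3] by (metis zero_less_numeral)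
    have cg: "continuous_on UNIV g"
      by (rule continuous_local[OF g(1,2)])
    have close: "\<bar>(\<integral>x. f x \<partial>Q) - (\<integral>x. g x \<partial>Q)\<bar> \<le> e / 3" if Q: "prob_space Q" "sets Q = sets borel" for Q
    proof -
      interpret Q: prob_space Q by fact
      have ints: "integrable Q f" "integrable Q g" "integrable Q (\<lambda>x. f x - g x)"
        using int[OF f Q] int[OF cg Q] by auto
      have "\<bar>(\<integral>x. f x \<partial>Q) - (\<integral>x. g x \<partial>Q)\<bar> = \<bar>\<integral>x. f x - g x \<partial>Q\<bar>"
        using ints by simp
      also have "\<dots> \<le> (\<integral>x. \<bar>f x - g x\<bar> \<partial>Q)"
        by (rule integral_abs_bound)
      also have "\<dots> \<le> (\<integral>x. e / 3 \<partial>Q)"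
        using ints g(3) by (intro integral_mono) (auto intro: less_imp_le)
      finally show ?thesis
        by (simp add: Q.prob_space)
    qed
    have "\<forall>\<^sub>F i in \<F>. dist (\<integral>x. g x \<partial>Ns i) (\<integral>x. g x \<partial>M) < e / 3"
      by (rule tendstoD[OF lim[OF g(1,2)]]) (use e in simp)
    then show "\<forall>\<^sub>F i in \<F>. dist (\<integral>x. f x \<partial>Ns i) (\<integral>x. f x \<partial>M) < e"
    proof eventually_elim
      case (elim i)
      with close[OF N(1)[of i] N(2)[of i]] close[OF M] show ?case
        unfolding dist_real_def by linarith
    qed
  qed
qed

section \<open>Characters of the configuration space\<close>

text \<open>
  Every element has order two, so a character takes the values \<open>1\<close> and \<open>- 1\<close> only. By continuity it
  stays within distance \<open>1\<close> of \<open>1\<close> on a cylinder around \<open>0\<close>, hence equals \<open>1\<close> there, and it is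
  determined by its values on finitely many unit vectors.
\<close>

lemma character_eq_walsh:
  assumes "is_character \<xi>"
  obtains K where "finite K" "\<xi> = (\<lambda>a. complex_of_real (walsh K a))"
proof -
  have cont: "continuous_on UNIV \<xi>" and norm: "\<And>a. norm (\<xi> a) = 1"
    and hom: "\<And>a b. \<xi> (a + b) = \<xi> a * \<xi> b"
    using assms by (auto simp: is_character_def)
  have "\<xi> 0 = \<xi> 0 * \<xi> 0"
    using hom[of 0 0] by simp
  with norm[of 0] have one: "\<xi> 0 = 1"
    by (metis mult_cancel_right1 norm_zero zero_neq_one)
  have vals: "\<xi> a = 1 \<or> \<xi> a = - 1" for a
  proof -
    have "a + a = 0"
      by (rule ext) (simp add: plus_fun_def zero_fun_def)
    with hom[of a a] one have "(\<xi> a) ^ 2 = 1"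
      by (simp add: power2_eq_square)
    then show ?thesis
      by (simp add: power2_eq_1_iff)
  qed
  have "open (\<xi> -` ball 1 1)"
    using cont by (simp add: open_vimage)
  moreover have "0 \<in> \<xi> -` ball 1 1"
    by (simp add: one)
  ultimately obtain F where finF: "finite F"
    and F: "\<And>y. (\<And>k. k \<in> F \<Longrightarrow> y k = 0 k) \<Longrightarrow> y \<in> \<xi> -` ball 1 1"
    by (rule open_contains_cylinder) blast
  have triv: "\<xi> a = 1" if "\<And>k. k \<in> F \<Longrightarrow> a k = 0" for a
  proof -
    have "a \<in> \<xi> -` ball 1 1"
      by (rule F) (simp add: that zero_fun_def)
    then have "\<xi> a \<noteq> - 1"
      by (auto simp: dist_norm)
    then show ?thesis
      using vals by blast
  qed
  define K where "K = {k \<in> F. \<xi> (delta k) = - 1}"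
  have finK: "finite K"
    using finF by (simp add: K_def)
  have finsupp: "\<xi> a = complex_of_real (walsh K a)" if "finite S" "\<And>k. k \<notin> S \<Longrightarrow> a k = 0" for a S
    using that
  proof (induction S arbitrary: a rule: finite_induct)
    case empty
    then have a: "a k = 0" for k
      by simp
    then have "a = 0"
      by (intro ext) (simp add: zero_fun_def)
    then have "\<xi> a = 1"
      using one by (simp only:)
    moreover have "walsh K a = 1"
      unfolding walsh_def by (rule prod.neutral) (simp add: a)
    ultimately show ?case
      by simp
  next
    case (insert k S)
    show ?case
    proof (cases "a k = 0")
      case True
      have "a j = 0" if "j \<notin> S" for j
        using that True insert.prems[of j] by (cases "j = k") auto
      then show ?thesis
        by (rule insert.IH)
    next
      case False
      then have a1: "a k = 1"
        by simp
      define b where "b = a(k := 0)"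
      have ab: "a = delta k + b"
      proof
        fix j
        show "a j = (delta k + b) j"
          using a1 by (cases "j = k") (simp_all add: b_def delta_def plus_fun_apply)
      qed
      have "\<xi> b = complex_of_real (walsh K b)"
        using insert.prems by (intro insert.IH) (auto simp: b_def)
      moreover have "\<xi> (delta k) = complex_of_real (walsh K (delta k))"
      proof (cases "k \<in> F")
        case True
        then show ?thesis
          using vals[of "delta k"] unfolding walsh_delta[OF finK] by (auto simp: K_def)
      next
        case False
        then have "\<xi> (delta k) = 1"
          by (intro triv) (auto simp: delta_def)
        then show ?thesis
          using False unfolding walsh_delta[OF finK] by (simp add: K_def)
      qed
      ultimately show ?thesis
        unfolding ab hom walsh_add by (simp only: of_real_mult)
    qed
  qed
  have "\<xi> a = complex_of_real (walsh K a)" for a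
  proof -
    define b where "b = (\<lambda>k. if k \<in> F then a k else 0)"
    define c where "c = (\<lambda>k. if k \<in> F then 0 else a k)"
    have a: "a = b + c"
      by (rule ext) (simp add: b_def c_def plus_fun_apply)
    have "\<xi> c = 1"
      by (rule triv) (simp add: c_def)
    moreover have "walsh K c = 1"
      unfolding walsh_def by (rule prod.neutral) (simp add: c_def K_def)
    moreover have "\<xi> b = complex_of_real (walsh K b)"
      by (rule finsupp[OF finF]) (simp add: b_def)
    ultimately show ?thesis
      unfolding a hom walsh_add by simp
  qed
  then show ?thesis
    using that[OF finK] by blast
qed

lemma nontrivial_bit_character:
  assumes "nontrivial_character (c :: bit \<Rightarrow> complex)"
  shows "c b = complex_of_real (bit_sign b)"
proof -
  have norm: "\<And>a. norm (c a) = 1" and hom: "\<And>a b. c (a + b) = c a * c b" and nt: "c \<noteq> (\<lambda>_. 1)"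
    using assms by (auto simp: is_character_def nontrivial_character_def)
  have "c 0 = c 0 * c 0"
    using hom[of 0 0] by simp
  with norm[of 0] have zero: "c 0 = 1"
    by (metis mult_cancel_right1 norm_zero zero_neq_one)
  have "(c 1) ^ 2 = 1"
    using hom[of 1 1] zero by (simp add: power2_eq_square)
  moreover have "c 1 \<noteq> 1"
  proof
    assume "c 1 = 1"
    with zero have "c b = 1" for b
      by (cases b) auto
    with nt show False
      by auto
  qed
  ultimately have "c 1 = - 1"
    by (simp add: power2_eq_1_iff)
  with zero show ?thesis
    by (cases b) simp_all
qed

lemma character_support_walsh:
  assumes "finite K"
  shows "character_support (\<lambda>a. complex_of_real (walsh K a)) = K"
  unfolding character_support_def
proof (rule the_equality)
  let ?c = "\<lambda>(_::int) b. complex_of_real (bit_sign b)"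
  have "nontrivial_character (\<lambda>b. complex_of_real (bit_sign b))"
  proof -
    have "(\<lambda>b. complex_of_real (bit_sign b)) \<noteq> (\<lambda>_. 1)"
      by (auto dest: fun_cong[of _ _ 1])
    moreover have "continuous_on UNIV (\<lambda>b. complex_of_real (bit_sign b))"
      by simp
    ultimately show ?thesis
      unfolding nontrivial_character_def is_character_def bit_sign_add
      by (simp only: of_real_mult norm_of_real abs_bit_sign simp_thms)
  qed
  then show "finite K \<and> (\<exists>c :: int \<Rightarrow> bit \<Rightarrow> complex. (\<forall>k\<in>K. nontrivial_character (c k)) \<and>
      (\<forall>a. complex_of_real (walsh K a) = (\<Prod>k\<in>K. c k (a k))))"
    using assms by (intro conjI exI[of _ ?c]) (simp_all add: walsh_def)
next
  fix L
  assume L: "finite L \<and> (\<exists>c :: int \<Rightarrow> bit \<Rightarrow> complex. (\<forall>k\<in>L. nontrivial_character (c k)) \<and>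
      (\<forall>a. complex_of_real (walsh K a) = (\<Prod>k\<in>L. c k (a k))))"
  then obtain c where c: "\<forall>k\<in>L. nontrivial_character (c k)"
    "\<forall>a. complex_of_real (walsh K a) = (\<Prod>k\<in>L. c k (a k))"
    by blast
  have "complex_of_real (walsh K a) = complex_of_real (walsh L a)" for a
    using c by (simp add: walsh_def nontrivial_bit_character)
  then have "walsh K a = walsh L a" for a
    using of_real_eq_iff by blast
  then have "k \<in> K \<longleftrightarrow> k \<in> L" for k
    using walsh_delta[OF assms, of k] walsh_delta[of L k] L by (auto split: if_splits)
  then show "L = K"
    by blast
qed

text \<open>
  Rounding the logarithm up makes the scale a power of two that still bounds the width.
\<close>

lemma character_scale_walsh:
  assumes "finite K"
  obtains r where "character_scale (\<lambda>a. complex_of_real (walsh K a)) = 2 ^ r"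
    "nat (Max K - Min K) \<le> 2 ^ r"
proof -
  define w where "w = nat (Max K - Min K)"
  have w: "character_width (\<lambda>a. complex_of_real (walsh K a)) = w"
    by (simp add: character_width_def character_support_walsh[OF assms] w_def)
  show ?thesis
  proof (cases "w = 0")
    case True
    then show ?thesis
      using that[of 0] w by (simp add: character_scale_def w_def)
  next
    case False
    define r where "r = nat \<lceil>log 2 (real w)\<rceil>"
    have "log 2 (real w) \<le> real r"
      unfolding r_def using False by (simp add: real_nat_ceiling_ge)
    then have "real w \<le> 2 powr real r"
      using False by (simp add: log_le_iff)
    then have "real w \<le> real (2 ^ r)"
      by (simp add: powr_realpow)
    then have "w \<le> 2 ^ r"
      by (simp only: of_nat_le_iff)
    then show ?thesis
      using that[of r] w False by (simp add: character_scale_def w_def r_def)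
  qed
qed

section \<open>A coupling of the approximating measures\<close>

definition shift_by :: "int \<Rightarrow> config \<Rightarrow> config" where
  "shift_by c a = (\<lambda>m. a (m + c))"

text \<open>
  Reduces measurability of equality of coordinates to that of events \<open>X m = 1\<close>.
\<close>

lemma bit_eq_iff_eq_one: "(a :: bit) = b \<longleftrightarrow> (a = 1 \<longleftrightarrow> b = 1)"
  by (cases a; cases b) simp_all

lemma shift_by_shift_by: "shift_by c (shift_by d a) = shift_by (c + d) a"
  by (simp add: shift_by_def add.assoc)

lemma shift_by_0 [simp]: "shift_by 0 a = a"
  by (simp add: shift_by_def)

lemma config_shift_power: "(config_shift ^^ i) a = shift_by (int i) a"
proof (induction i)
  case (Suc i)
  have "(config_shift ^^ Suc i) a = shift_by 1 (shift_by (int i) a)"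
    unfolding funpow.simps o_apply Suc by (simp add: config_shift_def shift_by_def)
  then show ?case
    by (simp add: shift_by_shift_by)
qed simp

lemma continuous_shift_by: "continuous_on UNIV (shift_by c)"
  unfolding shift_by_def
  by (intro continuous_on_coordinatewise_then_product continuous_on_product_coordinates)

lemma measurable_shift_by [measurable]: "shift_by c \<in> borel \<rightarrow>\<^sub>M borel"
  by (rule borel_measurable_continuous_onI[OF continuous_shift_by])

lemma local_at_shift_by: "local_at F f \<Longrightarrow> local_at ((\<lambda>k. k + c) ` F) (\<lambda>a. f (shift_by c a))"
  unfolding local_at_def shift_by_def by simp

lemma pred_coordinate [measurable (raw)]:
  "X \<in> M \<rightarrow>\<^sub>M borel \<Longrightarrow> Measurable.pred M (\<lambda>x. (X x :: config) m = b)"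
proof -
  assume X: "X \<in> M \<rightarrow>\<^sub>M borel"
  have "{a :: config. a m = b} \<in> sets borel"
    using open_coordinate by (rule borel_open)
  from measurable_sets[OF X this] show ?thesis
    by (simp add: vimage_def Int_def conj_commute pred_def)
qed

lemma measurable_configI:
  assumes "\<And>m. Measurable.pred M (\<lambda>x. X x m = 1)"
  shows "(X :: _ \<Rightarrow> config) \<in> M \<rightarrow>\<^sub>M borel"
proof -
  have "(\<lambda>x. X x m) \<in> M \<rightarrow>\<^sub>M count_space UNIV" for m
  proof -
    have "(\<lambda>x. if X x m = 1 then 1 else 0 :: bit) \<in> M \<rightarrow>\<^sub>M count_space UNIV"
      using assms by measurable
    also have "(\<lambda>x. if X x m = 1 then 1 else 0 :: bit) = (\<lambda>x. X x m)"
      by auto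
    finally show ?thesis .
  qed
  then have "X \<in> M \<rightarrow>\<^sub>M PiM UNIV (\<lambda>_. borel)"
    by (intro measurable_PiM_single')
      (auto simp: measurable_cong_sets[OF refl sets_borel_eq_count_space])
  then show ?thesis
    by (simp add: measurable_cong_sets[OF refl sets_PiM_equal_borel])
qed

lemma sum_periodic_shift:
  fixes g :: "int \<Rightarrow> 'a::ab_group_add"
  assumes "\<And>s. g (s + int N) = g s"
  shows "(\<Sum>s<N. g (int s + c)) = (\<Sum>s<N. g (int s))"
proof -
  have step: "(\<Sum>s<N. g (int s + (c + 1))) = (\<Sum>s<N. g (int s + c))" for c
  proof -
    have "(\<Sum>s<N. g (int s + (c + 1))) + g c = (\<Sum>s<Suc N. g (int s + c))"
      by (subst sum.lessThan_Suc_shift) (simp add: algebra_simps)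
    also have "\<dots> = (\<Sum>s<N. g (int s + c)) + g c"
      using assms[of c] by (simp add: add.commute)
    finally show ?thesis
      by simp
  qed
  show ?thesis
  proof (induction c rule: int_induct[where k = 0])
    case (step2 i)
    then show ?case
      using step[of "i - 1"] by simp
  qed (simp_all add: step)
qed

lemma a_seq_periodic: "a_seq \<omega> n (m + 2 ^ n * c) = a_seq \<omega> n m"
proof (induction n arbitrary: m c)
  case (Suc n)
  have "a_seq \<omega> n (m + 2 ^ Suc n * c) = a_seq \<omega> n m"
    using Suc[of m "2 * c"] by (simp add: mult_ac)
  moreover have "r_seq \<omega> n (m + 2 ^ Suc n * c) = r_seq \<omega> n m"
    by (simp add: r_seq_def)
  ultimately show ?case
    by simp
qed (simp add: zero_fun_def)

definition coin_space :: "nat stream measure" where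
  "coin_space = stream_space (measure_pmf (pmf_of_set {0, 1}))"

text \<open>
  The stream of fair coins is a random 2-adic integer; \<open>offset n\<close> is its residue modulo \<open>2 ^ n\<close>.
  The recursion starts from the lowest digit, so that it fits the decomposition of a stream into head and
  tail.
\<close>

primrec offset :: "nat \<Rightarrow> nat stream \<Rightarrow> nat" where
  "offset 0 b = 0"
| "offset (Suc n) b = shd b + 2 * offset n (stl b)"

lemma offset_Suc: "offset (Suc n) b = offset n b + 2 ^ n * (b !! n)"
  by (induction n arbitrary: b) simp_all

lemma prob_space_coin: "prob_space coin_space"
  unfolding coin_space_def by (rule prob_space.prob_space_stream_space[OF prob_space_measure_pmf])

lemma measurable_offset [measurable]: "offset n \<in> coin_space \<rightarrow>\<^sub>M count_space UNIV"
proof (induction n)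
  case (Suc n)
  have shd: "shd \<in> coin_space \<rightarrow>\<^sub>M count_space UNIV"
    using measurable_shd[of "measure_pmf (pmf_of_set {0, 1 :: nat})"]
    unfolding coin_space_def by (simp add: measurable_cong_sets[OF refl sets_measure_pmf_count_space])
  have stl: "stl \<in> coin_space \<rightarrow>\<^sub>M coin_space"
    unfolding coin_space_def by measurable
  note [measurable] = shd Suc stl
  have "(\<lambda>b. shd b + 2 * offset n (stl b)) \<in> coin_space \<rightarrow>\<^sub>M count_space UNIV"
    by measurable
  then show ?case
    by simp
qed simp

lemma nn_integral_offset:
  fixes f :: "nat \<Rightarrow> ennreal"
  shows "(\<integral>\<^sup>+b. f (offset n b) \<partial>coin_space) = (\<Sum>s<2 ^ n. f s) / 2 ^ n"
proof (induction n arbitrary: f)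
  case 0
  show ?case
    by (simp add: prob_space.emeasure_space_1[OF prob_space_coin] divide_ennreal_def)
next
  case (Suc n)
  have "(\<integral>\<^sup>+b. f (offset (Suc n) b) \<partial>coin_space)
      = (\<integral>\<^sup>+x. (\<integral>\<^sup>+b. f (offset (Suc n) (x ## b)) \<partial>coin_space) \<partial>measure_pmf (pmf_of_set {0, 1}))"
    unfolding coin_space_def
    by (rule prob_space.nn_integral_stream_space[OF prob_space_measure_pmf])
      (rule measurable_compose[OF measurable_offset[unfolded coin_space_def]], simp)
  also have "\<dots> = (\<integral>\<^sup>+x. (\<Sum>s<2 ^ n. f (x + 2 * s)) / 2 ^ n \<partial>measure_pmf (pmf_of_set {0, 1}))"
    by (simp add: Suc[of "\<lambda>s. f (_ + 2 * s)"])
  also have "\<dots> = ((\<Sum>s<2 ^ n. f (2 * s)) / 2 ^ n + (\<Sum>s<2 ^ n. f (Suc (2 * s))) / 2 ^ n) / 2"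
    by (subst nn_integral_pmf_of_set) simp_all
  also have "\<dots> = (\<Sum>s<2 ^ n. f (2 * s) + f (Suc (2 * s))) / 2 ^ Suc n"
    by (simp add: sum.distrib divide_ennreal_def algebra_simps ennreal_inverse_power flip: power_Suc) (simp add: algebra_simps)
  also have "(\<Sum>s<2 ^ n. f (2 * s) + f (Suc (2 * s))) = (\<Sum>s<2 ^ Suc n. f s)"
    by (simp add: sum_lessThan_double)
  finally show ?case .
qed

lemma distr_offset: "distr coin_space (count_space UNIV) (offset n) = measure_pmf (pmf_of_set {..<2 ^ n})"
proof (rule measure_eqI)
  fix A :: "nat set"
  have "emeasure (distr coin_space (count_space UNIV) (offset n)) A
      = (\<integral>\<^sup>+x. indicator A x \<partial>distr coin_space (count_space UNIV) (offset n))"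
    by simp
  also have "\<dots> = (\<integral>\<^sup>+b. indicator A (offset n b) \<partial>coin_space)"
    by (subst nn_integral_distr) simp_all
  also have "\<dots> = (\<Sum>s<2 ^ n. indicator A s) / 2 ^ n"
    by (rule nn_integral_offset)
  also have "\<dots> = (\<integral>\<^sup>+x. indicator A x \<partial>measure_pmf (pmf_of_set {..<2 ^ n}))"
    by (subst nn_integral_pmf_of_set) (auto simp: lessThan_empty_iff)
  finally show "emeasure (distr coin_space (count_space UNIV) (offset n)) A
      = emeasure (measure_pmf (pmf_of_set {..<2 ^ n})) A"
    by simp
qed simp

lemma integral_offset:
  fixes f :: "nat \<Rightarrow> real"
  shows "(\<integral>b. f (offset n b) \<partial>coin_space) = (\<Sum>s<2 ^ n. f s) / 2 ^ n"
proof -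
  have "(\<integral>b. f (offset n b) \<partial>coin_space) = (\<integral>x. f x \<partial>distr coin_space (count_space UNIV) (offset n))"
    by (subst integral_distr) simp_all
  also have "\<dots> = (\<Sum>s<2 ^ n. f s) / 2 ^ n"
    unfolding distr_offset by (subst integral_pmf_of_set) (auto simp: lessThan_empty_iff)
  finally show ?thesis .
qed

definition coupling :: "real \<Rightarrow> ((nat \<times> nat \<Rightarrow> bit) \<times> nat stream) measure" where
  "coupling \<alpha> = noise_space \<alpha> \<Otimes>\<^sub>M coin_space"

lemma prob_space_coupling: "prob_space (coupling \<alpha>)"
proof -
  interpret pair_prob_space "noise_space \<alpha>" coin_space
    using prob_space_noise prob_space_coin by (simp add: pair_prob_space_def pair_sigma_finite_def prob_space_imp_sigma_finite)
  show ?thesis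
    unfolding coupling_def by unfold_locales
qed

lemma measurable_offset_compose:
  assumes "\<And>s. H s \<in> noise_space \<alpha> \<rightarrow>\<^sub>M N"
  shows "(\<lambda>x. H (offset k (snd x)) (fst x)) \<in> coupling \<alpha> \<rightarrow>\<^sub>M N"
proof -
  note [measurable] = assms
  have "(\<lambda>x. H s (fst x)) \<in> noise_space \<alpha> \<Otimes>\<^sub>M coin_space \<rightarrow>\<^sub>M N" for s
    by measurable
  moreover have "(\<lambda>x. offset k (snd x)) \<in> noise_space \<alpha> \<Otimes>\<^sub>M coin_space \<rightarrow>\<^sub>M count_space UNIV"
    by measurable
  ultimately show ?thesis
    unfolding coupling_def by (rule measurable_compose_countable)
qed

lemma integral_coupling_offset:
  fixes H :: "nat \<Rightarrow> (nat \<times> nat \<Rightarrow> bit) \<Rightarrow> real"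
  assumes H: "\<And>s. H s \<in> borel_measurable (noise_space \<alpha>)" and bound: "\<And>s \<omega>. \<bar>H s \<omega>\<bar> \<le> B"
  shows "(\<integral>x. H (offset k (snd x)) (fst x) \<partial>coupling \<alpha>)
       = (\<Sum>s<2 ^ k. \<integral>\<omega>. H s \<omega> \<partial>noise_space \<alpha>) / 2 ^ k"
proof -
  interpret C: prob_space "coupling \<alpha>"
    by (rule prob_space_coupling)
  interpret pair_sigma_finite "noise_space \<alpha>" coin_space
    using prob_space_noise prob_space_coin by (simp add: pair_sigma_finite_def prob_space_imp_sigma_finite)
  have "integrable (coupling \<alpha>) (\<lambda>x. H (offset k (snd x)) (fst x))"
    using measurable_offset_compose[OF H] bound by (intro C.integrable_const_bound[of _ B]) auto
  then have "integrable (noise_space \<alpha> \<Otimes>\<^sub>M coin_space) (\<lambda>(\<omega>, b). H (offset k b) \<omega>)"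
    by (simp add: coupling_def case_prod_unfold)
  from integral_snd[OF this]
  have "(\<integral>x. H (offset k (snd x)) (fst x) \<partial>coupling \<alpha>)
      = (\<integral>b. (\<integral>\<omega>. H (offset k b) \<omega> \<partial>noise_space \<alpha>) \<partial>coin_space)"
    by (simp add: coupling_def case_prod_unfold)
  also have "\<dots> = (\<Sum>s<2 ^ k. \<integral>\<omega>. H s \<omega> \<partial>noise_space \<alpha>) / 2 ^ k"
    by (rule integral_offset)
  finally show ?thesis .
qed

text \<open>
  The sequence \<open>a\<^sup>n\<close> seen from a random phase. The phases for different \<open>n\<close> are residues of the
  same 2-adic integer, so that consecutive approximants differ only by the contribution of
  \<open>r\<^sup>n\<close>.
\<close>

definition approx :: "nat \<Rightarrow> (nat \<times> nat \<Rightarrow> bit) \<times> nat stream \<Rightarrow> config" where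
  "approx n x = shift_by (int (offset n (snd x))) (a_seq (fst x) n)"

text \<open>
  The pointwise limit of the approximants where it exists. Coordinates at which the approximants oscillate
  get the value \<open>0\<close>; they form a null event because
  \<open>\<alpha> ^ n\<close> is summable.
\<close>

definition limit_config :: "(nat \<times> nat \<Rightarrow> bit) \<times> nat stream \<Rightarrow> config" where
  "limit_config x = (\<lambda>m. of_bool (\<exists>N. \<forall>n\<ge>N. approx n x m = 1))"

definition limit_law :: "real \<Rightarrow> config measure" where
  "limit_law \<alpha> = distr (coupling \<alpha>) borel limit_config"

lemma measurable_approx [measurable]: "approx n \<in> coupling \<alpha> \<rightarrow>\<^sub>M borel"
  unfolding approx_def
  by (rule measurable_offset_compose[where H = "\<lambda>s \<omega>. shift_by (int s) (a_seq \<omega> n)"]) measurable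

lemma measurable_limit_config [measurable]: "limit_config \<in> coupling \<alpha> \<rightarrow>\<^sub>M borel"
proof (rule measurable_configI)
  fix m
  have "Measurable.pred (coupling \<alpha>) (\<lambda>x. \<exists>N. \<forall>n\<in>{N..}. approx n x m = 1)"
    by measurable
  then show "Measurable.pred (coupling \<alpha>) (\<lambda>x. limit_config x m = 1)"
    by (simp add: limit_config_def atLeast_def)
qed

lemma prob_space_limit_law: "prob_space (limit_law \<alpha>)"
  unfolding limit_law_def by (rule prob_space.prob_space_distr[OF prob_space_coupling]) measurable

lemma sets_limit_law: "sets (limit_law \<alpha>) = sets borel"
  by (simp add: limit_law_def)

lemma space_limit_law: "space (limit_law \<alpha>) = UNIV"
  by (simp add: limit_law_def)

text \<open>
  The integral of \<open>f\<close> with respect to \<open>mu_tilde \<alpha> n\<close>, as a sum over the phases.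
\<close>

definition phase_average :: "real \<Rightarrow> nat \<Rightarrow> (config \<Rightarrow> real) \<Rightarrow> real" where
  "phase_average \<alpha> n f = (\<Sum>s<2 ^ n. \<integral>\<omega>. f (shift_by (int s) (a_seq \<omega> n)) \<partial>noise_space \<alpha>) / 2 ^ n"

lemma integral_approx:
  fixes f :: "config \<Rightarrow> real"
  assumes [measurable]: "f \<in> borel_measurable borel" and "\<And>a. \<bar>f a\<bar> \<le> B"
  shows "(\<integral>x. f (approx n x) \<partial>coupling \<alpha>) = phase_average \<alpha> n f"
  unfolding approx_def phase_average_def
  by (rule integral_coupling_offset[where H = "\<lambda>s \<omega>. f (shift_by (int s) (a_seq \<omega> n))" and B = B])
    (measurable, rule assms)

text \<open>
  The sequence \<open>a\<^sup>n\<close> has period \<open>2 ^ n\<close>, so a shift permutes the phases cyclically.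
\<close>

lemma phase_average_shift: "phase_average \<alpha> n (\<lambda>a. f (shift_by c a)) = phase_average \<alpha> n f"
proof -
  let ?g = "\<lambda>s :: int. \<integral>\<omega>. f (shift_by s (a_seq \<omega> n)) \<partial>noise_space \<alpha>"
  have "shift_by (s + int (2 ^ n)) (a_seq \<omega> n) = shift_by s (a_seq \<omega> n)" for s \<omega>
    using a_seq_periodic[of \<omega> n _ 1] by (auto simp: shift_by_def add.assoc[symmetric])
  then have "(\<Sum>s<2 ^ n. ?g (int s + c)) = (\<Sum>s<2 ^ n. ?g (int s))"
    by (intro sum_periodic_shift) simp
  then show ?thesis
    by (simp add: phase_average_def shift_by_shift_by add.commute)
qed

lemma mu_tilde_eq_distr: "mu_tilde \<alpha> n = distr (coupling \<alpha>) borel (approx n)"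
proof (rule measure_eqI)
  fix A assume "A \<in> sets (mu_tilde \<alpha> n)"
  then have A [measurable]: "A \<in> sets borel"
    by (simp add: sets_mu_tilde)
  interpret N: prob_space "noise_space \<alpha>"
    by (rule prob_space_noise)
  interpret C: prob_space "coupling \<alpha>"
    by (rule prob_space_coupling)
  let ?g = "\<lambda>s :: int. \<integral>\<omega>. indicator A (shift_by s (a_seq \<omega> n)) \<partial>noise_space \<alpha>"
  have g: "emeasure (distr (mu_n \<alpha> n) borel (config_shift ^^ i)) A = ennreal (?g (int i))" for i
  proof -
    have "distr (mu_n \<alpha> n) borel (config_shift ^^ i)
        = distr (noise_space \<alpha>) borel (\<lambda>\<omega>. shift_by (int i) (a_seq \<omega> n))"
      unfolding mu_n_def by (subst distr_distr) (simp_all add: comp_def config_shift_power)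
    then have "emeasure (distr (mu_n \<alpha> n) borel (config_shift ^^ i)) A
        = emeasure (noise_space \<alpha>) ((\<lambda>\<omega>. shift_by (int i) (a_seq \<omega> n)) -` A \<inter> space (noise_space \<alpha>))"
      by (simp add: emeasure_distr)
    also have "\<dots> = ennreal (\<integral>\<omega>. indicator ((\<lambda>\<omega>. shift_by (int i) (a_seq \<omega> n)) -` A \<inter> space (noise_space \<alpha>)) \<omega> \<partial>noise_space \<alpha>)"
      by (simp add: N.emeasure_eq_measure)
    also have "\<dots> = ennreal (?g (int i))"
      by (intro arg_cong[where f = ennreal] Bochner_Integration.integral_cong) (auto simp: indicator_def)
    finally show ?thesis .
  qed
  have "emeasure (mu_tilde \<alpha> n) A = (\<Sum>i = 1..2 ^ n. ennreal (?g (int i))) / 2 ^ n"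
    using A by (simp add: emeasure_mu_tilde g)
  also have "\<dots> = ennreal (\<Sum>i = 1..2 ^ n. ?g (int i)) / ennreal (2 ^ n)"
    by (simp add: sum_ennreal flip: ennreal_power)
  also have "\<dots> = ennreal ((\<Sum>i = 1..2 ^ n. ?g (int i)) / 2 ^ n)"
    by (rule divide_ennreal) (auto intro: sum_nonneg)
  also have "(\<Sum>i = 1..2 ^ n. ?g (int i)) = (\<Sum>s<2 ^ n. ?g (int s + 1))"
    by (rule sum.reindex_bij_witness[of _ Suc "\<lambda>i. i - 1"]) (auto simp: of_nat_diff)
  also have "\<dots> / 2 ^ n = phase_average \<alpha> n (\<lambda>a. indicator A (shift_by 1 a))"
    by (simp add: phase_average_def shift_by_shift_by add.commute)
  also have "\<dots> = phase_average \<alpha> n (indicator A)"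
    by (rule phase_average_shift)
  also have "\<dots> = (\<integral>x. indicator A (approx n x) \<partial>coupling \<alpha>)"
    by (rule integral_approx[symmetric, where B = 1]) (auto simp: indicator_def)
  also have "\<dots> = (\<integral>x. indicator (approx n -` A \<inter> space (coupling \<alpha>)) x \<partial>coupling \<alpha>)"
    by (intro Bochner_Integration.integral_cong) (auto simp: indicator_def)
  also have "ennreal \<dots> = emeasure (distr (coupling \<alpha>) borel (approx n)) A"
    by (simp add: emeasure_distr C.emeasure_eq_measure)
  finally show "emeasure (mu_tilde \<alpha> n) A = emeasure (distr (coupling \<alpha>) borel (approx n)) A" .
qed (simp add: sets_mu_tilde)

lemma prob_r_seq_le:
  assumes "0 \<le> \<alpha>" "\<alpha> \<le> 1"
  shows "(\<integral>\<omega>. of_bool (r_seq \<omega> n m = 1) \<partial>noise_space \<alpha>) \<le> \<alpha> ^ n"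
proof (cases "nat (m mod 2 ^ (n + 1)) < 2 ^ n")
  case True
  then show ?thesis
    using assms by (simp add: r_seq_def)
next
  case False
  define i where "i = nat (m mod 2 ^ (n + 1)) - 2 ^ n"
  have "nat (m mod 2 ^ (n + 1)) < 2 ^ (n + 1)"
    by (simp add: nat_less_iff)
  then have i: "i < 2 ^ n"
    using False by (simp add: i_def)
  have r: "r_seq \<omega> n m = \<omega> (n, i)" for \<omega>
    using False by (simp add: r_seq_def Let_def i_def)
  have meas: "(\<lambda>\<omega>. \<omega> (n, i)) \<in> noise_space \<alpha> \<rightarrow>\<^sub>M measure_pmf (rho \<alpha> n)"
    unfolding noise_space_def
    using measurable_component_singleton[of "(n, i)" noise_index "\<lambda>(n, i). measure_pmf (rho \<alpha> n)"] i
    by (simp add: noise_index_def)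
  have "(\<integral>\<omega>. of_bool (r_seq \<omega> n m = 1) \<partial>noise_space \<alpha>)
      = (\<integral>b. (of_bool (b = 1) :: real) \<partial>distr (noise_space \<alpha>) (measure_pmf (rho \<alpha> n)) (\<lambda>\<omega>. \<omega> (n, i)))"
    unfolding r by (rule integral_distr[symmetric, OF meas]) simp
  also have "\<dots> = (\<integral>b. indicator {1} b \<partial>measure_pmf (rho \<alpha> n))"
    unfolding distr_noise[OF i] by (rule Bochner_Integration.integral_cong) (auto simp: indicator_def)
  also have "\<dots> = \<alpha> ^ n"
    using pmf_rho(1)[OF assms, of n] by (simp add: measure_pmf_single)
  finally show ?thesis
    by simp
qed

lemma approx_Suc: "approx (Suc n) x m = approx n x m + r_seq (fst x) n (m + int (offset (Suc n) (snd x)))"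
proof -
  have "a_seq (fst x) n (m + int (offset (Suc n) (snd x))) = a_seq (fst x) n (m + int (offset n (snd x)))"
    unfolding offset_Suc using a_seq_periodic[of "fst x" n "m + int (offset n (snd x))" "int (snd x !! n)"]
    by (simp add: add.assoc)
  then show ?thesis
    by (simp add: approx_def shift_by_def del: offset.simps)
qed

lemma prob_approx_Suc_neq:
  assumes "0 \<le> \<alpha>" "\<alpha> \<le> 1"
  shows "measure (coupling \<alpha>) {x \<in> space (coupling \<alpha>). approx (Suc n) x m \<noteq> approx n x m} \<le> \<alpha> ^ n"
proof -
  let ?S = "{x \<in> space (coupling \<alpha>). r_seq (fst x) n (m + int (offset (Suc n) (snd x))) = 1}"
  let ?H = "\<lambda>s \<omega>. of_bool (r_seq \<omega> n (m + int s) = 1) :: real"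
  have r: "Measurable.pred (noise_space \<alpha>) (\<lambda>\<omega>. r_seq \<omega> n j = 1)" for j
  proof -
    have "Measurable.pred (noise_space \<alpha>) (\<lambda>\<omega>. a_seq \<omega> n j = 0 \<longleftrightarrow> a_seq \<omega> (Suc n) j = 1)"
      by measurable
    also have "(\<lambda>\<omega>. a_seq \<omega> n j = 0 \<longleftrightarrow> a_seq \<omega> (Suc n) j = 1) = (\<lambda>\<omega>. r_seq \<omega> n j = 1)"
    proof
      fix \<omega>
      show "(a_seq \<omega> n j = 0 \<longleftrightarrow> a_seq \<omega> (Suc n) j = 1) \<longleftrightarrow> r_seq \<omega> n j = 1"
        by (cases "a_seq \<omega> n j"; cases "r_seq \<omega> n j") simp_all
    qed
    finally show ?thesis .
  qed
  have [measurable]: "?H s \<in> borel_measurable (noise_space \<alpha>)" for s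
    using r[of "m + int s"] by measurable
  have "approx (Suc n) x m \<noteq> approx n x m \<longleftrightarrow> r_seq (fst x) n (m + int (offset (Suc n) (snd x))) = 1" for x
    by (simp add: approx_Suc)
  then have "measure (coupling \<alpha>) {x \<in> space (coupling \<alpha>). approx (Suc n) x m \<noteq> approx n x m} = measure (coupling \<alpha>) ?S"
    by (simp only:)
  also have "\<dots> = (\<integral>x. indicator ?S x \<partial>coupling \<alpha>)"
    by (subst Bochner_Integration.integral_indicator)
      (auto simp del: offset.simps intro!: arg_cong[where f = "measure (coupling \<alpha>)"])
  also have "\<dots> = (\<integral>x. ?H (offset (Suc n) (snd x)) (fst x) \<partial>coupling \<alpha>)"
    by (rule Bochner_Integration.integral_cong) (auto simp: indicator_def)
  also have "\<dots> = (\<Sum>s<2 ^ Suc n. \<integral>\<omega>. ?H s \<omega> \<partial>noise_space \<alpha>) / 2 ^ Suc n"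
    by (rule integral_coupling_offset[where B = 1]) auto
  also have "\<dots> \<le> (\<Sum>s<(2::nat) ^ Suc n. \<alpha> ^ n) / 2 ^ Suc n"
    by (intro divide_right_mono sum_mono prob_r_seq_le assms) auto
  also have "\<dots> = \<alpha> ^ n"
    by simp
  finally show ?thesis .
qed

text \<open>
  A union bound over the later levels: if no level from \<open>n\<close> on changes the coordinate, the limit
  agrees with the approximant.
\<close>

lemma prob_limit_neq_approx:
  assumes "0 < \<alpha>" "\<alpha> < 1"
  shows "measure (coupling \<alpha>) {x \<in> space (coupling \<alpha>). limit_config x m \<noteq> approx n x m} \<le> \<alpha> ^ n / (1 - \<alpha>)"
proof -
  interpret C: prob_space "coupling \<alpha>"
    by (rule prob_space_coupling)
  let ?A = "\<lambda>j. {x \<in> space (coupling \<alpha>). approx (Suc (n + j)) x m \<noteq> approx (n + j) x m}"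
  have sums: "(\<lambda>j. \<alpha> ^ n * \<alpha> ^ j) sums (\<alpha> ^ n * (1 / (1 - \<alpha>)))"
    using assms by (intro sums_mult geometric_sums) auto
  have le: "measure (coupling \<alpha>) (?A j) \<le> \<alpha> ^ n * \<alpha> ^ j" for j
    using prob_approx_Suc_neq[of \<alpha> "n + j" m] assms by (simp add: power_add)
  have summable: "summable (\<lambda>j. measure (coupling \<alpha>) (?A j))"
    using sums_summable[OF sums] by (rule summable_comparison_test_ev[rotated]) (use le in \<open>auto intro!: always_eventually\<close>)
  have meas: "?A j \<in> sets (coupling \<alpha>)" for j
  proof -
    have "?A j = {x \<in> space (coupling \<alpha>). \<not> (approx (Suc (n + j)) x m = 1 \<longleftrightarrow> approx (n + j) x m = 1)}"
      by (intro Collect_cong conj_cong refl arg_cong[where f = Not] bit_eq_iff_eq_one)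
    also have "\<dots> \<in> sets (coupling \<alpha>)"
      by measurable
    finally show ?thesis .
  qed
  have "{x \<in> space (coupling \<alpha>). limit_config x m \<noteq> approx n x m} \<subseteq> (\<Union>j. ?A j)"
  proof
    fix x assume x: "x \<in> {x \<in> space (coupling \<alpha>). limit_config x m \<noteq> approx n x m}"
    show "x \<in> (\<Union>j. ?A j)"
    proof (rule ccontr)
      assume "x \<notin> (\<Union>j. ?A j)"
      with x have step: "approx (Suc (n + j)) x m = approx (n + j) x m" for j
        by auto
      have const: "approx (n + j) x m = approx n x m" for j
        by (induction j) (simp_all add: step)
      have "limit_config x m = approx n x m"
      proof (cases "approx n x m = 1")
        case True
        then have "\<forall>k\<ge>n. approx k x m = 1"
          using const by (metis le_add_diff_inverse)
        with True show ?thesis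
          by (auto simp: limit_config_def)
      next
        case False
        then have "\<not> (\<forall>k\<ge>N. approx k x m = 1)" for N
          using const[of N] by (intro notI) (auto dest!: spec[of _ "n + N"])
        with False show ?thesis
          by (auto simp: limit_config_def)
      qed
      with x show False
        by simp
    qed
  qed
  then have "measure (coupling \<alpha>) {x \<in> space (coupling \<alpha>). limit_config x m \<noteq> approx n x m} \<le> measure (coupling \<alpha>) (\<Union>j. ?A j)"
    by (rule C.finite_measure_mono) (use meas in auto)
  also have "\<dots> \<le> (\<Sum>j. measure (coupling \<alpha>) (?A j))"
    using meas summable by (intro C.finite_measure_subadditive_countably) auto
  also have "\<dots> \<le> (\<Sum>j. \<alpha> ^ n * \<alpha> ^ j)"
    by (intro suminf_le le summable sums_summable[OF sums])
  also have "\<dots> = \<alpha> ^ n / (1 - \<alpha>)"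
    using sums_unique[OF sums] by simp
  finally show ?thesis .
qed

section \<open>The limit measure\<close>

lemma local_bounded:
  fixes f :: "config \<Rightarrow> real"
  assumes "finite F" "local_at F f"
  obtains B where "\<And>a. \<bar>f a\<bar> \<le> B"
proof -
  have "bounded (range f)"
    using finite_range_local[OF assms] by (rule finite_imp_bounded)
  then show ?thesis
    using that unfolding bounded_iff by auto
qed

lemma integral_limit_law:
  fixes f :: "config \<Rightarrow> real"
  assumes "f \<in> borel_measurable borel"
  shows "(\<integral>a. f a \<partial>limit_law \<alpha>) = (\<integral>x. f (limit_config x) \<partial>coupling \<alpha>)"
  unfolding limit_law_def by (rule integral_distr[OF measurable_limit_config assms])

abbreviation differs_on :: "real \<Rightarrow> nat \<Rightarrow> int set \<Rightarrow> ((nat \<times> nat \<Rightarrow> bit) \<times> nat stream) set" where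
  "differs_on \<alpha> n F \<equiv> {x \<in> space (coupling \<alpha>). \<exists>k\<in>F. limit_config x k \<noteq> approx n x k}"

lemma sets_differs_on [measurable]:
  assumes "finite F"
  shows "differs_on \<alpha> n F \<in> sets (coupling \<alpha>)"
proof -
  have "differs_on \<alpha> n F
      = {x \<in> space (coupling \<alpha>). \<exists>k\<in>F. \<not> (limit_config x k = 1 \<longleftrightarrow> approx n x k = 1)}"
    by (intro Collect_cong conj_cong bex_cong refl arg_cong[where f = Not] bit_eq_iff_eq_one)
  also have "\<dots> \<in> sets (coupling \<alpha>)"
    using assms by (intro sets.sets_Collect_finite_Ex) measurable
  finally show ?thesis .
qed

lemma prob_limit_differs_on:
  assumes "0 < \<alpha>" "\<alpha> < 1" "finite F"
  shows "measure (coupling \<alpha>) (differs_on \<alpha> n F)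
    \<le> real (card F) * (\<alpha> ^ n / (1 - \<alpha>))"
proof -
  interpret C: prob_space "coupling \<alpha>"
    by (rule prob_space_coupling)
  let ?A = "\<lambda>k. {x \<in> space (coupling \<alpha>). limit_config x k \<noteq> approx n x k}"
  have meas: "?A k \<in> sets (coupling \<alpha>)" for k
    using sets_differs_on[of "{k}"] by simp
  have "differs_on \<alpha> n F = (\<Union>k\<in>F. ?A k)"
    by auto
  also have "measure (coupling \<alpha>) \<dots> \<le> (\<Sum>k\<in>F. measure (coupling \<alpha>) (?A k))"
    using meas assms(3) by (intro C.finite_measure_subadditive_finite) auto
  also have "\<dots> \<le> (\<Sum>k\<in>F. \<alpha> ^ n / (1 - \<alpha>))"
    by (intro sum_mono prob_limit_neq_approx assms)
  finally show ?thesis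
    by simp
qed

lemma integral_limit_law_close:
  fixes f :: "config \<Rightarrow> real"
  assumes \<alpha>: "0 < \<alpha>" "\<alpha> < 1" and F: "finite F" "local_at F f" and B: "\<And>a. \<bar>f a\<bar> \<le> B"
  shows "\<bar>(\<integral>a. f a \<partial>limit_law \<alpha>) - phase_average \<alpha> n f\<bar> \<le> 2 * B * (real (card F) * (\<alpha> ^ n / (1 - \<alpha>)))"
proof -
  interpret C: prob_space "coupling \<alpha>"
    by (rule prob_space_coupling)
  have f [measurable]: "f \<in> borel_measurable borel"
    by (rule borel_measurable_local[OF F])
  have B0: "0 \<le> B"
    using B[of 0] by linarith
  let ?D = "differs_on \<alpha> n F"
  have D: "?D \<in> sets (coupling \<alpha>)"
    by (rule sets_differs_on[OF F(1)])
  have int: "integrable (coupling \<alpha>) (\<lambda>x. f (limit_config x))" "integrable (coupling \<alpha>) (\<lambda>x. f (approx n x))"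
    by (rule C.integrable_const_bound[of _ B]; (use B in simp)?; measurable)+
  have "\<bar>(\<integral>a. f a \<partial>limit_law \<alpha>) - phase_average \<alpha> n f\<bar>
      = \<bar>\<integral>x. f (limit_config x) - f (approx n x) \<partial>coupling \<alpha>\<bar>"
    using int by (simp add: integral_limit_law[OF f] integral_approx[OF f B])
  also have "\<dots> \<le> (\<integral>x. \<bar>f (limit_config x) - f (approx n x)\<bar> \<partial>coupling \<alpha>)"
    by (rule integral_abs_bound)
  also have "\<dots> \<le> (\<integral>x. 2 * B * indicator ?D x \<partial>coupling \<alpha>)"
  proof (rule integral_mono)
    show "integrable (coupling \<alpha>) (\<lambda>x. 2 * B * indicator ?D x)"
      using D by (intro integrable_mult_right integrable_real_indicator) (auto simp: C.emeasure_eq_measure)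
    fix x assume x: "x \<in> space (coupling \<alpha>)"
    show "\<bar>f (limit_config x) - f (approx n x)\<bar> \<le> 2 * B * indicator ?D x"
    proof (cases "x \<in> ?D")
      case True
      then show ?thesis
        using B[of "limit_config x"] B[of "approx n x"] by simp
    next
      case False
      then have "f (limit_config x) = f (approx n x)"
        using x by (intro local_atD[OF F(2)]) blast
      with False show ?thesis
        by simp
    qed
  qed (use int in auto)
  also have "\<dots> = 2 * B * measure (coupling \<alpha>) ?D"
    using D by (simp add: Int_absorb2 sets.sets_into_space)
  also have "\<dots> \<le> 2 * B * (real (card F) * (\<alpha> ^ n / (1 - \<alpha>)))"
    using B0 by (intro mult_left_mono prob_limit_differs_on \<alpha> F) auto
  finally show ?thesis .
qed

lemma phase_average_tendsto:
  fixes f :: "config \<Rightarrow> real"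
  assumes \<alpha>: "0 < \<alpha>" "\<alpha> < 1" and F: "finite F" "local_at F f"
  shows "(\<lambda>n. phase_average \<alpha> n f) \<longlonglongrightarrow> (\<integral>a. f a \<partial>limit_law \<alpha>)"
proof -
  obtain B where B: "\<And>a. \<bar>f a\<bar> \<le> B"
    using local_bounded[OF F] by blast
  have "(\<lambda>n. \<alpha> ^ n) \<longlonglongrightarrow> 0"
    using \<alpha> by (intro LIMSEQ_power_zero) auto
  then have "(\<lambda>n. 2 * B * (real (card F) * (\<alpha> ^ n / (1 - \<alpha>)))) \<longlonglongrightarrow> 2 * B * (real (card F) * (0 / (1 - \<alpha>)))"
    by (intro tendsto_intros) (use \<alpha> in auto)
  then have lim: "(\<lambda>n. 2 * B * (real (card F) * (\<alpha> ^ n / (1 - \<alpha>)))) \<longlonglongrightarrow> 0"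
    by simp
  have "(\<lambda>n. phase_average \<alpha> n f - (\<integral>a. f a \<partial>limit_law \<alpha>)) \<longlonglongrightarrow> 0"
  proof (rule Lim_null_comparison[OF always_eventually lim], rule allI)
    fix n
    show "norm (phase_average \<alpha> n f - (\<integral>a. f a \<partial>limit_law \<alpha>)) \<le> 2 * B * (real (card F) * (\<alpha> ^ n / (1 - \<alpha>)))"
      using integral_limit_law_close[OF \<alpha> F B, of n] by (simp add: abs_minus_commute)
  qed
  then show ?thesis
    by (simp add: LIM_zero_iff)
qed

lemma integral_mu_tilde_local:
  fixes f :: "config \<Rightarrow> real"
  assumes "finite F" "local_at F f"
  shows "(\<integral>a. f a \<partial>mu_tilde \<alpha> n) = phase_average \<alpha> n f"
proof -
  obtain B where B: "\<And>a. \<bar>f a\<bar> \<le> B"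
    using local_bounded[OF assms] by blast
  have f: "f \<in> borel_measurable borel"
    by (rule borel_measurable_local[OF assms])
  show ?thesis
    unfolding mu_tilde_eq_distr using integral_approx[OF f B] by (simp add: integral_distr[OF measurable_approx f])
qed

text \<open>
  The coupling provides the weak* limit, whose existence the definition by \<open>THE\<close> presupposes.
\<close>

lemma mu_eq_limit_law:
  assumes "0 < \<alpha>" "\<alpha> < 1"
  shows "mu \<alpha> = limit_law \<alpha>"
  unfolding mu_def
proof (rule the_equality)
  have "weak_star_converges (mu_tilde \<alpha>) (limit_law \<alpha>) sequentially"
  proof (rule weak_star_converges_if_local)
    show "prob_space (mu_tilde \<alpha> n)" for n
      unfolding mu_tilde_eq_distr by (rule prob_space.prob_space_distr[OF prob_space_coupling]) measurable
    show "(\<lambda>n. \<integral>a. f a \<partial>mu_tilde \<alpha> n) \<longlonglongrightarrow> (\<integral>a. f a \<partial>limit_law \<alpha>)"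
      if "finite F" "local_at F f" for f :: "config \<Rightarrow> real" and F
      using phase_average_tendsto[OF assms that] by (simp add: integral_mu_tilde_local[OF that])
  qed (simp_all add: sets_mu_tilde sets_limit_law prob_space_limit_law)
  then show "prob_space (limit_law \<alpha>) \<and> sets (limit_law \<alpha>) = sets borel \<and>
      weak_star_converges (mu_tilde \<alpha>) (limit_law \<alpha>) sequentially"
    by (simp add: sets_limit_law prob_space_limit_law)
  fix \<nu> assume \<nu>: "prob_space \<nu> \<and> sets \<nu> = sets borel \<and> weak_star_converges (mu_tilde \<alpha>) \<nu> sequentially"
  show "\<nu> = limit_law \<alpha>"
  proof (rule measure_eq_if_local_integrals_eq)
    fix f :: "config \<Rightarrow> real" and F assume F: "finite F" "local_at F f"
    have "(\<lambda>n. \<integral>a. f a \<partial>mu_tilde \<alpha> n) \<longlonglongrightarrow> (\<integral>a. f a \<partial>\<nu>)"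
      using \<nu> continuous_local[OF F] by (simp add: weak_star_converges_def)
    then show "(\<integral>a. f a \<partial>\<nu>) = (\<integral>a. f a \<partial>limit_law \<alpha>)"
      using phase_average_tendsto[OF assms F] unfolding integral_mu_tilde_local[OF F]
      by (rule LIMSEQ_unique)
  qed (use \<nu> in \<open>simp_all add: sets_limit_law prob_space_limit_law\<close>)
qed

lemma integral_limit_law_shift:
  fixes f :: "config \<Rightarrow> real"
  assumes "0 < \<alpha>" "\<alpha> < 1" "finite F" "local_at F f"
  shows "(\<integral>a. f (shift_by c a) \<partial>limit_law \<alpha>) = (\<integral>a. f a \<partial>limit_law \<alpha>)"
proof -
  have "(\<lambda>n. phase_average \<alpha> n (\<lambda>a. f (shift_by c a))) \<longlonglongrightarrow> (\<integral>a. f (shift_by c a) \<partial>limit_law \<alpha>)"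
    using assms(3) by (intro phase_average_tendsto[OF assms(1,2) _ local_at_shift_by[OF assms(4)]]) simp
  then show ?thesis
    using phase_average_tendsto[OF assms] unfolding phase_average_shift by (rule LIMSEQ_unique)
qed

lemma limit_law_shift_invariant:
  assumes "0 < \<alpha>" "\<alpha> < 1"
  shows "distr (limit_law \<alpha>) borel (shift_by c) = limit_law \<alpha>"
proof (rule measure_eq_if_local_integrals_eq)
  have m: "shift_by c \<in> limit_law \<alpha> \<rightarrow>\<^sub>M borel"
    using measurable_shift_by measurable_cong_sets[OF sets_limit_law refl] by blast
  show "prob_space (distr (limit_law \<alpha>) borel (shift_by c))"
    by (rule prob_space.prob_space_distr[OF prob_space_limit_law m])
  fix f :: "config \<Rightarrow> real" and F assume F: "finite F" "local_at F f"
  show "(\<integral>a. f a \<partial>distr (limit_law \<alpha>) borel (shift_by c)) = (\<integral>a. f a \<partial>limit_law \<alpha>)"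
    using integral_limit_law_shift[OF assms F] by (simp add: integral_distr[OF m borel_measurable_local[OF F]])
qed (simp_all add: sets_limit_law prob_space_limit_law)

section \<open>Decay of Walsh integrals\<close>

text \<open>
  The exponent with which the variable \<open>r\<^sup>i\<^sub>l\<close> enters the character \<open>walsh K\<close> of \<open>a\<^sup>n\<close> shifted
  by \<open>s\<close>; only its parity matters. The upper half of the period of \<open>r\<^sup>i\<close> carries the variables.
\<close>

definition hits :: "int set \<Rightarrow> int \<Rightarrow> nat \<Rightarrow> nat \<Rightarrow> nat" where
  "hits K s i l = card {k \<in> K. (k + s) mod 2 ^ Suc i = 2 ^ i + int l}"

lemma bit_sign_r_seq:
  "bit_sign (r_seq \<omega> i m) = (\<Prod>l<2 ^ i. if m mod 2 ^ Suc i = 2 ^ i + int l then bit_sign (\<omega> (i, l)) else 1)"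
proof -
  define j where "j = nat (m mod 2 ^ Suc i)"
  have j: "m mod 2 ^ Suc i = int j"
    by (simp add: j_def)
  have "int j < 2 ^ Suc i"
    unfolding j[symmetric] by simp
  then have less: "j < 2 * 2 ^ i"
    by (simp flip: of_nat_less_iff[where 'a = int])
  have r: "r_seq \<omega> i m = (if j < 2 ^ i then 0 else \<omega> (i, j - 2 ^ i))"
    by (simp add: r_seq_def j_def)
  have eq: "int j = 2 ^ i + int l \<longleftrightarrow> j = 2 ^ i + l" for l
    by (simp flip: of_nat_eq_iff[where 'a = int])
  show ?thesis
  proof (cases "j < 2 ^ i")
    case True
    then have "j \<noteq> 2 ^ i + l" for l
      by linarith
    with True show ?thesis
      unfolding r j eq by simp
  next
    case False
    have "j = 2 ^ i + l \<longleftrightarrow> l = j - 2 ^ i" for l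
      using False by linarith
    with False less show ?thesis
      unfolding r j eq by simp
  qed
qed

lemma a_seq_eq_sum: "a_seq \<omega> n m = (\<Sum>i<n. r_seq \<omega> i m)"
  by (induction n) (simp_all add: zero_fun_def)

lemma walsh_a_seq:
  assumes "finite K"
  shows "walsh K (shift_by s (a_seq \<omega> n))
    = (\<Prod>(i, l)\<in>(SIGMA i:{..<n}. {..<2 ^ i}). bit_sign (\<omega> (i, l)) ^ hits K s i l)"
proof -
  have "walsh K (shift_by s (a_seq \<omega> n)) = (\<Prod>k\<in>K. \<Prod>i<n. bit_sign (r_seq \<omega> i (k + s)))"
    by (simp add: walsh_def shift_by_def a_seq_eq_sum bit_sign_sum)
  also have "\<dots> = (\<Prod>i<n. \<Prod>k\<in>K. \<Prod>l<2 ^ i. if (k + s) mod 2 ^ Suc i = 2 ^ i + int l then bit_sign (\<omega> (i, l)) else 1)"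
    unfolding bit_sign_r_seq by (rule prod.swap)
  also have "\<dots> = (\<Prod>i<n. \<Prod>l<2 ^ i. \<Prod>k\<in>K. if (k + s) mod 2 ^ Suc i = 2 ^ i + int l then bit_sign (\<omega> (i, l)) else 1)"
    by (intro prod.cong refl prod.swap)
  also have "\<dots> = (\<Prod>i<n. \<Prod>l<2 ^ i. bit_sign (\<omega> (i, l)) ^ hits K s i l)"
    unfolding hits_def prod.inter_filter[OF assms, symmetric] by simp
  also have "\<dots> = (\<Prod>(i, l)\<in>(SIGMA i:{..<n}. {..<2 ^ i}). bit_sign (\<omega> (i, l)) ^ hits K s i l)"
    by (rule prod.Sigma) auto
  finally show ?thesis .
qed

lemma integral_bit_sign_power_rho:
  assumes "0 \<le> \<alpha>" "\<alpha> \<le> 1"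
  shows "(\<integral>b. bit_sign b ^ c \<partial>measure_pmf (rho \<alpha> i)) = (if even c then 1 else 1 - 2 * \<alpha> ^ i)"
proof -
  have "(\<integral>b. bit_sign b ^ c \<partial>measure_pmf (rho \<alpha> i)) = (\<Sum>b\<in>UNIV. bit_sign b ^ c * pmf (rho \<alpha> i) b)"
    by (rule integral_measure_pmf_real) auto
  also have "\<dots> = (if even c then 1 else 1 - 2 * \<alpha> ^ i)"
    using assms by (simp add: UNIV_bit pmf_rho)
  finally show ?thesis .
qed

lemma integral_noise_coordinate:
  fixes g :: "bit \<Rightarrow> real"
  assumes "l < 2 ^ i"
  shows "(\<integral>\<omega>. g (\<omega> (i, l)) \<partial>noise_space \<alpha>) = (\<integral>b. g b \<partial>measure_pmf (rho \<alpha> i))"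
proof -
  have "(\<lambda>\<omega>. \<omega> (i, l)) \<in> noise_space \<alpha> \<rightarrow>\<^sub>M measure_pmf (rho \<alpha> i)"
    unfolding noise_space_def
    using measurable_component_singleton[of "(i, l)" noise_index "\<lambda>(n, i). measure_pmf (rho \<alpha> n)"] assms
    by (simp add: noise_index_def)
  from integral_distr[OF this, of g] show ?thesis
    unfolding distr_noise[OF assms] by simp
qed

lemma integral_noise_prod:
  fixes g :: "nat \<times> nat \<Rightarrow> bit \<Rightarrow> real"
  assumes I: "finite I" "I \<subseteq> noise_index"
  shows "(\<integral>\<omega>. (\<Prod>x\<in>I. g x (\<omega> x)) \<partial>noise_space \<alpha>) = (\<Prod>x\<in>I. \<integral>b. g x b \<partial>measure_pmf (rho \<alpha> (fst x)))"
proof -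
  interpret N: prob_space "noise_space \<alpha>"
    by (rule prob_space_noise)
  have indep: "N.indep_vars (\<lambda>_. borel) (\<lambda>x \<omega>. g x (\<omega> x)) I"
    by (rule N.indep_vars_compose2[OF N.indep_vars_subset[OF indep_noise I(2)]]) (auto split: prod.splits)
  have "(\<integral>\<omega>. (\<Prod>x\<in>I. g x (\<omega> x)) \<partial>noise_space \<alpha>) = (\<Prod>x\<in>I. \<integral>\<omega>. g x (\<omega> x) \<partial>noise_space \<alpha>)"
  proof (rule N.indep_vars_lebesgue_integral[OF I(1) indep])
    fix x assume "x \<in> I"
    then have meas: "(\<lambda>\<omega>. g x (\<omega> x)) \<in> borel_measurable (noise_space \<alpha>)"
      using indep by (auto simp: N.indep_vars_def)
    have "\<bar>g x b\<bar> \<le> max \<bar>g x 0\<bar> \<bar>g x 1\<bar>" for b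
      by (cases b) auto
    with meas show "integrable (noise_space \<alpha>) (\<lambda>\<omega>. g x (\<omega> x))"
      by (intro N.integrable_const_bound[of _ "max \<bar>g x 0\<bar> \<bar>g x 1\<bar>"]) auto
  qed
  also have "\<dots> = (\<Prod>x\<in>I. \<integral>b. g x b \<partial>measure_pmf (rho \<alpha> (fst x)))"
  proof (rule prod.cong)
    fix x assume "x \<in> I"
    then obtain i l where "x = (i, l)" "l < 2 ^ i"
      using I(2) by (auto simp: noise_index_def)
    then show "(\<integral>\<omega>. g x (\<omega> x) \<partial>noise_space \<alpha>) = (\<integral>b. g x b \<partial>measure_pmf (rho \<alpha> (fst x)))"
      by (simp add: integral_noise_coordinate)
  qed simp
  finally show ?thesis .
qed

abbreviation phase_mean :: "real \<Rightarrow> nat \<Rightarrow> int \<Rightarrow> int set \<Rightarrow> real" where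
  "phase_mean \<alpha> n s K \<equiv> \<integral>\<omega>. walsh K (shift_by s (a_seq \<omega> n)) \<partial>noise_space \<alpha>"

text \<open>
  By independence the expectation is a product over all variables, with every factor of modulus at most
  one. At level \<open>j\<close> the hypotheses say that the points of \<open>K\<close> meet pairwise different variables, each
  exactly once.
\<close>

lemma walsh_a_seq_integral_le:
  assumes \<alpha>: "0 \<le> \<alpha>" "\<alpha> \<le> 1" and K: "finite K" and j: "j < n"
    and inj: "inj_on (\<lambda>k. (k + s) mod 2 ^ Suc j) K"
    and upper: "\<And>k. k \<in> K \<Longrightarrow> 2 ^ j \<le> (k + s) mod 2 ^ Suc j"
  shows "\<bar>phase_mean \<alpha> n s K\<bar> \<le> \<bar>1 - 2 * \<alpha> ^ j\<bar> ^ card K"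
proof -
  define I where "I = (SIGMA i:{..<n}. {..<2 ^ i :: nat})"
  define E where "E x = (\<integral>b. bit_sign b ^ hits K s (fst x) (snd x) \<partial>measure_pmf (rho \<alpha> (fst x)))" for x
  have I: "finite I" "I \<subseteq> noise_index"
    by (auto simp: I_def noise_index_def)
  have "phase_mean \<alpha> n s K = (\<Prod>x\<in>I. E x)"
    unfolding walsh_a_seq[OF K] I_def[symmetric]
    using integral_noise_prod[OF I, where g = "\<lambda>x b. bit_sign b ^ hits K s (fst x) (snd x)"]
    by (simp add: E_def case_prod_unfold)
  then have eq: "\<bar>phase_mean \<alpha> n s K\<bar> = (\<Prod>x\<in>I. \<bar>E x\<bar>)"
    by (simp add: abs_prod)
  have E_le: "\<bar>E x\<bar> \<le> 1" for x
  proof -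
    have "0 \<le> \<alpha> ^ fst x" "\<alpha> ^ fst x \<le> 1"
      using \<alpha> by (auto simp: power_le_one)
    then have "\<bar>1 - 2 * \<alpha> ^ fst x\<bar> \<le> 1"
      by linarith
    then show ?thesis
      using \<alpha> by (auto simp: E_def integral_bit_sign_power_rho)
  qed
  define L where "L = (\<lambda>k. (j, nat ((k + s) mod 2 ^ Suc j - 2 ^ j))) ` K"
  have "inj_on (\<lambda>k. (j, nat ((k + s) mod 2 ^ Suc j - 2 ^ j))) K"
  proof (rule inj_onI)
    fix k k' assume k: "k \<in> K" "k' \<in> K"
      "(j, nat ((k + s) mod 2 ^ Suc j - 2 ^ j)) = (j, nat ((k' + s) mod 2 ^ Suc j - 2 ^ j))"
    then have "(k + s) mod 2 ^ Suc j = (k' + s) mod 2 ^ Suc j"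
      using upper[OF k(1)] upper[OF k(2)] by (simp only: prod.inject nat_eq_iff2 int_nat_eq) (simp split: if_splits)
    then show "k = k'"
      using inj k(1,2) by (auto dest: inj_onD)
  qed
  then have cardL: "card L = card K"
    by (simp add: L_def card_image)
  have LI: "L \<subseteq> I"
  proof -
    have "nat ((k + s) mod 2 ^ Suc j - 2 ^ j) < 2 ^ j" if "k \<in> K" for k
    proof -
      have "(k + s) mod 2 ^ Suc j < 2 ^ Suc j"
        by simp
      then show ?thesis
        using upper[OF that] by (simp add: nat_less_iff)
    qed
    then show ?thesis
      using j by (auto simp: L_def I_def)
  qed
  have E_L: "E x = 1 - 2 * \<alpha> ^ j" if "x \<in> L" for x
  proof -
    from that obtain k where k: "k \<in> K" "x = (j, nat ((k + s) mod 2 ^ Suc j - 2 ^ j))"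
      by (auto simp: L_def)
    have "{k' \<in> K. (k' + s) mod 2 ^ Suc j = 2 ^ j + int (snd x)} = {k}"
      using k upper[OF k(1)] inj by (auto dest: inj_onD)
    then have "hits K s j (snd x) = 1"
      by (simp add: hits_def)
    then show ?thesis
      using integral_bit_sign_power_rho[OF \<alpha>, of j 1] k(2) by (simp add: E_def)
  qed
  have "(\<Prod>x\<in>I. \<bar>E x\<bar>) = (\<Prod>x\<in>I - L. \<bar>E x\<bar>) * (\<Prod>x\<in>L. \<bar>E x\<bar>)"
    by (rule prod.subset_diff[OF LI I(1)])
  also have "\<dots> \<le> 1 * (\<Prod>x\<in>L. \<bar>E x\<bar>)"
    by (intro mult_right_mono prod_le_1 prod_nonneg) (auto simp: E_le)
  also have "\<dots> = \<bar>1 - 2 * \<alpha> ^ j\<bar> ^ card K"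
    using E_L by (simp add: cardL)
  finally show ?thesis
    by (simp only: eq)
qed

lemma walsh_a_seq_integral_le_1: "\<bar>phase_mean \<alpha> n s K\<bar> \<le> 1"
proof -
  interpret N: prob_space "noise_space \<alpha>"
    by (rule prob_space_noise)
  have "\<bar>phase_mean \<alpha> n s K\<bar>
      \<le> (\<integral>\<omega>. \<bar>walsh K (shift_by s (a_seq \<omega> n))\<bar> \<partial>noise_space \<alpha>)"
    by (rule integral_abs_bound)
  then show ?thesis
    by (simp add: N.prob_space)
qed

lemma card_digit_eq_le:
  "card {s. s < 2 ^ (a + M + c) \<and> (s div 2 ^ a) mod 2 ^ M = (r :: nat)} \<le> 2 ^ (a + c)"
proof -
  let ?S = "{s. s < 2 ^ (a + M + c) \<and> (s div 2 ^ a) mod 2 ^ M = (r :: nat)}"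
  let ?f = "\<lambda>s :: nat. (s mod 2 ^ a, s div 2 ^ (a + M))"
  have split: "s = s div 2 ^ (a + M) * 2 ^ (a + M) + (s div 2 ^ a mod 2 ^ M) * 2 ^ a + s mod 2 ^ a" for s :: nat
  proof -
    have "s = (s div 2 ^ a) * 2 ^ a + s mod 2 ^ a"
      by (rule div_mult_mod_eq[symmetric])
    also have "s div 2 ^ a = (s div 2 ^ a div 2 ^ M) * 2 ^ M + s div 2 ^ a mod 2 ^ M"
      by (rule div_mult_mod_eq[symmetric])
    also have "s div 2 ^ a div 2 ^ M = s div 2 ^ (a + M)"
      by (simp only: power_add div_mult2_eq)
    finally show ?thesis
      by (simp only: distrib_left distrib_right power_add mult_ac add_ac)
  qed
  have "inj_on ?f ?S"
  proof (rule inj_onI)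
    fix s t assume "s \<in> ?S" "t \<in> ?S" "?f s = ?f t"
    then show "s = t"
      using split[of s] split[of t] by simp
  qed
  moreover have "?f ` ?S \<subseteq> {..<2 ^ a} \<times> {..<2 ^ c}"
    by (auto simp: less_mult_imp_div_less power_add mult_ac)
  ultimately have "card ?S \<le> card ({..<2 ^ a :: nat} \<times> {..<2 ^ c :: nat})"
    by (intro card_inj_on_le) auto
  then show ?thesis
    by (simp add: card_cartesian_product power_add)
qed

lemma odd_digit_exists:
  assumes "x mod 2 ^ M \<noteq> (0 :: nat)"
  obtains i where "i < M" "odd (x div 2 ^ i)"
proof -
  have "take_bit M x \<noteq> 0"
    using assms by (simp add: take_bit_eq_mod)
  then obtain i where "bit (take_bit M x) i"
    by (metis bit_0_eq bit_eq_iff bot_apply bot_bool_def)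
  then have "i < M" "bit x i"
    by (simp_all add: bit_take_bit_iff)
  then show ?thesis
    using that by (simp add: bit_iff_odd)
qed

text \<open>
  If the digits of \<open>s\<close> in positions \<open>J\<close> to \<open>J + M - 1\<close> are not all one, then adding an element of
  \<open>K\<close> produces no carry beyond them; a digit one in position \<open>j \<ge> J + M\<close> then survives in
  \<open>k + s\<close> for all \<open>k \<in> K\<close> at once, which places \<open>K + s\<close> in the upper half modulo
  \<open>2 ^ Suc j\<close>.
\<close>

lemma good_phase:
  assumes K: "K \<subseteq> {0..<2 ^ J}"
    and s1: "(s div 2 ^ J) mod 2 ^ M \<noteq> 2 ^ M - (1 :: nat)"
    and s2: "(s div 2 ^ (J + M)) mod 2 ^ M \<noteq> 0"
  obtains j where "J \<le> j" "j < J + 2 * M" "inj_on (\<lambda>k. (k + int s) mod 2 ^ Suc j) K"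
    "\<And>k. k \<in> K \<Longrightarrow> 2 ^ j \<le> (k + int s) mod 2 ^ Suc j"
proof -
  obtain i where i: "i < M" "odd (s div 2 ^ (J + M) div 2 ^ i)"
    by (rule odd_digit_exists[OF s2])
  define j where "j = J + M + i"
  have digit: "(t + s) div 2 ^ (J + M) = s div 2 ^ (J + M)" if "t < 2 ^ J" for t
  proof -
    define v where "v = s div 2 ^ J"
    have "(t + s) div 2 ^ J \<in> {v, Suc v}"
    proof -
      have "t + s = v * 2 ^ J + (t + s mod 2 ^ J)"
        using div_mult_mod_eq[of s "2 ^ J"] unfolding v_def by linarith
      then have "(t + s) div 2 ^ J = v + (t + s mod 2 ^ J) div 2 ^ J"
        by (metis div_mult_self3 power_not_zero zero_neq_numeral)
      moreover have "(t + s mod 2 ^ J) < 2 * 2 ^ J"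
        using that mod_less_divisor[of "2 ^ J" s] by linarith
      then have "(t + s mod 2 ^ J) div 2 ^ J < 2"
        by (rule less_mult_imp_div_less)
      ultimately show ?thesis
        by auto
    qed
    moreover have "Suc v div 2 ^ M = v div 2 ^ M"
    proof -
      have "Suc (v mod 2 ^ M) \<noteq> 2 ^ M"
        using s1 unfolding v_def by (metis diff_Suc_1)
      then show ?thesis
        by (simp add: div_Suc mod_Suc split: if_splits)
    qed
    ultimately have "(t + s) div 2 ^ J div 2 ^ M = v div 2 ^ M"
      by auto
    then show ?thesis
      by (simp add: v_def power_add div_mult2_eq)
  qed
  have upper: "2 ^ j \<le> (k + int s) mod 2 ^ Suc j" if "k \<in> K" for k
  proof -
    define t where "t = nat k"
    have t: "k = int t" "t < 2 ^ J"
      using that K by (auto simp: t_def nat_less_iff)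
    have "(t + s) div 2 ^ j = s div 2 ^ (J + M) div 2 ^ i"
      unfolding j_def power_add[of 2 "J + M" i] div_mult2_eq digit[OF t(2)] ..
    then have "odd ((t + s) div 2 ^ j)"
      using i(2) by simp
    then have "(t + s) mod 2 ^ Suc j = 2 ^ j + (t + s) mod 2 ^ j"
      by (simp add: mod_mult2_eq[of _ "2 ^ j" 2] mult.commute[of 2] odd_iff_mod_2_eq_one)
    then have "2 ^ j \<le> (t + s) mod 2 ^ Suc j"
      by linarith
    then have "int (2 ^ j) \<le> int ((t + s) mod 2 ^ Suc j)"
      by (simp only: of_nat_le_iff)
    then show ?thesis
      by (simp add: t(1) of_nat_mod)
  qed
  have inj: "inj_on (\<lambda>k. (k + int s) mod 2 ^ Suc j) K"
  proof (rule inj_onI)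
    fix k k' assume k: "k \<in> K" "k' \<in> K" "(k + int s) mod 2 ^ Suc j = (k' + int s) mod 2 ^ Suc j"
    have "2 ^ Suc j dvd (k + int s) - (k' + int s)"
      using k(3) by (rule mod_eq_dvd_iff[THEN iffD1])
    then have dvd: "2 ^ Suc j dvd k - k'"
      by simp
    have "(2 :: int) ^ J \<le> 2 ^ Suc j"
      by (rule power_increasing) (auto simp: j_def)
    then have "\<bar>k - k'\<bar> < 2 ^ Suc j"
    proof -
      have "0 \<le> k" "k < 2 ^ J" "0 \<le> k'" "k' < 2 ^ J"
        using k(1,2) K by auto
      with \<open>(2 :: int) ^ J \<le> 2 ^ Suc j\<close> show ?thesis
        by linarith
    qed
    with dvd show "k = k'"
      by (metis dvd_imp_le_int abs_ge_zero abs_of_nonneg eq_iff_diff_eq_0 linorder_not_less zero_le_numeral zero_le_power)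
  qed
  show ?thesis
    using that[OF _ _ inj upper] i(1) by (simp add: j_def)
qed

lemma one_minus_power_le:
  fixes x :: real
  assumes "0 \<le> x" "x \<le> 1"
  shows "(1 - x) ^ N \<le> 1 / (1 + x * N)"
proof -
  have "(1 - x) ^ N * (1 + x * N) \<le> (1 - x) ^ N * (1 + x) ^ N"
    using assms Bernoulli_inequality[of x N] by (intro mult_left_mono) (auto simp: mult.commute)
  also have "\<dots> = (1 - x * x) ^ N"
    by (simp add: algebra_simps flip: power_mult_distrib)
  also have "\<dots> \<le> 1"
    using assms by (intro power_le_one) (auto simp: mult_le_one)
  finally show ?thesis
    using assms by (simp add: pos_le_divide_eq add_pos_nonneg)
qed

abbreviation walsh_mean :: "real \<Rightarrow> int set \<Rightarrow> real" where
  "walsh_mean \<alpha> K \<equiv> \<integral>a. walsh K a \<partial>limit_law \<alpha>"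

text \<open>
  A proportion of at most \<open>2 / 2 ^ M\<close> of the phases violates one of the two hypotheses of
  \<open>good_phase\<close>; for all others the level found there is below \<open>J + 2 * M\<close>.
\<close>

lemma walsh_integral_le_aux:
  assumes \<alpha>: "0 < \<alpha>" "\<alpha> < 1" and small: "\<alpha> ^ J \<le> 1 / 2" and K: "K \<subseteq> {0..<2 ^ J}"
  shows "\<bar>walsh_mean \<alpha> K\<bar> \<le> 2 / 2 ^ M + 1 / (1 + 2 * \<alpha> ^ (J + 2 * M) * card K)"
proof -
  define q where "q = 1 / (1 + 2 * \<alpha> ^ (J + 2 * M) * card K)"
  have q0: "0 \<le> q"
    using \<alpha> by (simp add: q_def)
  have finK: "finite K"
    using K by (rule finite_subset) simp
  have avg: "\<bar>phase_average \<alpha> (J + 2 * M + c) (walsh K)\<bar> \<le> 2 / 2 ^ M + q" for c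
  proof -
    define n where "n = J + 2 * M + c"
    define I where "I s = phase_mean \<alpha> n (int s) K" for s :: nat
    define B1 where "B1 = {s. s < 2 ^ n \<and> (s div 2 ^ J) mod 2 ^ M = 2 ^ M - (1 :: nat)}"
    define B2 where "B2 = {s. s < 2 ^ n \<and> (s div 2 ^ (J + M)) mod 2 ^ M = (0 :: nat)}"
    have good: "\<bar>I s\<bar> \<le> q" if s: "s < 2 ^ n" "s \<notin> B1 \<union> B2" for s
    proof -
      have "(s div 2 ^ J) mod 2 ^ M \<noteq> 2 ^ M - (1 :: nat)" "(s div 2 ^ (J + M)) mod 2 ^ M \<noteq> (0 :: nat)"
        using s by (auto simp: B1_def B2_def)
      then obtain j where j: "J \<le> j" "j < J + 2 * M" "inj_on (\<lambda>k. (k + int s) mod 2 ^ Suc j) K"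
        "\<And>k. k \<in> K \<Longrightarrow> 2 ^ j \<le> (k + int s) mod 2 ^ Suc j"
        using good_phase[OF K] by blast
      have "\<bar>I s\<bar> \<le> \<bar>1 - 2 * \<alpha> ^ j\<bar> ^ card K"
        unfolding I_def using \<alpha> j finK by (intro walsh_a_seq_integral_le) (auto simp: n_def)
      also have "\<dots> \<le> (1 - 2 * \<alpha> ^ (J + 2 * M)) ^ card K"
      proof (rule power_mono)
        have "\<alpha> ^ j \<le> \<alpha> ^ J"
          using \<alpha> j(1) by (intro power_decreasing) auto
        moreover have "\<alpha> ^ (J + 2 * M) \<le> \<alpha> ^ j"
          using \<alpha> j(2) by (intro power_decreasing) auto
        ultimately show "\<bar>1 - 2 * \<alpha> ^ j\<bar> \<le> 1 - 2 * \<alpha> ^ (J + 2 * M)"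
          using small by linarith
      qed simp
      also have "\<dots> \<le> q"
      proof -
        have "\<alpha> ^ (J + 2 * M) \<le> \<alpha> ^ J"
          using \<alpha> by (intro power_decreasing) auto
        moreover have "0 \<le> \<alpha> ^ (J + 2 * M)"
          using \<alpha> by simp
        ultimately show ?thesis
          unfolding q_def using small by (intro one_minus_power_le; linarith)
      qed
      finally show ?thesis .
    qed
    have "card B1 \<le> 2 ^ (J + (M + c))"
      using card_digit_eq_le[of J M "M + c" "2 ^ M - 1"] by (simp add: B1_def n_def mult_2 add_ac)
    moreover have "card B2 \<le> 2 ^ (J + M + c)"
      using card_digit_eq_le[of "J + M" M c 0] by (simp add: B2_def n_def mult_2 add_ac)
    ultimately have "card (B1 \<union> B2) \<le> 2 * 2 ^ (J + M + c)"
      using card_Un_le[of B1 B2] by (simp add: add_ac)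
    then have "real (card (B1 \<union> B2)) \<le> real (2 * 2 ^ (J + M + c))"
      by (simp only: of_nat_le_iff)
    then have cardB: "real (card (B1 \<union> B2)) \<le> 2 / 2 ^ M * 2 ^ n"
    proof -
      have "n = (J + M + c) + M"
        by (simp add: n_def)
      then have "(2 :: real) ^ n = 2 ^ (J + M + c) * 2 ^ M"
        by (simp only: power_add)
      then have "2 / 2 ^ M * 2 ^ n = real (2 * 2 ^ (J + M + c))"
        by simp
      then show ?thesis
        using \<open>real (card (B1 \<union> B2)) \<le> real (2 * 2 ^ (J + M + c))\<close> by linarith
    qed
    have "\<bar>phase_average \<alpha> n (walsh K)\<bar> = \<bar>\<Sum>s<2 ^ n. I s\<bar> / 2 ^ n"
      by (simp add: phase_average_def I_def)
    also have "\<dots> \<le> (\<Sum>s<2 ^ n. \<bar>I s\<bar>) / 2 ^ n"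
      by (intro divide_right_mono sum_abs) simp
    also have "\<dots> \<le> (\<Sum>s<2 ^ n. indicator (B1 \<union> B2) s + q) / 2 ^ n"
    proof (intro divide_right_mono sum_mono)
      fix s :: nat assume "s \<in> {..<2 ^ n}"
      then show "\<bar>I s\<bar> \<le> indicator (B1 \<union> B2) s + q"
        using good[of s] walsh_a_seq_integral_le_1[where K = K and s = "int s" and n = n and \<alpha> = \<alpha>] q0
        by (cases "s \<in> B1 \<union> B2") (auto simp: I_def)
    qed simp
    also have "(\<Sum>s<2 ^ n. indicator (B1 \<union> B2) s + q) = real (card ({..<2 ^ n} \<inter> (B1 \<union> B2))) + 2 ^ n * q"
      using sum.inter_restrict[of "{..<2 ^ n}" "\<lambda>_. 1 :: real" "B1 \<union> B2"]
      by (simp only: sum.distrib indicator_def of_bool_def) simp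
    also have "{..<2 ^ n} \<inter> (B1 \<union> B2) = B1 \<union> B2"
      by (auto simp: B1_def B2_def)
    also have "(real (card (B1 \<union> B2)) + 2 ^ n * q) / 2 ^ n \<le> (2 / 2 ^ M * 2 ^ n + 2 ^ n * q) / 2 ^ n"
      using cardB by (intro divide_right_mono add_right_mono) auto
    also have "\<dots> = 2 / 2 ^ M + q"
      by (simp add: field_simps)
    finally show ?thesis
      by (simp add: n_def)
  qed
  have "(\<lambda>c. phase_average \<alpha> (J + 2 * M + c) (walsh K)) \<longlonglongrightarrow> walsh_mean \<alpha> K"
    using LIMSEQ_ignore_initial_segment[OF phase_average_tendsto[OF \<alpha> finK local_at_walsh], of "J + 2 * M"]
    by (simp add: add.commute)
  then have "\<bar>walsh_mean \<alpha> K\<bar> \<le> 2 / 2 ^ M + q"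
    by (intro LIMSEQ_le_const2[OF tendsto_rabs]) (use avg in auto)
  then show ?thesis
    by (simp add: q_def)
qed

lemma walsh_shift: "walsh K (shift_by c a) = walsh ((\<lambda>k. k + c) ` K) a"
  unfolding walsh_def shift_by_def by (subst prod.reindex) (auto intro: inj_onI)

lemma walsh_integral_le:
  assumes \<alpha>: "0 < \<alpha>" "\<alpha> < 1" and small: "\<alpha> ^ J \<le> 1 / 2" and K: "K \<subseteq> {c..<c + 2 ^ J}"
  shows "\<bar>walsh_mean \<alpha> K\<bar> \<le> 2 / 2 ^ M + 1 / (1 + 2 * \<alpha> ^ (J + 2 * M) * card K)"
proof -
  define K' where "K' = (\<lambda>k. k + - c) ` K"
  have K': "K' \<subseteq> {0..<2 ^ J}"
    using K by (force simp: K'_def)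
  have fin: "finite K'"
    using K' by (rule finite_subset) simp
  have "(\<lambda>k. k + c) ` K' = K"
    by (simp add: K'_def image_image)
  then have "walsh_mean \<alpha> K = (\<integral>a. walsh K' (shift_by c a) \<partial>limit_law \<alpha>)"
    by (simp add: walsh_shift)
  also have "\<dots> = walsh_mean \<alpha> K'"
    by (rule integral_limit_law_shift[OF \<alpha> fin local_at_walsh])
  finally have eq: "walsh_mean \<alpha> K = walsh_mean \<alpha> K'" .
  have "card K' = card K"
    unfolding K'_def by (rule card_image) (auto intro: inj_onI)
  with walsh_integral_le_aux[OF \<alpha> small K', of M] show ?thesis
    by (simp add: eq)
qed

section \<open>Entropy and Hamming distance to finitely many names\<close>

text \<open>
  The entropy of \<open>p\<close> is at most the expected code length of any code \<open>q\<close>. Explicit choices of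
  \<open>q\<close> replace conditional entropies below.
\<close>

lemma gibbs_inequality:
  fixes p q :: "'a \<Rightarrow> real"
  assumes "\<And>w. w \<in> W \<Longrightarrow> 0 \<le> p w" "(\<Sum>w\<in>W. p w) = 1"
    and "\<And>w. w \<in> W \<Longrightarrow> 0 < q w" "(\<Sum>w\<in>W. q w) \<le> 1"
  shows "- (\<Sum>w\<in>W. p w * ln (p w)) \<le> (\<Sum>w\<in>W. p w * - ln (q w))"
proof -
  have "p w * - ln (q w) + p w * ln (p w) \<ge> p w - q w" if w: "w \<in> W" for w
  proof (cases "p w = 0")
    case True
    then show ?thesis
      using assms(3)[OF w] by simp
  next
    case False
    then have pos: "0 < p w"
      using assms(1)[OF w] by simp
    have "ln (q w / p w) \<le> q w / p w - 1"
      using pos assms(3)[OF w] by (intro ln_le_minus_one) simp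
    then have "p w * ln (q w / p w) \<le> p w * (q w / p w - 1)"
      using pos by (intro mult_left_mono) auto
    then show ?thesis
      using pos assms(3)[OF w] by (simp add: ln_div algebra_simps)
  qed
  then have "(\<Sum>w\<in>W. p w - q w) \<le> (\<Sum>w\<in>W. p w * - ln (q w) + p w * ln (p w))"
    by (rule sum_mono)
  then show ?thesis
    using assms(2,4) by (simp add: sum.distrib sum_subtractf sum_negf)
qed

definition cell :: "'a set set \<Rightarrow> 'a \<Rightarrow> 'a set" where
  "cell P x = (THE A. A \<in> P \<and> x \<in> A)"

lemma cell_unique:
  assumes "partition_on UNIV P"
  shows "cell P x \<in> P" "x \<in> cell P x" "A \<in> P \<Longrightarrow> x \<in> A \<Longrightarrow> cell P x = A"
proof -
  have "\<exists>!A. A \<in> P \<and> x \<in> A"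
    using partition_onD1[OF assms] partition_onD2[OF assms] by (auto simp: disjoint_def)
  then have "cell P x \<in> P \<and> x \<in> cell P x"
    unfolding cell_def by (rule theI')
  then show "cell P x \<in> P" "x \<in> cell P x"
    by auto
  show "A \<in> P \<Longrightarrow> x \<in> A \<Longrightarrow> cell P x = A"
    unfolding cell_def using \<open>\<exists>!A. A \<in> P \<and> x \<in> A\<close> by (rule the1_equality) simp
qed

lemma cell_eq_iff: "partition_on UNIV P \<Longrightarrow> A \<in> P \<Longrightarrow> cell P x = A \<longleftrightarrow> x \<in> A"
  using cell_unique by metis

lemma finite_measurable_partitionD:
  assumes "finite_measurable_partition M P" "space M = UNIV"
  shows "partition_on UNIV P" "finite P" "P \<subseteq> sets M" "0 < card P"
proof -
  show part: "partition_on UNIV P" "finite P" "P \<subseteq> sets M"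
    using assms by (auto simp: finite_measurable_partition_def)
  show "0 < card P"
    using part(2) cell_unique(1)[OF part(1)] by (auto simp: card_gt_0_iff)
qed

definition itinerary :: "'a set set \<Rightarrow> ('a \<Rightarrow> 'a) \<Rightarrow> nat \<Rightarrow> 'a \<Rightarrow> nat \<Rightarrow> 'a set" where
  "itinerary P T N x = (\<lambda>k\<in>{..<N}. cell P ((T ^^ k) x))"

lemma itinerary_eq_iff: "itinerary P T N x = itinerary P T N y \<longleftrightarrow> (\<forall>k<N. cell P ((T ^^ k) x) = cell P ((T ^^ k) y))"
  by (auto simp: itinerary_def fun_eq_iff restrict_def)

lemma itinerary_mem: "partition_on UNIV P \<Longrightarrow> itinerary P T N x \<in> {..<N} \<rightarrow>\<^sub>E P"
  using cell_unique(1) by (auto simp: itinerary_def)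

text \<open>
  Empty intersections are removed in the join, so its members are precisely the level sets of the
  itinerary.
\<close>

lemma iterated_join_eq:
  assumes P: "partition_on UNIV P" and M: "space M = UNIV"
  shows "iterated_join M T P N = range (\<lambda>x. {y. itinerary P T N y = itinerary P T N x})"
proof (induction N)
  case 0
  show ?case
    by (auto simp: M itinerary_eq_iff)
next
  case (Suc N)
  let ?J = "\<lambda>N x. {y. itinerary P T N y = itinerary P T N x}"
  have split: "?J (Suc N) x = ?J N x \<inter> (T ^^ N) -` cell P ((T ^^ N) x)" for x
    using cell_eq_iff[OF P cell_unique(1)[OF P]] by (auto simp: itinerary_eq_iff less_Suc_eq)
  show ?case
  proof (intro equalityI subsetI)
    fix S assume "S \<in> iterated_join M T P (Suc N)"
    then obtain x A where S: "S = ?J N x \<inter> (T ^^ N) -` A" "A \<in> P" "S \<noteq> {}"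
      by (auto simp: partition_join_def pullback_partition_def Suc M)
    then obtain z where z: "z \<in> ?J N x" "(T ^^ N) z \<in> A"
      by auto
    have "?J N x = ?J N z"
      using z(1) by auto
    moreover have "A = cell P ((T ^^ N) z)"
      using cell_unique(3)[OF P S(2) z(2)] by simp
    ultimately have "S = ?J (Suc N) z"
      unfolding split S(1) by simp
    then show "S \<in> range (?J (Suc N))"
      by blast
  next
    fix S assume "S \<in> range (?J (Suc N))"
    then obtain x where S: "S = ?J N x \<inter> (T ^^ N) -` cell P ((T ^^ N) x)"
      unfolding split by blast
    have x: "x \<in> S"
      unfolding S using cell_unique(2)[OF P] by auto
    have "(T ^^ N) -` cell P ((T ^^ N) x) \<in> pullback_partition M (T ^^ N) P"
      using x unfolding S pullback_partition_def M using cell_unique(1)[OF P] by auto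
    moreover have "?J N x \<in> iterated_join M T P N"
      unfolding Suc by blast
    moreover have "S \<noteq> {}"
      using x by blast
    ultimately show "S \<in> iterated_join M T P (Suc N)"
      unfolding iterated_join.simps partition_join_def S by blast
  qed
qed

lemma itinerary_measurable:
  assumes P: "finite_measurable_partition M P" and M: "space M = UNIV" and T: "T \<in> M \<rightarrow>\<^sub>M M"
  shows "itinerary P T N \<in> M \<rightarrow>\<^sub>M count_space ({..<N} \<rightarrow>\<^sub>E P)"
proof -
  note part = finite_measurable_partitionD[OF P M]
  have Tk: "(T ^^ k) \<in> M \<rightarrow>\<^sub>M M" for k
    using T by (rule measurable_compose_n)
  have "itinerary P T N -` {w} \<inter> space M \<in> sets M" if w: "w \<in> {..<N} \<rightarrow>\<^sub>E P" for w
  proof -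
    have "itinerary P T N x = w \<longleftrightarrow> (\<forall>k<N. (T ^^ k) x \<in> w k)" for x
    proof -
      have "itinerary P T N x = w \<longleftrightarrow> (\<forall>k<N. cell P ((T ^^ k) x) = w k)"
        using w by (auto simp: itinerary_def fun_eq_iff restrict_def PiE_iff extensional_def)
      also have "\<dots> \<longleftrightarrow> (\<forall>k<N. (T ^^ k) x \<in> w k)"
        using w cell_eq_iff[OF part(1)] by (auto simp: PiE_iff)
      finally show ?thesis .
    qed
    then have "itinerary P T N -` {w} \<inter> space M = {x \<in> space M. \<forall>k\<in>{..<N}. (T ^^ k) x \<in> w k}"
      by auto
    also have "\<dots> \<in> sets M"
    proof (rule sets.sets_Collect_finite_All)
      fix k assume "k \<in> {..<N}"
      then have "w k \<in> sets M"
        using w part(3) by (auto simp: PiE_iff)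
      from measurable_sets[OF Tk this, of k] show "{x \<in> space M. (T ^^ k) x \<in> w k} \<in> sets M"
        by (simp add: vimage_def Int_def conj_commute)
    qed simp
    finally show ?thesis .
  qed
  then show ?thesis
    using part(2) itinerary_mem[OF part(1)] by (subst measurable_count_space_eq2) (auto intro: finite_PiE)
qed

lemma partition_entropy_itinerary:
  assumes P: "finite_measurable_partition M P" and M: "space M = UNIV"
  shows "partition_entropy M (iterated_join M T P N)
    = - (\<Sum>w\<in>{..<N} \<rightarrow>\<^sub>E P. measure M (itinerary P T N -` {w}) * ln (measure M (itinerary P T N -` {w})))"
proof -
  note part = finite_measurable_partitionD[OF P M]
  let ?c = "\<lambda>w. itinerary P T N -` {w}"
  let ?R = "range (itinerary P T N)"
  have "iterated_join M T P N = ?c ` ?R"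
    unfolding iterated_join_eq[OF part(1) M] by (auto simp: image_image vimage_def)
  moreover have "inj_on ?c ?R"
    by (rule inj_onI) blast
  ultimately have "(\<Sum>A\<in>iterated_join M T P N. measure M A * ln (measure M A))
      = (\<Sum>w\<in>?R. measure M (?c w) * ln (measure M (?c w)))"
    by (simp add: sum.reindex)
  also have "\<dots> = (\<Sum>w\<in>{..<N} \<rightarrow>\<^sub>E P. measure M (?c w) * ln (measure M (?c w)))"
  proof (rule sum.mono_neutral_left)
    show "\<forall>w\<in>({..<N} \<rightarrow>\<^sub>E P) - ?R. measure M (?c w) * ln (measure M (?c w)) = 0"
    proof
      fix w assume "w \<in> ({..<N} \<rightarrow>\<^sub>E P) - ?R"
      then have "?c w = {}"
        by auto
      then show "measure M (?c w) * ln (measure M (?c w)) = 0"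
        by simp
    qed
    show "?R \<subseteq> {..<N} \<rightarrow>\<^sub>E P"
      using itinerary_mem[OF part(1)] by blast
    show "finite ({..<N} \<rightarrow>\<^sub>E P)"
      using part(2) by (auto intro: finite_PiE)
  qed
  finally show ?thesis
    by (simp add: partition_entropy_def)
qed

lemma integral_itinerary:
  fixes h :: "(nat \<Rightarrow> 'a set) \<Rightarrow> real"
  assumes M: "prob_space M" "space M = UNIV" and P: "finite_measurable_partition M P" and T: "T \<in> M \<rightarrow>\<^sub>M M"
  shows "(\<integral>x. h (itinerary P T N x) \<partial>M) = (\<Sum>w\<in>{..<N} \<rightarrow>\<^sub>E P. measure M (itinerary P T N -` {w}) * h w)"
proof -
  interpret M: prob_space M by fact
  note part = finite_measurable_partitionD[OF P M(2)]
  let ?W = "{..<N} \<rightarrow>\<^sub>E P"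
  let ?c = "\<lambda>w. itinerary P T N -` {w}"
  have fin: "finite ?W"
    using part by (auto intro: finite_PiE)
  have sets: "?c w \<in> sets M" if "w \<in> ?W" for w
    using measurable_sets[OF itinerary_measurable[OF P M(2) T], of "{w}" N] that M(2) by simp
  have "h (itinerary P T N x) = (\<Sum>w\<in>?W. h w * indicator (?c w) x)" for x
  proof -
    have "(\<Sum>w\<in>?W. h w * indicator (?c w) x) = (\<Sum>w\<in>{itinerary P T N x}. h w * indicator (?c w) x)"
      using fin itinerary_mem[OF part(1)] by (intro sum.mono_neutral_right) (auto simp: indicator_def)
    then show ?thesis
      by simp
  qed
  then have "(\<integral>x. h (itinerary P T N x) \<partial>M) = (\<integral>x. (\<Sum>w\<in>?W. h w * indicator (?c w) x) \<partial>M)"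
    by simp
  also have "\<dots> = (\<Sum>w\<in>?W. \<integral>x. h w * indicator (?c w) x \<partial>M)"
    using sets by (intro Bochner_Integration.integral_sum integrable_mult_right integrable_real_indicator)
      (auto simp: M.emeasure_eq_measure)
  also have "\<dots> = (\<Sum>w\<in>?W. measure M (?c w) * h w)"
    by (simp add: M(2) mult.commute)
  finally show ?thesis .
qed

definition hamming :: "nat \<Rightarrow> (nat \<Rightarrow> 'b) \<Rightarrow> (nat \<Rightarrow> 'b) \<Rightarrow> nat" where
  "hamming N w y = card {k. k < N \<and> w k \<noteq> y k}"

definition hamming_dist :: "nat \<Rightarrow> (nat \<Rightarrow> 'b) set \<Rightarrow> (nat \<Rightarrow> 'b) \<Rightarrow> nat" where
  "hamming_dist N V w = Min (hamming N w ` V)"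

lemma hamming_dist_le: "finite V \<Longrightarrow> y \<in> V \<Longrightarrow> hamming_dist N V w \<le> hamming N w y"
  by (simp add: hamming_dist_def)

lemma hamming_dist_attained:
  assumes "finite V" "V \<noteq> {}"
  obtains y where "y \<in> V" "hamming_dist N V w = hamming N w y"
proof -
  have "Min (hamming N w ` V) \<in> hamming N w ` V"
    using assms by (intro Min_in) auto
  then show ?thesis
    using that by (auto simp: hamming_dist_def)
qed

text \<open>
  Code an itinerary by first choosing a reference name from \<open>V\<close> uniformly and then replacing every
  letter independently, with probability \<open>\<eta>\<close>, by a uniformly chosen cell. The cost is \<open>ln (card V)\<close>
  for the name, at most \<open>- ln (1 - \<eta>)\<close> for every letter, and at most \<open>ln (card P / \<eta>)\<close> more
  for each wrong one.
\<close>

lemma partition_entropy_le_hamming: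
  assumes M: "prob_space M" "space M = UNIV" and P: "finite_measurable_partition M P" and T: "T \<in> M \<rightarrow>\<^sub>M M"
    and V: "finite V" "V \<noteq> {}" and \<eta>: "0 < \<eta>" "\<eta> < 1"
  shows "partition_entropy M (iterated_join M T P N)
    \<le> ln (card V) - real N * ln (1 - \<eta>) + ln (card P / \<eta>) * (\<integral>x. real (hamming_dist N V (itinerary P T N x)) \<partial>M)"
proof -
  interpret M: prob_space M by fact
  note part = finite_measurable_partitionD[OF P M(2)]
  have V0: "0 < card V"
    using V by (simp add: card_gt_0_iff)
  let ?W = "{..<N} \<rightarrow>\<^sub>E P"
  let ?p = "\<lambda>w. measure M (itinerary P T N -` {w})"
  define \<theta> where "\<theta> = \<eta> / card P"
  have \<theta>: "0 < \<theta>" "\<theta> \<le> 1"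
    using \<eta> part(4) by (auto simp: \<theta>_def divide_le_eq_1)
  \<comment> \<open>The transition probability from the letter b of the reference name to a. Its sum over a in P is at most 1
     even if b is not a cell of P.\<close>
  define t where "t a b = (if a = b then 1 - \<eta> else 0) + \<theta>" for a b :: "'a set"
  define q where "q w = (\<Sum>y\<in>V. \<Prod>k<N. t (w k) (y k)) / card V" for w
  have fin: "finite ?W"
    using part by (auto intro: finite_PiE)
  have t_ge: "(1 - \<eta>) * (if a = b then 1 else \<theta>) \<le> t a b" for a b
    using \<theta> \<eta> by (auto simp: t_def mult_le_cancel_right1)
  have t_nonneg: "0 \<le> t a b" for a b
    using \<theta> \<eta> by (auto simp: t_def)
  have q_ge: "(1 - \<eta>) ^ N * \<theta> ^ hamming_dist N V w / card V \<le> q w" for w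
  proof -
    obtain y where y: "y \<in> V" "hamming_dist N V w = hamming N w y"
      by (rule hamming_dist_attained[OF V])
    have "(1 - \<eta>) ^ N * \<theta> ^ hamming_dist N V w = (\<Prod>k<N. (1 - \<eta>) * (if w k = y k then 1 else \<theta>))"
    proof -
      have "(\<Prod>k<N. if w k = y k then 1 else \<theta>) = (\<Prod>k | k < N \<and> w k \<noteq> y k. \<theta>)"
        by (rule prod.mono_neutral_cong_right) auto
      then show ?thesis
        by (simp add: y(2) prod.distrib hamming_def)
    qed
    also have "\<dots> \<le> (\<Prod>k<N. t (w k) (y k))"
      using \<theta> \<eta> by (intro prod_mono conjI t_ge) auto
    also have "\<dots> \<le> (\<Sum>y\<in>V. \<Prod>k<N. t (w k) (y k))"
      using y(1) V(1) by (intro member_le_sum prod_nonneg t_nonneg) (auto intro!: prod_nonneg t_nonneg)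
    finally show ?thesis
      unfolding q_def by (rule divide_right_mono) simp
  qed
  have low_pos: "0 < (1 - \<eta>) ^ N * \<theta> ^ d / card V" for d
    using \<theta> \<eta> V0 by simp
  have q_pos: "0 < q w" for w
    using low_pos q_ge by (rule less_le_trans)
  have t_sum: "(\<Sum>a\<in>P. t a b) \<le> 1" for b
  proof -
    have "(\<Sum>a\<in>P. t a b) = (if b \<in> P then 1 - \<eta> else 0) + card P * \<theta>"
      using part(2) by (simp add: t_def sum.distrib)
    also have "\<dots> \<le> 1"
      using part(4) \<eta> by (simp add: \<theta>_def)
    finally show ?thesis .
  qed
  have q_sum: "(\<Sum>w\<in>?W. q w) \<le> 1"
  proof -
    have "(\<Sum>w\<in>?W. q w) = (\<Sum>y\<in>V. \<Sum>w\<in>?W. \<Prod>k<N. t (w k) (y k)) / card V"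
      unfolding q_def sum_divide_distrib[symmetric] by (subst sum.swap) simp
    also have "(\<Sum>y\<in>V. \<Sum>w\<in>?W. \<Prod>k<N. t (w k) (y k)) = (\<Sum>y\<in>V. \<Prod>k<N. \<Sum>a\<in>P. t a (y k))"
      by (intro sum.cong refl, subst prod_sum_PiE) (use part in auto)
    also have "\<dots> \<le> (\<Sum>y\<in>V. 1)"
      by (intro sum_mono prod_le_1 conjI sum_nonneg t_nonneg t_sum)
    finally show ?thesis
      using V0 by (simp add: divide_le_eq)
  qed
  have p_sum: "(\<Sum>w\<in>?W. ?p w) = 1"
    using integral_itinerary[OF M P T, of "\<lambda>_. 1" N] by (simp add: M.prob_space)
  have ln_q: "- ln (q w) \<le> ln (card V) - real N * ln (1 - \<eta>) + ln (card P / \<eta>) * real (hamming_dist N V w)" for w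
  proof -
    have "ln ((1 - \<eta>) ^ N * \<theta> ^ hamming_dist N V w / card V) \<le> ln (q w)"
      using q_ge low_pos q_pos by (subst ln_le_cancel_iff)
    moreover have "ln ((1 - \<eta>) ^ N * \<theta> ^ hamming_dist N V w / card V)
        = real N * ln (1 - \<eta>) + real (hamming_dist N V w) * ln \<theta> - ln (card V)"
      using \<theta> \<eta> V0 by (simp add: ln_div ln_mult ln_realpow)
    moreover have "ln \<theta> = - ln (card P / \<eta>)"
      using \<eta> part(4) by (simp add: \<theta>_def ln_div)
    ultimately show ?thesis
      by (simp add: algebra_simps)
  qed
  have "partition_entropy M (iterated_join M T P N) \<le> (\<Sum>w\<in>?W. ?p w * - ln (q w))"
    unfolding partition_entropy_itinerary[OF P M(2)]
    by (rule gibbs_inequality) (use p_sum q_pos q_sum in auto)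
  also have "\<dots> \<le> (\<Sum>w\<in>?W. ?p w * (ln (card V) - real N * ln (1 - \<eta>) + ln (card P / \<eta>) * real (hamming_dist N V w)))"
    by (intro sum_mono mult_left_mono ln_q) simp
  also have "\<dots> = (\<Sum>w\<in>?W. ?p w) * (ln (card V) - real N * ln (1 - \<eta>))
      + ln (card P / \<eta>) * (\<Sum>w\<in>?W. ?p w * real (hamming_dist N V w))"
    by (simp add: distrib_left sum.distrib sum_distrib_left sum_distrib_right mult_ac)
  also have "(\<Sum>w\<in>?W. ?p w * real (hamming_dist N V w)) = (\<integral>x. real (hamming_dist N V (itinerary P T N x)) \<partial>M)"
    by (rule integral_itinerary[OF M P T, symmetric])
  finally show ?thesis
    by (simp add: p_sum)
qed

lemma partition_entropy_nonneg:
  assumes "prob_space M"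
  shows "0 \<le> partition_entropy M Q"
proof -
  interpret M: prob_space M by fact
  have "measure M A * ln (measure M A) \<le> 0" for A
    by (cases "measure M A = 0") (auto intro!: mult_nonneg_nonpos simp: zero_less_measure_iff)
  then show ?thesis
    unfolding partition_entropy_def by (simp add: sum_nonpos)
qed

section \<open>Approximating measurable partitions by local ones\<close>

text \<open>
  The sets with this approximation property form a sigma-algebra that contains the cylinders.
\<close>

lemma local_set_approximation:
  assumes M: "prob_space M" "sets M = sets (borel :: config measure)" and A: "A \<in> sets borel" and e: "0 < e"
  shows "\<exists>F C. finite F \<and> local_at F (\<lambda>x. x \<in> C) \<and> measure M ((A - C) \<union> (C - A)) < e"
proof -
  interpret M: prob_space M by fact
  have sp: "space M = UNIV"
    using M(2) by (simp add: sets_eq_imp_space_eq)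
  have loc: "C \<in> sets M" if "finite F" "local_at F (\<lambda>x. x \<in> C)" for F C
    using open_local[OF that] M(2) by simp
  let ?U = "\<Pi>\<^sub>E i\<in>UNIV. space (borel :: bit measure)"
  let ?E = "{{f \<in> \<Pi>\<^sub>E i\<in>UNIV. space (borel :: bit measure). f i \<in> B} | (i :: int) B. i \<in> UNIV \<and> B \<in> sets (borel :: bit measure)}"
  have "A \<in> sets (PiM UNIV (\<lambda>_::int. borel :: bit measure))"
    using A by (simp add: sets_PiM_equal_borel)
  then have "A \<in> sigma_sets ?U ?E"
    unfolding sets_PiM_single .
  then have "A \<in> sets M \<and> (\<forall>e>0. \<exists>F C. finite F \<and> local_at F (\<lambda>x. x \<in> C) \<and> measure M ((A - C) \<union> (C - A)) < e)"
  proof (induction rule: sigma_sets.induct)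
    case (Basic A)
    then obtain i B where "A = {f. f i \<in> B}"
      by auto
    then have "local_at {i} (\<lambda>x. x \<in> A)"
      by (simp add: local_at_def)
    then show ?case
      using loc[of "{i}" A] by (intro conjI allI impI exI[of _ "{i}"] exI[of _ A]) auto
  next
    case Empty
    have "local_at {} (\<lambda>x. x \<in> {})"
      by (simp add: local_at_def)
    then show ?case
      by (intro conjI allI impI exI[of _ "{}"]) auto
  next
    case (Compl A)
    have uni: "?U = (UNIV :: config set)"
      by auto
    show ?case
    proof (intro conjI allI impI)
      show "?U - A \<in> sets M"
        unfolding uni using Compl sp by (metis sets.compl_sets)
      fix e :: real assume "e > 0"
      then obtain F C where FC: "finite F" "local_at F (\<lambda>x. x \<in> C)" "measure M ((A - C) \<union> (C - A)) < e"
        using Compl by blast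
      have "(UNIV - A - - C) \<union> (- C - (UNIV - A)) = (A - C) \<union> (C - A)"
        by auto
      then show "\<exists>F C. finite F \<and> local_at F (\<lambda>x. x \<in> C) \<and>
          measure M ((?U - A - C) \<union> (C - (?U - A))) < e"
        unfolding uni using FC local_at_comp[OF FC(2), of Not]
        by (intro exI[of _ F] exI[of _ "- C"]) simp
    qed
  next
    case (Union A)
    have sets: "\<And>i. A i \<in> sets M"
      using Union by blast
    show ?case
    proof (intro conjI allI impI)
      show "\<Union> (range A) \<in> sets M"
        using sets by blast
      fix e :: real assume e: "e > 0"
      let ?R = "\<lambda>n. \<Union> (range A) - (\<Union>i<n. A i)"
      have "(\<lambda>n. measure M (?R n)) \<longlonglongrightarrow> measure M (\<Inter>n. ?R n)"
        using sets by (intro M.finite_Lim_measure_decseq) (auto simp: decseq_def)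
      also have "(\<Inter>n. ?R n) = {}"
        by auto
      finally have "(\<lambda>n. measure M (?R n)) \<longlonglongrightarrow> 0"
        by simp
      then have "\<forall>\<^sub>F n in sequentially. measure M (?R n) < e / 2"
        using e by (intro order_tendstoD) auto
      then obtain n where n: "measure M (?R n) < e / 2"
        by (auto simp: eventually_sequentially)
      define d where "d = e / (2 * real (Suc n))"
      have "d > 0"
        using e by (simp add: d_def)
      then have "\<forall>i. \<exists>F C. finite F \<and> local_at F (\<lambda>x. x \<in> C) \<and> measure M ((A i - C) \<union> (C - A i)) < d"
        using Union by blast
      then obtain F C where FC: "\<And>i. finite (F i)" "\<And>i. local_at (F i) (\<lambda>x. x \<in> C i)"
        "\<And>i. measure M ((A i - C i) \<union> (C i - A i)) < d"
        by metis
      let ?C = "\<Union>i<n. C i" and ?F = "\<Union>i<n. F i"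
      have setsC: "C i \<in> sets M" for i
        using loc FC by blast
      have "x \<in> ?C \<longleftrightarrow> y \<in> ?C" if "\<forall>k\<in>?F. x k = y k" for x y
      proof -
        have "x \<in> C i \<longleftrightarrow> y \<in> C i" if "i < n" for i
          using \<open>\<forall>k\<in>?F. x k = y k\<close> that by (intro local_atD[OF FC(2)]) auto
        then show ?thesis
          by auto
      qed
      then have loc_C: "local_at ?F (\<lambda>x. x \<in> ?C)"
        unfolding local_at_def by blast
      have "measure M ((\<Union> (range A) - ?C) \<union> (?C - \<Union> (range A)))
          \<le> measure M (?R n \<union> (\<Union>i<n. (A i - C i) \<union> (C i - A i)))"
        using sets setsC by (intro M.finite_measure_mono) auto
      also have "\<dots> \<le> measure M (?R n) + measure M (\<Union>i<n. (A i - C i) \<union> (C i - A i))"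
        using sets setsC by (intro measure_Un_le) auto
      also have "measure M (\<Union>i<n. (A i - C i) \<union> (C i - A i)) \<le> (\<Sum>i<n. measure M ((A i - C i) \<union> (C i - A i)))"
        using sets setsC by (intro M.finite_measure_subadditive_finite) auto
      also have "\<dots> \<le> (\<Sum>i<n. d)"
        by (intro sum_mono less_imp_le FC)
      also have "\<dots> \<le> e / 2"
        using e by (simp add: d_def field_simps)
      finally have "measure M ((\<Union> (range A) - ?C) \<union> (?C - \<Union> (range A))) < e"
        using n by linarith
      with loc_C FC(1) show "\<exists>F C. finite F \<and> local_at F (\<lambda>x. x \<in> C) \<and>
          measure M ((\<Union> (range A) - C) \<union> (C - \<Union> (range A))) < e"
        by (intro exI[of _ ?F] exI[of _ ?C]) auto
    qed
  qed
  then show ?thesis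
    using e by blast
qed

text \<open>
  Off the bad set \<open>B\<close>, membership in the approximating sets agrees with membership in the cells, so the
  cell can be read off from finitely many coordinates.
\<close>

lemma local_cell_approximation:
  assumes M: "prob_space M" "sets M = sets (borel :: config measure)"
    and P: "finite_measurable_partition M P" and e: "0 < e"
  obtains F \<phi> B where "finite F" "local_at F \<phi>" "B \<in> sets M" "measure M B < e"
    "\<And>x. x \<notin> B \<Longrightarrow> \<phi> x = cell P x"
proof -
  interpret M: prob_space M by fact
  have sp: "space M = UNIV"
    using M(2) by (simp add: sets_eq_imp_space_eq)
  note part = finite_measurable_partitionD[OF P sp]
  have "\<forall>A\<in>P. \<exists>F C. finite F \<and> local_at F (\<lambda>x. x \<in> C) \<and> measure M ((A - C) \<union> (C - A)) < e / card P"
    using part(3) M(2) e part(4) by (intro ballI local_set_approximation[OF M]) auto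
  then obtain F C where FC: "\<And>A. A \<in> P \<Longrightarrow> finite (F A)" "\<And>A. A \<in> P \<Longrightarrow> local_at (F A) (\<lambda>x. x \<in> C A)"
    "\<And>A. A \<in> P \<Longrightarrow> measure M ((A - C A) \<union> (C A - A)) < e / card P"
    by metis
  define B where "B = (\<Union>A\<in>P. (A - C A) \<union> (C A - A))"
  \<comment> \<open>On B there may be no such cell or several; even there the value depends on finitely many coordinates
     only.\<close>
  define \<phi> where "\<phi> x = (THE A. A \<in> P \<and> x \<in> C A)" for x
  have setsC: "C A \<in> sets M" if "A \<in> P" for A
    using open_local[OF FC(1)[OF that] FC(2)[OF that]] M(2) by simp
  show ?thesis
  proof (rule that)
    show "finite (\<Union>A\<in>P. F A)"
      using part(2) FC(1) by auto
    show "local_at (\<Union>A\<in>P. F A) \<phi>"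
      unfolding local_at_def
    proof (intro allI impI)
      fix x y :: config assume "\<forall>k\<in>\<Union>A\<in>P. F A. x k = y k"
      then have "x \<in> C A \<longleftrightarrow> y \<in> C A" if "A \<in> P" for A
        using that by (intro local_atD[OF FC(2)]) auto
      then have "(\<lambda>A. A \<in> P \<and> x \<in> C A) = (\<lambda>A. A \<in> P \<and> y \<in> C A)"
        by auto
      then show "\<phi> x = \<phi> y"
        by (simp add: \<phi>_def)
    qed
    show "B \<in> sets M"
      unfolding B_def using part(2,3) setsC by (intro sets.finite_UN sets.Un sets.Diff) auto
    have "measure M B \<le> (\<Sum>A\<in>P. measure M ((A - C A) \<union> (C A - A)))"
      unfolding B_def using part(2,3) setsC by (intro M.finite_measure_subadditive_finite) auto
    also have "\<dots> < (\<Sum>A\<in>P. e / card P)"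
      using part(2) part(4) FC(3) by (intro sum_strict_mono) auto
    also have "\<dots> = e"
      using part(4) by simp
    finally show "measure M B < e" .
    fix x assume "x \<notin> B"
    then have "A \<in> P \<and> x \<in> C A \<longleftrightarrow> A \<in> P \<and> x \<in> A" for A
      by (auto simp: B_def)
    then show "\<phi> x = cell P x"
      by (simp add: \<phi>_def cell_def)
  qed
qed

section \<open>Zero entropy\<close>

definition periodic_configs :: "nat \<Rightarrow> config set" where
  "periodic_configs n = {a. \<forall>m. a (m mod 2 ^ n) = a m}"

lemma finite_periodic_configs: "finite (periodic_configs n)"
proof (rule finite_imageD)
  let ?r = "\<lambda>a :: config. \<lambda>i\<in>{0..<2 ^ n}. a i"
  have "?r ` periodic_configs n \<subseteq> {0..<2 ^ n} \<rightarrow>\<^sub>E UNIV"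
    by auto
  then show "finite (?r ` periodic_configs n)"
    by (rule finite_subset) (auto intro: finite_PiE)
  show "inj_on ?r (periodic_configs n)"
  proof (rule inj_onI, rule ext)
    fix a b :: config and m :: int assume ab: "a \<in> periodic_configs n" "b \<in> periodic_configs n" "?r a = ?r b"
    have "m mod 2 ^ n \<in> {0..<2 ^ n}"
      by simp
    then have "a (m mod 2 ^ n) = b (m mod 2 ^ n)"
      using fun_cong[OF ab(3), of "m mod 2 ^ n"] by (simp only: restrict_apply if_True)
    then show "a m = b m"
      using ab(1,2) by (simp add: periodic_configs_def)
  qed
qed

lemma approx_periodic: "approx n x \<in> periodic_configs n"
proof -
  have "a_seq \<omega> n (m mod 2 ^ n + s) = a_seq \<omega> n (m + s)" for \<omega> m s
    using a_seq_periodic[of \<omega> n "m mod 2 ^ n + s" "m div 2 ^ n"] mult_div_mod_eq[of "2 ^ n" m]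
    by (simp add: algebra_simps)
  then show ?thesis
    by (simp add: periodic_configs_def approx_def shift_by_def)
qed

text \<open>
  The reference names are the local names of the \<open>2 ^ n\<close>-periodic configurations: their number does
  not grow with the length \<open>N\<close>. A letter of the itinerary of the limit can differ from that of the
  approximant for two reasons, the error \<open>e\<close> of the local name and a differing coordinate in the window
  \<open>F\<close>.
\<close>

lemma entropy_rate_bound:
  assumes \<alpha>: "0 < \<alpha>" "\<alpha> < 1" and P: "finite_measurable_partition (limit_law \<alpha>) P"
    and F: "finite F" "local_at F \<phi>"
    and B: "B \<in> sets borel" "measure (limit_law \<alpha>) B \<le> e" "\<And>x. x \<notin> B \<Longrightarrow> \<phi> x = cell P x"
    and \<eta>: "0 < \<eta>" "\<eta> < 1"
  shows "partition_entropy (limit_law \<alpha>) (iterated_join (limit_law \<alpha>) config_shift P N)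
    \<le> ln (card (periodic_configs n)) - real N * ln (1 - \<eta>)
      + ln (card P / \<eta>) * (real N * (e + real (card F) * (\<alpha> ^ n / (1 - \<alpha>))))"
proof -
  interpret M: prob_space "limit_law \<alpha>"
    by (rule prob_space_limit_law)
  interpret C: prob_space "coupling \<alpha>"
    by (rule prob_space_coupling)
  note part = finite_measurable_partitionD[OF P space_limit_law]
  have T: "config_shift \<in> limit_law \<alpha> \<rightarrow>\<^sub>M limit_law \<alpha>"
    using borel_measurable_config_shift_power[of 1] measurable_cong_sets[OF sets_limit_law sets_limit_law] by simp
  define name where "name a k = \<phi> (shift_by (int k) a)" for a and k :: nat
  define V where "V = name ` periodic_configs n"
  have V: "finite V" "V \<noteq> {}"
    using finite_periodic_configs approx_periodic[of n undefined] by (auto simp: V_def)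
  have cardV: "card V \<le> card (periodic_configs n)" "0 < card V"
    unfolding V_def using V finite_periodic_configs card_image_le by (auto simp: V_def card_gt_0_iff)
  let ?it = "itinerary P config_shift N"
  have it: "?it a k = cell P (shift_by (int k) a)" if "k < N" for a k
    using that by (simp add: itinerary_def config_shift_power)
  let ?d = "\<lambda>a. real (hamming_dist N V (?it a))"
  have it_meas: "?it \<in> borel \<rightarrow>\<^sub>M count_space ({..<N} \<rightarrow>\<^sub>E P)"
    using itinerary_measurable[OF P space_limit_law T] measurable_cong_sets[OF sets_limit_law refl] by blast
  have d_meas: "?d \<in> borel_measurable borel"
    by (rule measurable_compose[OF it_meas]) simp
  let ?Bk = "\<lambda>k. {x \<in> space (coupling \<alpha>). shift_by (int k) (limit_config x) \<in> B}"
  let ?Dk = "\<lambda>k. differs_on \<alpha> n ((\<lambda>j. j + int k) ` F)"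
  have Bk: "?Bk k \<in> sets (coupling \<alpha>)" for k
    using B(1) by measurable
  have Dk: "?Dk k \<in> sets (coupling \<alpha>)" for k
    using F(1) by (intro sets_differs_on) simp
  have pBk: "measure (coupling \<alpha>) (?Bk k) \<le> e" for k
  proof -
    have "measure (coupling \<alpha>) (?Bk k) = measure (distr (limit_law \<alpha>) borel (shift_by (int k))) B"
      unfolding limit_law_def using B(1)
      by (simp add: measure_distr distr_distr comp_def vimage_def Int_def conj_commute)
    then show ?thesis
      using B(2) limit_law_shift_invariant[OF \<alpha>, of "int k"] by simp
  qed
  have pDk: "measure (coupling \<alpha>) (?Dk k) \<le> real (card F) * (\<alpha> ^ n / (1 - \<alpha>))" for k
  proof -
    have "card ((\<lambda>j. j + int k) ` F) = card F"
      by (rule card_image) (auto intro: inj_onI)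
    with prob_limit_differs_on[OF \<alpha>, of "(\<lambda>j. j + int k) ` F" n] F(1) show ?thesis
      by simp
  qed
  have d_le: "?d (limit_config x) \<le> (\<Sum>k<N. indicator (?Bk k) x + indicator (?Dk k) x)"
    if x: "x \<in> space (coupling \<alpha>)" for x
  proof -
    have "hamming_dist N V (?it (limit_config x)) \<le> hamming N (?it (limit_config x)) (name (approx n x))"
      by (rule hamming_dist_le[OF V(1)]) (simp add: V_def approx_periodic)
    also have "real \<dots> = (\<Sum>k<N. of_bool (?it (limit_config x) k \<noteq> name (approx n x) k))"
      by (simp add: hamming_def of_bool_def sum.If_cases Int_def)
    also have "\<dots> \<le> (\<Sum>k<N. indicator (?Bk k) x + indicator (?Dk k) x)"
    proof (rule sum_mono)
      fix k assume "k \<in> {..<N}"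
      then have k: "k < N"
        by simp
      show "of_bool (?it (limit_config x) k \<noteq> name (approx n x) k) \<le> (indicator (?Bk k) x + indicator (?Dk k) x :: real)"
      proof (cases "x \<in> ?Bk k \<or> x \<in> ?Dk k")
        case True
        then show ?thesis
          by (auto simp: indicator_def)
      next
        case False
        then have "\<phi> (shift_by (int k) (limit_config x)) = ?it (limit_config x) k"
          using x B(3) by (simp add: it[OF k])
        moreover have "\<phi> (shift_by (int k) (limit_config x)) = \<phi> (shift_by (int k) (approx n x))"
          using False x by (intro local_atD[OF F(2)]) (auto simp: shift_by_def)
        ultimately show ?thesis
          by (simp add: name_def)
      qed
    qed
    finally show ?thesis
      by simp
  qed
  have ind: "integrable (coupling \<alpha>) (indicator (?Bk k) :: _ \<Rightarrow> real)" "integrable (coupling \<alpha>) (indicator (?Dk k) :: _ \<Rightarrow> real)" for k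
    using Bk[of k] Dk[of k] by (auto simp: C.emeasure_eq_measure)
  have integral_ind: "(\<integral>x. indicator S x \<partial>coupling \<alpha>) = measure (coupling \<alpha>) S" if "S \<in> sets (coupling \<alpha>)" for S
    using that by (simp add: Int_absorb2 sets.sets_into_space)
  have "(\<integral>a. ?d a \<partial>limit_law \<alpha>) = (\<integral>x. ?d (limit_config x) \<partial>coupling \<alpha>)"
    by (rule integral_limit_law[OF d_meas])
  also have "\<dots> \<le> (\<integral>x. (\<Sum>k<N. indicator (?Bk k) x + indicator (?Dk k) x) \<partial>coupling \<alpha>)"
  proof (rule integral_mono')
    show "integrable (coupling \<alpha>) (\<lambda>x. \<Sum>k<N. indicator (?Bk k) x + indicator (?Dk k) x :: real)"
      by (intro Bochner_Integration.integrable_sum Bochner_Integration.integrable_add ind)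
  qed (use d_le in \<open>auto intro!: sum_nonneg\<close>)
  also have "\<dots> = (\<Sum>k<N. \<integral>x. indicator (?Bk k) x + indicator (?Dk k) x \<partial>coupling \<alpha>)"
    by (intro Bochner_Integration.integral_sum Bochner_Integration.integrable_add ind)
  also have "\<dots> = (\<Sum>k<N. measure (coupling \<alpha>) (?Bk k) + measure (coupling \<alpha>) (?Dk k))"
    by (intro sum.cong refl) (simp only: Bochner_Integration.integral_add[OF ind] integral_ind Bk Dk)
  also have "\<dots> \<le> (\<Sum>k<N. e + real (card F) * (\<alpha> ^ n / (1 - \<alpha>)))"
    by (intro sum_mono add_mono pBk pDk)
  finally have ham: "(\<integral>a. ?d a \<partial>limit_law \<alpha>) \<le> real N * (e + real (card F) * (\<alpha> ^ n / (1 - \<alpha>)))"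
    by simp
  have "1 \<le> card P / \<eta>"
    using part(4) \<eta> by (simp add: field_simps)
  then have "0 \<le> ln (card P / \<eta>)"
    by (rule ln_ge_zero)
  then have "ln (card P / \<eta>) * (\<integral>a. ?d a \<partial>limit_law \<alpha>) \<le> ln (card P / \<eta>) * (real N * (e + real (card F) * (\<alpha> ^ n / (1 - \<alpha>))))"
    using ham by (rule mult_left_mono[rotated])
  moreover have "ln (card V) \<le> ln (card (periodic_configs n))"
    using cardV by simp
  ultimately show ?thesis
    using partition_entropy_le_hamming[OF prob_space_limit_law space_limit_law P T V \<eta>, of N] by linarith
qed

lemma entropy_rate_zero:
  assumes \<alpha>: "0 < \<alpha>" "\<alpha> < 1" and P: "finite_measurable_partition (limit_law \<alpha>) P"
  shows "(\<lambda>N. partition_entropy (limit_law \<alpha>) (iterated_join (limit_law \<alpha>) config_shift P N) / real N) \<longlonglongrightarrow> 0"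
    (is "(\<lambda>N. ?H N / real N) \<longlonglongrightarrow> 0")
proof (rule LIMSEQ_I)
  fix r :: real assume r: "0 < r"
  note part = finite_measurable_partitionD[OF P space_limit_law]
  define \<eta> where "\<eta> = 1 - exp (- (r / 4))"
  have \<eta>: "0 < \<eta>" "\<eta> < 1" "- ln (1 - \<eta>) \<le> r / 4"
    using r by (auto simp: \<eta>_def)
  define c where "c = ln (card P / \<eta>)"
  have "1 < card P / \<eta>"
    using part(4) \<eta> by (simp add: field_simps)
  then have c: "0 < c"
    unfolding c_def by simp
  define e where "e = r / (8 * c)"
  have e: "0 < e"
    using r c by (simp add: e_def)
  obtain F \<phi> B where F: "finite F" "local_at F \<phi>" and B: "B \<in> sets (limit_law \<alpha>)" "measure (limit_law \<alpha>) B < e"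
    "\<And>x. x \<notin> B \<Longrightarrow> \<phi> x = cell P x"
    using local_cell_approximation[OF prob_space_limit_law sets_limit_law P e] by blast
  have "(\<lambda>n. \<alpha> ^ n) \<longlonglongrightarrow> 0"
    using \<alpha> by (intro LIMSEQ_power_zero) auto
  then have "(\<lambda>n. real (card F) * (\<alpha> ^ n / (1 - \<alpha>))) \<longlonglongrightarrow> real (card F) * (0 / (1 - \<alpha>))"
    by (intro tendsto_intros) (use \<alpha> in auto)
  then have "\<forall>\<^sub>F n in sequentially. real (card F) * (\<alpha> ^ n / (1 - \<alpha>)) < e"
    using e by (intro order_tendstoD) auto
  then obtain n where n: "real (card F) * (\<alpha> ^ n / (1 - \<alpha>)) < e"
    by (auto simp: eventually_sequentially)
  define L where "L = ln (card (periodic_configs n))"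
  obtain N0 where N0: "real N0 > 4 * \<bar>L\<bar> / r"
    using reals_Archimedean2 by blast
  show "\<exists>no. \<forall>N\<ge>no. norm (?H N / real N - 0) < r"
  proof (intro exI allI impI)
    fix N assume N: "Suc N0 \<le> N"
    then have Npos: "0 < real N"
      by simp
    have "4 * \<bar>L\<bar> / r < real N"
      using N0 N by linarith
    then have "L \<le> real N * (r / 4)"
      using r by (simp add: field_simps)
    moreover have "- real N * ln (1 - \<eta>) \<le> real N * (r / 4)"
      using \<eta>(3) Npos mult_left_mono[of "- ln (1 - \<eta>)" "r / 4" "real N"] by simp
    moreover have "c * (real N * (e + real (card F) * (\<alpha> ^ n / (1 - \<alpha>)))) \<le> real N * (r / 4)"
    proof -
      have "c * (real N * (e + real (card F) * (\<alpha> ^ n / (1 - \<alpha>)))) \<le> c * (real N * (e + e))"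
        using c n by (intro mult_left_mono) auto
      also have "\<dots> = real N * (r / 4)"
        using c by (simp add: e_def)
      finally show ?thesis .
    qed
    moreover have "?H N \<le> L - real N * ln (1 - \<eta>) + c * (real N * (e + real (card F) * (\<alpha> ^ n / (1 - \<alpha>))))"
      unfolding L_def c_def using B by (intro entropy_rate_bound[OF \<alpha> P F _ _ B(3) \<eta>(1,2)]) (auto simp: sets_limit_law)
    ultimately have "?H N \<le> real N * (r / 4) + real N * (r / 4) + real N * (r / 4)"
      by linarith
    then have "?H N \<le> real N * (3 / 4 * r)"
      by (simp add: mult_ac)
    also have "\<dots> < real N * r"
      using r Npos by simp
    finally have "?H N / real N < r"
      using Npos by (simp add: divide_less_eq mult.commute)
    moreover have "0 \<le> ?H N / real N"
      using partition_entropy_nonneg[OF prob_space_limit_law] by simp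
    ultimately show "norm (?H N / real N - 0) < r"
      by simp
  qed
qed

lemma ks_entropy_limit_law:
  assumes "0 < \<alpha>" "\<alpha> < 1"
  shows "ks_entropy (limit_law \<alpha>) config_shift = 0"
proof -
  have zero: "ks_entropy_wrt (limit_law \<alpha>) config_shift P = 0" if "finite_measurable_partition (limit_law \<alpha>) P" for P
    unfolding ks_entropy_wrt_def by (rule limI[OF entropy_rate_zero[OF assms that]])
  have "finite_measurable_partition (limit_law \<alpha>) {UNIV}"
    using sets.top[of "limit_law \<alpha>"] by (auto simp: finite_measurable_partition_def partition_on_def space_limit_law)
  then have "{P. finite_measurable_partition (limit_law \<alpha>) P} \<noteq> {}"
    by blast
  then show ?thesis
    unfolding ks_entropy_def using zero by (intro SUP_eq_const) (auto simp: zero_ereal_def)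
qed

section \<open>Lucas mixing and asymptotic randomization\<close>

lemma shift_by_Phi_power: "(Phi ^^ h) (shift_by c a) = shift_by c ((Phi ^^ h) a)"
proof (induction h)
  case (Suc h)
  have "Phi (shift_by c b) = shift_by c (Phi b)" for b
    by (rule ext) (simp add: Phi_def config_shift_def shift_by_def add_ac)
  with Suc show ?case
    by simp
qed simp

lemma walsh_poly: "walsh (int ` poly_support p) a = bit_sign (pairing p a)"
  by (simp add: walsh_def pairing_def bit_sign_sum prod.reindex)

definition shifted_support :: "int \<Rightarrow> bit poly \<Rightarrow> int set" where
  "shifted_support c p = (\<lambda>k. k + c) ` int ` poly_support p"

text \<open>
  Translating \<open>K\<close> to start at \<open>0\<close> makes it the set of exponents of a polynomial; \<open>Phi\<close> commutes
  with the translation.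
\<close>

lemma walsh_as_poly:
  assumes "finite K" "K \<noteq> {}"
  obtains p where "p \<noteq> 0" "degree p = nat (Max K - Min K)"
    "\<forall>h a. walsh K ((Phi ^^ h) a) = walsh (shifted_support (Min K) (p * [:1, 1:] ^ h)) a"
proof -
  define w where "w = nat (Max K - Min K)"
  define p :: "bit poly" where "p = (\<Sum>k\<in>K. monom 1 (nat (k - Min K)))"
  have bounds: "Min K \<le> k" "k \<le> Max K" if "k \<in> K" for k
    using assms that by auto
  have coeff: "coeff p i = (if int i + Min K \<in> K then 1 else 0)" for i
  proof -
    have "coeff p i = (\<Sum>k\<in>K. if k = int i + Min K then 1 else 0)"
      unfolding p_def coeff_sum using bounds by (intro sum.cong) (auto simp: nat_eq_iff)
    then show ?thesis
      using assms(1) by simp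
  qed
  have supp: "shifted_support (Min K) p = K"
  proof -
    have "k \<in> shifted_support (Min K) p" if "k \<in> K" for k
      using that bounds[OF that] by (auto simp: shifted_support_def poly_support_def coeff image_image intro!: image_eqI[of _ _ "nat (k - Min K)"])
    moreover have "shifted_support (Min K) p \<subseteq> K"
      by (auto simp: shifted_support_def poly_support_def coeff split: if_splits)
    ultimately show ?thesis
      by blast
  qed
  have "coeff p w = 1"
    using assms by (simp add: coeff w_def)
  moreover have "coeff p i = 0" if "w < i" for i
    using that bounds[of "int i + Min K"] by (auto simp: coeff w_def)
  ultimately have deg: "degree p = w"
    by (intro antisym degree_le le_degree) auto
  have "p \<noteq> 0"
    using \<open>coeff p w = 1\<close> by auto
  moreover have "walsh K ((Phi ^^ h) a) = walsh (shifted_support (Min K) (p * [:1, 1:] ^ h)) a" for h a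
  proof -
    have "walsh K ((Phi ^^ h) a) = walsh (int ` poly_support p) ((Phi ^^ h) (shift_by (Min K) a))"
      unfolding shift_by_Phi_power walsh_shift supp[unfolded shifted_support_def] ..
    also have "\<dots> = walsh (shifted_support (Min K) (p * [:1, 1:] ^ h)) a"
      unfolding walsh_poly pairing_Phi_power unfolding walsh_poly[symmetric] walsh_shift shifted_support_def ..
    finally show ?thesis .
  qed
  ultimately show ?thesis
    using that deg by (simp add: w_def)
qed

lemma card_shifted_support: "card (shifted_support c p) = weight p"
  unfolding shifted_support_def by (subst card_image, simp add: inj_on_def)+ simp

text \<open>
  Here the number of terms, at least \<open>2 ^ ones (q h)\<close> or \<open>2 ^ ones (Suc (q h))\<close>, is weighed against
  the diameter, which is below \<open>2 ^ (bit_length (q h) + r + 1)\<close>.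
\<close>

lemma walsh_decay_along_heavy_powers:
  assumes \<alpha>: "0 < \<alpha>" "\<alpha> < 1" and Q: "\<And>h. Q h \<noteq> 0" "\<And>h. degree (Q h) < 2 * 2 ^ r"
    and heavy: "\<And>C. \<exists>m. \<forall>h\<in>J. m \<le> h \<longrightarrow> C \<le> 2 ^ ones (q h) * \<alpha> ^ bit_length (q h)
        \<and> C \<le> 2 ^ ones (Suc (q h)) * \<alpha> ^ bit_length (Suc (q h))"
    and q: "filterlim q at_top sequentially"
  shows "((\<lambda>h. \<integral>a. walsh (shifted_support c (Q h * [:1, 1:] ^ (2 ^ r * q h))) a \<partial>limit_law \<alpha>) \<longlongrightarrow> 0)
    (inf sequentially (principal J))"
proof (rule tendstoI)
  fix e :: real assume e: "0 < e"
  obtain M where M: "2 / 2 ^ M < e / 2"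
  proof -
    have "(\<lambda>M. 2 * (1 / 2) ^ M :: real) \<longlonglongrightarrow> 0"
      by (intro tendsto_mult_right_zero LIMSEQ_power_zero) simp
    then have "\<forall>\<^sub>F M in sequentially. 2 * (1 / 2) ^ M < e / 2"
      by (rule order_tendstoD) (use e in simp)
    then obtain M where "2 * (1 / 2) ^ M < e / 2"
      by (auto simp: eventually_sequentially)
    then show ?thesis
      by (intro that[of M]) (simp add: power_divide)
  qed
  \<comment> \<open>With J = bit_length (q h) + r + 1, the exponent J + 2 * M of the decay bound is bit_length (q h) + s.\<close>
  define s where "s = r + 1 + 2 * M"
  obtain C where C: "1 / (1 + 2 * \<alpha> ^ s * C) < e / 2" "0 \<le> C"
  proof -
    have "0 < 2 * \<alpha> ^ s"
      using \<alpha> by simp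
    define C where "C = (2 / e) / (2 * \<alpha> ^ s)"
    have "2 * \<alpha> ^ s * C = 2 / e"
      using \<alpha> by (simp add: C_def)
    moreover have "1 / (1 + 2 / e) < e / 2"
      using e by (simp add: field_simps)
    ultimately have "1 / (1 + 2 * \<alpha> ^ s * C) < e / 2"
      by (simp only:)
    moreover have "0 \<le> C"
      using e \<alpha> by (simp add: C_def)
    ultimately show ?thesis
      by (rule that)
  qed
  obtain l where l: "\<alpha> ^ l \<le> 1 / 2"
  proof -
    have "(\<lambda>l. \<alpha> ^ l) \<longlonglongrightarrow> 0"
      using \<alpha> by (intro LIMSEQ_power_zero) auto
    then have "\<forall>\<^sub>F l in sequentially. \<alpha> ^ l < 1 / 2"
      by (intro order_tendstoD) auto
    then obtain l where "\<alpha> ^ l < 1 / 2"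
      by (auto simp: eventually_sequentially)
    then show ?thesis
      by (intro that[of l]) simp
  qed
  obtain m where m: "\<forall>h\<in>J. m \<le> h \<longrightarrow> C / \<alpha> \<le> 2 ^ ones (q h) * \<alpha> ^ bit_length (q h)
        \<and> C / \<alpha> \<le> 2 ^ ones (Suc (q h)) * \<alpha> ^ bit_length (Suc (q h))"
    using heavy by blast
  have "\<forall>\<^sub>F h in sequentially. 2 ^ l \<le> q h"
    using q by (simp add: filterlim_at_top)
  then have "\<forall>\<^sub>F h in sequentially. m \<le> h \<and> 2 ^ l \<le> q h"
    using eventually_ge_at_top by (rule eventually_conj[rotated])
  then show "\<forall>\<^sub>F h in inf sequentially (principal J).
      dist (\<integral>a. walsh (shifted_support c (Q h * [:1, 1:] ^ (2 ^ r * q h))) a \<partial>limit_law \<alpha>) 0 < e"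
    unfolding eventually_inf_principal
  proof eventually_elim
    case (elim h)
    show ?case
    proof
      assume h: "h \<in> J"
      define K where "K = shifted_support c (Q h * [:1, 1:] ^ (2 ^ r * q h))"
      define b where "b = bit_length (q h)"
      define L where "L = b + r + 1"
      have "2 ^ l < (2 :: nat) ^ b"
        using elim less_power_bit_length[of "q h"] unfolding b_def by linarith
      then have "l < b"
        by (rule power_less_imp_less_exp[rotated]) simp
      then have "\<alpha> ^ L \<le> \<alpha> ^ l"
        using \<alpha> by (intro power_decreasing) (auto simp: L_def)
      then have small: "\<alpha> ^ L \<le> 1 / 2"
        using l by linarith
      have "degree (Q h * [:1, 1:] ^ (2 ^ r * q h)) < 2 ^ L"
      proof -
        have "degree ([:1, 1:] ^ (2 ^ r * q h) :: bit poly) \<le> 1 * (2 ^ r * q h)"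
          by (rule order_trans[OF degree_power_le]) simp
        then have "degree (Q h * [:1, 1:] ^ (2 ^ r * q h)) \<le> degree (Q h) + 2 ^ r * q h"
          using degree_mult_le[of "Q h" "[:1, 1:] ^ (2 ^ r * q h)"] by linarith
        also have "\<dots> < 2 * 2 ^ r + 2 ^ r * q h"
          using Q(2) by simp
        also have "\<dots> = 2 ^ r * (q h + 2)"
          by simp
        also have "\<dots> \<le> 2 ^ r * (2 * 2 ^ b)"
        proof (rule mult_left_mono)
          have "q h < 2 ^ b" "1 \<le> (2 :: nat) ^ b"
            unfolding b_def by (auto intro: less_power_bit_length)
          then show "q h + 2 \<le> 2 * 2 ^ b"
            by linarith
        qed simp
        also have "\<dots> = 2 ^ L"
          by (simp add: L_def power_add)
        finally show ?thesis .
      qed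
      then have "i < 2 ^ L" if "i \<in> poly_support (Q h * [:1, 1:] ^ (2 ^ r * q h))" for i
        using poly_support_subset that by (meson atMost_iff le_less_trans subsetD)
      then have K: "K \<subseteq> {c..<c + 2 ^ L}"
        by (auto simp: K_def shifted_support_def)
      have heavy_h: "C / \<alpha> \<le> real (card K) * \<alpha> ^ b"
      proof -
        have bS: "bit_length (q h) \<le> bit_length (Suc (q h))"
          using less_power_bit_length[of "Suc (q h)"] by (intro bit_length_le) simp
        have "2 ^ ones (Suc (q h)) * \<alpha> ^ bit_length (Suc (q h)) \<le> 2 ^ ones (Suc (q h)) * \<alpha> ^ b"
          using \<alpha> bS by (intro mult_left_mono power_decreasing) (auto simp: b_def)
        moreover have two: "C / \<alpha> \<le> 2 ^ ones (q h) * \<alpha> ^ b" "C / \<alpha> \<le> 2 ^ ones (Suc (q h)) * \<alpha> ^ bit_length (Suc (q h))"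
          using m h elim by (auto simp: b_def)
        ultimately have "C / \<alpha> \<le> 2 ^ ones (Suc (q h)) * \<alpha> ^ b"
          by linarith
        have "min (2 ^ ones (q h)) (2 ^ ones (Suc (q h))) \<le> card K"
          unfolding K_def card_shifted_support using Q by (rule weight_mult_power_ge)
        then have "2 ^ ones (q h) \<le> card K \<or> 2 ^ ones (Suc (q h)) \<le> card K"
          by linarith
        then have "2 ^ ones (q h) \<le> real (card K) \<or> 2 ^ ones (Suc (q h)) \<le> real (card K)"
          by (metis of_nat_le_iff of_nat_numeral of_nat_power)
        then have "2 ^ ones (q h) * \<alpha> ^ b \<le> real (card K) * \<alpha> ^ b \<or> 2 ^ ones (Suc (q h)) * \<alpha> ^ b \<le> real (card K) * \<alpha> ^ b"
          using \<alpha> by (auto intro: mult_right_mono)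
        with two(1) \<open>C / \<alpha> \<le> 2 ^ ones (Suc (q h)) * \<alpha> ^ b\<close> show ?thesis
          by linarith
      qed
      have "C \<le> C / \<alpha>"
        using C(2) \<alpha> by (simp add: field_simps mult_left_le)
      with heavy_h have "C \<le> real (card K) * \<alpha> ^ b"
        by linarith
      then have "2 * \<alpha> ^ s * C \<le> 2 * \<alpha> ^ s * (real (card K) * \<alpha> ^ b)"
        using \<alpha> by (intro mult_left_mono) auto
      also have "\<dots> = 2 * \<alpha> ^ (L + 2 * M) * card K"
        by (simp add: s_def L_def power_add mult_ac)
      finally have "1 / (1 + 2 * \<alpha> ^ (L + 2 * M) * card K) \<le> 1 / (1 + 2 * \<alpha> ^ s * C)"
        using C(2) \<alpha> by (intro divide_left_mono mult_pos_pos add_pos_nonneg) auto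
      with walsh_integral_le[OF \<alpha> small K, of M] M C(1)
      show "dist (\<integral>a. walsh (shifted_support c (Q h * [:1, 1:] ^ (2 ^ r * q h))) a \<partial>limit_law \<alpha>) 0 < e"
        unfolding K_def[symmetric] dist_real_def by linarith
    qed
  qed
qed

lemma integrable_local:
  fixes f :: "config \<Rightarrow> real"
  assumes "prob_space M" "sets M = sets borel" "finite F" "local_at F f"
  shows "integrable M f"
proof -
  interpret prob_space M by fact
  obtain B where "\<And>a. \<bar>f a\<bar> \<le> B"
    using local_bounded[OF assms(3,4)] by blast
  moreover have "f \<in> borel_measurable M"
    using borel_measurable_local[OF assms(3,4)] measurable_cong_sets[OF assms(2) refl] by blast
  ultimately show ?thesis
    by (intro integrable_const_bound[of _ B]) auto
qed

lemma continuous_Phi: "continuous_on UNIV Phi"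
proof -
  have "continuous_on UNIV (\<lambda>a. Phi a k)" for k
    by (rule continuous_local[of "{k, k + 1}"]) (auto simp: local_at_def Phi_def config_shift_def)
  then show ?thesis
    by (rule continuous_on_coordinatewise_then_product)
qed

lemma measurable_Phi_power: "Phi ^^ h \<in> borel \<rightarrow>\<^sub>M borel"
  by (rule measurable_compose_n) (rule borel_measurable_continuous_onI[OF continuous_Phi])

lemma prob_space_haar: "prob_space haar" and sets_haar: "sets haar = sets borel"
proof -
  have "(\<lambda>a :: config. a) \<in> PiM UNIV (\<lambda>_. measure_pmf (pmf_of_set UNIV)) \<rightarrow>\<^sub>M borel"
    using measurable_ident_sets[OF sets_PiM_eq_borel_config] by simp
  then show "prob_space haar"
    unfolding haar_def by (intro prob_space.prob_space_distr prob_space_PiM) (auto simp: prob_space_measure_pmf)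
qed (simp add: haar_def)

lemma integral_walsh_haar:
  assumes "finite K"
  shows "(\<integral>a. walsh K a \<partial>haar) = (if K = {} then 1 else 0)"
proof -
  let ?u = "measure_pmf (pmf_of_set (UNIV :: bit set))"
  interpret U: product_prob_space "\<lambda>_::int. ?u" UNIV ..
  have id: "(\<lambda>a :: config. a) \<in> PiM UNIV (\<lambda>_. ?u) \<rightarrow>\<^sub>M borel"
    using measurable_ident_sets[OF sets_PiM_eq_borel_config] by simp
  have "(\<integral>a. walsh K a \<partial>haar) = (\<integral>a. walsh K a \<partial>PiM UNIV (\<lambda>_. ?u))"
    unfolding haar_def by (rule integral_distr[OF id borel_measurable_local[OF assms local_at_walsh]])
  also have "\<dots> = (\<integral>a. walsh K (restrict a K) \<partial>PiM UNIV (\<lambda>_. ?u))"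
    by (simp add: walsh_def)
  also have "\<dots> = (\<integral>a. walsh K a \<partial>distr (PiM UNIV (\<lambda>_. ?u)) (PiM K (\<lambda>_. ?u)) (\<lambda>a. restrict a K))"
  proof (rule integral_distr[symmetric])
    show "(\<lambda>a. restrict a K) \<in> PiM UNIV (\<lambda>_. ?u) \<rightarrow>\<^sub>M PiM K (\<lambda>_. ?u)"
      by (rule measurable_restrict_subset) simp
    have "(\<lambda>a. bit_sign (a k)) \<in> borel_measurable (PiM K (\<lambda>_. ?u))" if "k \<in> K" for k
      by (rule measurable_compose[OF measurable_component_singleton[OF that]]) simp
    then show "walsh K \<in> borel_measurable (PiM K (\<lambda>_. ?u))"
      unfolding walsh_def[abs_def] by (intro borel_measurable_prod)
  qed
  also have "\<dots> = (\<integral>a. walsh K a \<partial>PiM K (\<lambda>_. ?u))"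
    using assms by (subst U.distr_PiM_restrict_finite) auto
  also have "\<dots> = (\<Prod>k\<in>K. \<integral>b. bit_sign b \<partial>?u)"
    unfolding walsh_def using assms
    by (intro U.product_integral_prod integrable_measure_pmf_finite) auto
  also have "(\<integral>b. bit_sign b \<partial>?u) = 0"
    by (subst integral_pmf_of_set) (simp_all add: UNIV_bit)
  finally show ?thesis
    using assms by (simp add: prod_constant card_gt_0_iff power_0_left)
qed

text \<open>
  The iterate \<open>h * 2 ^ r\<close> multiplies by \<open>(1 + x) ^ (2 ^ r * h)\<close>, and the polynomial of the character has
  degree at most \<open>2 ^ r\<close> by the choice of the scale.
\<close>

lemma Lucas_mixing_limit_law:
  assumes \<alpha>: "1 / sqrt 2 < \<alpha>" "\<alpha> < 1"
  shows "Lucas_mixing (limit_law \<alpha>)"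
  unfolding Lucas_mixing_def
proof (intro allI impI)
  fix \<xi> :: "config \<Rightarrow> complex" assume "nontrivial_character \<xi>"
  then have "is_character \<xi>" "\<xi> \<noteq> (\<lambda>_. 1)"
    by (auto simp: nontrivial_character_def)
  then obtain K where K: "finite K" "\<xi> = (\<lambda>a. complex_of_real (walsh K a))"
    using character_eq_walsh by blast
  with \<open>\<xi> \<noteq> (\<lambda>_. 1)\<close> have "K \<noteq> {}"
    by auto
  have \<alpha>0: "0 < \<alpha>"
    using \<alpha>(1) by (rule less_trans[rotated]) simp
  obtain r where r: "character_scale \<xi> = 2 ^ r" "nat (Max K - Min K) \<le> 2 ^ r"
    using character_scale_walsh[OF K(1)] unfolding K(2) by blast
  obtain p where p: "p \<noteq> 0" "degree p = nat (Max K - Min K)"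
    "\<forall>h a. walsh K ((Phi ^^ h) a) = walsh (shifted_support (Min K) (p * [:1, 1:] ^ h)) a"
    using K(1) \<open>K \<noteq> {}\<close> by (rule walsh_as_poly)
  obtain J where J: "cesaro_density_one J"
    "\<And>r C. \<exists>m. \<forall>h\<in>J. m \<le> h \<longrightarrow> C \<le> 2 ^ ones (h div 2 ^ r) * \<alpha> ^ bit_length (h div 2 ^ r)
        \<and> C \<le> 2 ^ ones (Suc (h div 2 ^ r)) * \<alpha> ^ bit_length (Suc (h div 2 ^ r))"
    using density_one_all_quotients_many_ones[OF \<alpha>] by blast
  have "((\<lambda>h. \<integral>a. walsh (shifted_support (Min K) (p * [:1, 1:] ^ (2 ^ r * h))) a \<partial>limit_law \<alpha>) \<longlongrightarrow> 0)
      (inf sequentially (principal J))"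
  proof (rule walsh_decay_along_heavy_powers[OF \<alpha>0 \<alpha>(2), where q = "\<lambda>h. h" and Q = "\<lambda>_. p"])
    show "degree p < 2 * 2 ^ r"
      unfolding p(2) using r(2) by (rule le_less_trans) simp
    show "\<exists>m. \<forall>h\<in>J. m \<le> h \<longrightarrow> C \<le> 2 ^ ones h * \<alpha> ^ bit_length h \<and> C \<le> 2 ^ ones (Suc h) * \<alpha> ^ bit_length (Suc h)" for C
      using J(2)[of C 0] by simp
  qed (use p(1) in \<open>auto simp: filterlim_ident\<close>)
  then have "((\<lambda>h. complex_of_real (\<integral>a. walsh K ((Phi ^^ (h * character_scale \<xi>)) a) \<partial>limit_law \<alpha>)) \<longlongrightarrow> complex_of_real 0)
      (inf sequentially (principal J))"
    unfolding p(3)[rule_format] r(1) by (intro tendsto_of_real) (simp only: mult.commute[of _ "2 ^ r"])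
  then show "\<exists>H. cesaro_density_one H \<and>
      ((\<lambda>h. \<integral>a. \<xi> ((Phi ^^ (h * character_scale \<xi>)) a) \<partial>limit_law \<alpha>) \<longlongrightarrow> 0) (inf sequentially (principal H))"
    using J(1) by (intro exI[of _ J]) (simp add: K(2))
qed

text \<open>
  With \<open>2 ^ r\<close> larger than the degree of \<open>p\<close>, the part \<open>(1 + x) ^ (j mod 2 ^ r)\<close> of
  \<open>(1 + x) ^ j\<close> is absorbed into \<open>p\<close>, and the remaining power has the exponent
  \<open>2 ^ r * (j div 2 ^ r)\<close>. The set of times does not depend on \<open>r\<close>.
\<close>

lemma asymptotically_randomizes_limit_law:
  assumes \<alpha>: "1 / sqrt 2 < \<alpha>" "\<alpha> < 1"
  shows "asymptotically_randomizes Phi (limit_law \<alpha>)"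
proof -
  have \<alpha>0: "0 < \<alpha>"
    using \<alpha>(1) by (rule less_trans[rotated]) simp
  obtain J where J: "cesaro_density_one J"
    "\<And>r C. \<exists>m. \<forall>h\<in>J. m \<le> h \<longrightarrow> C \<le> 2 ^ ones (h div 2 ^ r) * \<alpha> ^ bit_length (h div 2 ^ r)
        \<and> C \<le> 2 ^ ones (Suc (h div 2 ^ r)) * \<alpha> ^ bit_length (Suc (h div 2 ^ r))"
    using density_one_all_quotients_many_ones[OF \<alpha>] by blast
  let ?F = "inf sequentially (principal J)"
  let ?N = "\<lambda>j. distr (limit_law \<alpha>) borel (Phi ^^ j)"
  let ?P = "\<lambda>f. (\<exists>G. finite G \<and> local_at G f) \<and> ((\<lambda>j. \<integral>a. f a \<partial>?N j) \<longlongrightarrow> (\<integral>a. f a \<partial>haar)) ?F"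
  have meas: "Phi ^^ j \<in> limit_law \<alpha> \<rightarrow>\<^sub>M borel" for j
    using measurable_Phi_power measurable_cong_sets[OF sets_limit_law refl] by blast
  have prob: "prob_space (?N j)" for j
    by (rule prob_space.prob_space_distr[OF prob_space_limit_law meas])
  have walsh: "((\<lambda>j. \<integral>a. walsh K a \<partial>?N j) \<longlongrightarrow> (\<integral>a. walsh K a \<partial>haar)) ?F" if K: "finite K" for K
  proof (cases "K = {}")
    case True
    have "(\<integral>a. 1 \<partial>?N j) = (1 :: real)" for j
      using prob_space.prob_space[OF prob[of j]] by simp
    then show ?thesis
      using integral_walsh_haar[OF K] True by simp
  next
    case False
    obtain p where p: "p \<noteq> 0" and "degree p = nat (Max K - Min K)"
      and walsh_p: "\<forall>h a. walsh K ((Phi ^^ h) a) = walsh (shifted_support (Min K) (p * [:1, 1:] ^ h)) a"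
      using K False by (rule walsh_as_poly)
    define r where "r = degree p"
    let ?Q = "\<lambda>j. p * [:1, 1:] ^ (j mod 2 ^ r)"
    have "((\<lambda>j. \<integral>a. walsh (shifted_support (Min K) (?Q j * [:1, 1:] ^ (2 ^ r * (j div 2 ^ r)))) a
        \<partial>limit_law \<alpha>) \<longlongrightarrow> 0) ?F"
    proof (rule walsh_decay_along_heavy_powers[OF \<alpha>0 \<alpha>(2) _ _ J(2)])
      fix j
      show "?Q j \<noteq> 0"
        using p by (simp only: mult_eq_0_iff power_eq_0_iff) simp
      have "degree ([:1, 1:] ^ (j mod 2 ^ r) :: bit poly) \<le> 1 * (j mod 2 ^ r)"
        by (rule order_trans[OF degree_power_le]) simp
      moreover have "j mod 2 ^ r < 2 ^ r"
        by simp
      moreover have "degree p < 2 ^ r"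
        by (simp add: r_def)
      ultimately show "degree (?Q j) < 2 * 2 ^ r"
        using degree_mult_le[of p "[:1, 1:] ^ (j mod 2 ^ r)"] by linarith
    next
      show "filterlim (\<lambda>j. j div 2 ^ r :: nat) at_top sequentially"
        by (rule filterlim_at_top_div_const_nat) simp
    qed
    also have "(\<lambda>j. \<integral>a. walsh (shifted_support (Min K) (?Q j * [:1, 1:] ^ (2 ^ r * (j div 2 ^ r)))) a \<partial>limit_law \<alpha>)
        = (\<lambda>j. \<integral>a. walsh K a \<partial>?N j)"
    proof
      fix j
      have "?Q j * [:1, 1:] ^ (2 ^ r * (j div 2 ^ r)) = p * [:1, 1:] ^ j"
        by (simp only: mult.assoc power_add[symmetric] mod_mult_div_eq)
      then show "(\<integral>a. walsh (shifted_support (Min K) (?Q j * [:1, 1:] ^ (2 ^ r * (j div 2 ^ r)))) a \<partial>limit_law \<alpha>)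
          = (\<integral>a. walsh K a \<partial>?N j)"
        unfolding integral_distr[OF meas borel_measurable_local[OF K local_at_walsh]] walsh_p[rule_format] by (simp only:)
    qed
    finally show ?thesis
      using integral_walsh_haar[OF K] False by simp
  qed
  have "weak_star_converges ?N haar ?F"
  proof (rule weak_star_converges_if_local)
    fix f :: "config \<Rightarrow> real" and F assume F: "finite F" "local_at F f"
    have "?P f"
    proof (rule local_walsh_induct[OF F])
      show "?P (walsh K)"
        if "finite K" for K
        using walsh[OF that] local_at_walsh that by blast
    next
      fix c d :: real and f g :: "config \<Rightarrow> real"
      assume f: "?P f"
        and g: "?P g"
      obtain A B where AB: "finite A" "local_at A f" "finite B" "local_at B g"
        using f g by blast
      have "local_at (A \<union> B) (\<lambda>x. c * f x + d * g x)"
        using local_at_mono[OF AB(2), of "A \<union> B"] local_at_mono[OF AB(4), of "A \<union> B"]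
        by (intro local_at_comp2[where h = "\<lambda>u v. c * u + d * v"]) auto
      then have "\<exists>G. finite G \<and> local_at G (\<lambda>x. c * f x + d * g x)"
        using AB by blast
      moreover have lin: "(\<integral>a. c * f a + d * g a \<partial>M) = c * (\<integral>a. f a \<partial>M) + d * (\<integral>a. g a \<partial>M)"
        if "prob_space M" "sets M = sets borel" for M
        using integrable_local[OF that AB(1,2)] integrable_local[OF that AB(3,4)] by simp
      have "((\<lambda>j. c * (\<integral>a. f a \<partial>?N j) + d * (\<integral>a. g a \<partial>?N j)) \<longlongrightarrow> c * (\<integral>a. f a \<partial>haar) + d * (\<integral>a. g a \<partial>haar)) ?F"
        using f g by (intro tendsto_intros) auto
      then have "((\<lambda>j. \<integral>a. c * f a + d * g a \<partial>?N j) \<longlongrightarrow> (\<integral>a. c * f a + d * g a \<partial>haar)) ?F"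
        by (simp add: lin prob prob_space_haar sets_haar)
      ultimately show "?P (\<lambda>x. c * f x + d * g x)"
        by blast
    qed
    then show "((\<lambda>j. \<integral>a. f a \<partial>?N j) \<longlongrightarrow> (\<integral>a. f a \<partial>haar)) ?F"
      by blast
  qed (simp_all add: prob prob_space_haar sets_haar)
  with J(1) show ?thesis
    unfolding asymptotically_randomizes_def by blast
qed

theorem mainTheorem8:
  fixes \<alpha> :: real
  assumes "1 / sqrt 2 < \<alpha>" and "\<alpha> < 1"
  shows "ks_entropy (mu \<alpha>) config_shift = 0 \<and> Lucas_mixing (mu \<alpha>) \<and> asymptotically_randomizes Phi (mu \<alpha>)"
proof -
  have "0 < \<alpha>"
    using assms(1) by (rule less_trans[rotated]) simp
  then show ?thesis
    using assms mu_eq_limit_law[of \<alpha>] ks_entropy_limit_law[of \<alpha>] Lucas_mixing_limit_law[of \<alpha>]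
      asymptotically_randomizes_limit_law[of \<alpha>] by simp
qed

end
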